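(* Let $H\Gamma=(V,E,r,s)$ be a finite hypergraph and let $w\in V$ be a vertex that emits exactly one edge $f$ and such that only one vertex $x\neq w$ emits to $w$. Assume that $H\Gamma$ is locally ultra at $w$ (so $s(f)=\{w\}$), and that every $e\in E$ with $w\in r(e)$ satisfies $r(e)=\{w\}$. Let $H\Gamma_R$ be the hypergraph obtained from $H\Gamma$ by move R at $w$. Then there is a $*$-homomorphism $\pi:C^*(H\Gamma_R)\to C^*(H\Gamma)$ such that the $*$-subalgebra $\mathrm{Im}(\pi)$ is a full corner in $C^*(H\Gamma)$.
   Context: A (finite directed) hypergraph $H\Gamma=(V,E,r,s)$ consists of finite sets $V$ (vertices) and $E$ (edges) and maps $r,s:E\to\mathcal P(V)\setminus\{\emptyset\}$ (range and source), where $\mathcal P(V)$ is the power set. A vertex $v$ is a sink if $v\notin s(e)$ for all $e\in E$. The hypergraph $C^*$-algebra $C^*(H\Gamma)$ is the universal $C^*$-algebra generated by mutually orthogonal projections $p_v$ ($v\in V$) and partial isometries $s_e$ ($e\in E$) such that: (HR1) $s_e^*s_f=\delta_{ef}\sum_{v\in r(e)}p_v$ for all $e,f\in E$; (HR2a) $s_es_e^*\le\sum_{v\in s(e)}p_v$ for all $e\in E$; (HR2b) $p_v\le\sum_{e\in E,\,v\in s(e)}s_es_e^*$ for all $v\in V$ that are not sinks. A vertex $v$ emits $e\in E$ if $v\in s(e)$, and $v$ emits to $w$ if there is $e\in E$ with $v\in s(e)$ and $w\in r(e)$. $H\Gamma$ is locally ultra at $w$ if for all $e\in E$, $w\in s(e)$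 implies $s(e)=\{w\}$. Move R at $w$, where $w$ emits exactly one edge $f$ and only one vertex $x\ne w$ emits to $w$, produces $H\Gamma_R=(V_R,E_R,r_R,s_R)$ with $V_R=V\setminus\{w\}$; $E_R=\big(E\setminus(\{e\in E\mid r(e)=\{w\}\}\cup\{f\})\big)\cup\{e_f\mid e\in E,\ r(e)=\{w\}\}$, where the $e_f$ are new edges; $s_R(e)=s(e)$, $s_R(e_f)=s(e)$; $r_R(e)=r(e)$, $r_R(e_f)=(r(e)\setminus\{w\})\cup r(f)$. A corner of a $C^*$-algebra $A$ is a subalgebra $pAp$ with $p$ a projection (in $A$ or its multiplier algebra); it is full if it is not contained in any proper closed two-sided ideal of $A$. *)

theory Defs
  imports "HOL-Analysis.Analysis" "HOL-Algebra.Module"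
begin

section \<open>C*-algebras\<close>

definition complex_ring :: "complex ring" where
  "complex_ring = \<lparr>carrier = UNIV, monoid.mult = (*), one = 1, ring.zero = 0, add = (+)\<rparr>"

text \<open>
  The universal property of a universal C*-algebra quantifies over C*-algebras, so these are
  record structures rather than a type class. The record inherits a field \<open>one\<close> from
  \<^theory>\<open>HOL-Algebra.Ring\<close>; it is never used, because C*-algebras and *-homomorphisms need not
  be unital.
\<close>

record 'a star_algebra = "(complex, 'a) module" +
  star :: "'a \<Rightarrow> 'a"
  cnorm :: "'a \<Rightarrow> real"

text \<open>
  The locale \<open>Metric_space\<close> demands symmetry and non-negativity of the distance also off the
  carrier, where the norm is arbitrary; hence the guard.
\<close>

definition cdist :: "'a star_algebra \<Rightarrow> 'a \<Rightarrow> 'a \<Rightarrow> real" where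
  "cdist A x y = (if x \<in> carrier A \<and> y \<in> carrier A then cnorm A (x \<ominus>\<^bsub>A\<^esub> y) else 0)"

locale cstar_algebra = module complex_ring A
  for A :: "'a star_algebra" (structure) +
  assumes mult_closed: "\<lbrakk>x \<in> carrier A; y \<in> carrier A\<rbrakk> \<Longrightarrow> x \<otimes> y \<in> carrier A"
    and mult_assoc: "\<lbrakk>x \<in> carrier A; y \<in> carrier A; z \<in> carrier A\<rbrakk>
      \<Longrightarrow> (x \<otimes> y) \<otimes> z = x \<otimes> (y \<otimes> z)"
    and mult_add_left: "\<lbrakk>x \<in> carrier A; y \<in> carrier A; z \<in> carrier A\<rbrakk>
      \<Longrightarrow> (x \<oplus> y) \<otimes> z = x \<otimes> z \<oplus> y \<otimes> z"
    and mult_add_right: "\<lbrakk>x \<in> carrier A; y \<in> carrier A; z \<in> carrier A\<rbrakk>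
      \<Longrightarrow> x \<otimes> (y \<oplus> z) = x \<otimes> y \<oplus> x \<otimes> z"
    and smult_mult_left: "\<lbrakk>x \<in> carrier A; y \<in> carrier A\<rbrakk> \<Longrightarrow> (c \<odot> x) \<otimes> y = c \<odot> (x \<otimes> y)"
    and smult_mult_right: "\<lbrakk>x \<in> carrier A; y \<in> carrier A\<rbrakk> \<Longrightarrow> x \<otimes> (c \<odot> y) = c \<odot> (x \<otimes> y)"
    and star_closed: "x \<in> carrier A \<Longrightarrow> star A x \<in> carrier A"
    and star_star: "x \<in> carrier A \<Longrightarrow> star A (star A x) = x"
    and star_add: "\<lbrakk>x \<in> carrier A; y \<in> carrier A\<rbrakk> \<Longrightarrow> star A (x \<oplus> y) = star A x \<oplus> star A y"
    and star_smult: "x \<in> carrier A \<Longrightarrow> star A (c \<odot> x) = cnj c \<odot> star A x"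
    and star_mult: "\<lbrakk>x \<in> carrier A; y \<in> carrier A\<rbrakk> \<Longrightarrow> star A (x \<otimes> y) = star A y \<otimes> star A x"
    and cnorm_nonneg: "x \<in> carrier A \<Longrightarrow> 0 \<le> cnorm A x"
    and cnorm_eq_0: "x \<in> carrier A \<Longrightarrow> cnorm A x = 0 \<longleftrightarrow> x = \<zero>"
    and cnorm_triangle: "\<lbrakk>x \<in> carrier A; y \<in> carrier A\<rbrakk>
      \<Longrightarrow> cnorm A (x \<oplus> y) \<le> cnorm A x + cnorm A y"
    and cnorm_smult: "x \<in> carrier A \<Longrightarrow> cnorm A (c \<odot> x) = cmod c * cnorm A x"
    and cnorm_mult: "\<lbrakk>x \<in> carrier A; y \<in> carrier A\<rbrakk>
      \<Longrightarrow> cnorm A (x \<otimes> y) \<le> cnorm A x * cnorm A y"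
    and cnorm_star_mult: "x \<in> carrier A \<Longrightarrow> cnorm A (star A x \<otimes> x) = (cnorm A x)\<^sup>2"
    and complete: "Metric_space.mcomplete (carrier A) (cdist A)"

lemma (in cstar_algebra) Metric_space_cdist: "Metric_space (carrier A) (cdist A)"
proof
  have neg: "\<ominus> x = (-1) \<odot> x" if "x \<in> carrier A" for x
  proof -
    have "(1 + (-1)) \<odot> x = 1 \<odot> x \<oplus> (-1) \<odot> x"
      using smult_l_distr[of 1 "-1" x] that by (simp add: complex_ring_def)
    moreover have "(0::complex) \<odot> x = \<zero>"
      using smult_l_null[of x] that by (simp add: complex_ring_def)
    moreover have "1 \<odot> x = x"
      using smult_one[of x] that by (simp add: complex_ring_def)
    moreover have "(-1) \<odot> x \<in> carrier A"
      using that smult_closed[of "-1" x] by (simp add: complex_ring_def)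
    ultimately show ?thesis
      using M.minus_equality[of "(-1) \<odot> x" x] that by (simp add: M.a_comm)
  qed
  fix x y z
  show "0 \<le> cdist A x y" by (auto simp: cdist_def intro: cnorm_nonneg M.minus_closed)
  show "cdist A x y = cdist A y x"
  proof (cases "x \<in> carrier A \<and> y \<in> carrier A")
    case True
    then have "y \<ominus> x = \<ominus> (x \<ominus> y)"
      by (simp add: a_minus_def M.minus_add M.a_comm)
    with True show ?thesis
      using cnorm_smult[of "x \<ominus> y" "-1"] by (simp add: cdist_def neg M.minus_closed)
  qed (auto simp: cdist_def)
  show "cdist A x y = 0 \<longleftrightarrow> x = y" if "x \<in> carrier A" "y \<in> carrier A"
  proof -
    have "x \<ominus> y = \<zero> \<longleftrightarrow> x = y"
      using that M.minus_equality[of x "\<ominus> y"] by (auto simp: a_minus_def M.r_neg)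
    with that show ?thesis by (simp add: cdist_def cnorm_eq_0 M.minus_closed)
  qed
  assume *: "x \<in> carrier A" "y \<in> carrier A" "z \<in> carrier A"
  then have "x \<ominus> z = (x \<ominus> y) \<oplus> (y \<ominus> z)"
    by (simp add: a_minus_def M.a_assoc M.r_neg1)
  with * show "cdist A x z \<le> cdist A x y + cdist A y z"
    using cnorm_triangle[of "x \<ominus> y" "y \<ominus> z"] by (simp add: cdist_def M.minus_closed)
qed

definition calg_closed :: "'a star_algebra \<Rightarrow> 'a set \<Rightarrow> bool" where
  "calg_closed A S \<longleftrightarrow> closedin (Metric_space.mtopology (carrier A) (cdist A)) S"

definition cstar_hom :: "'a star_algebra \<Rightarrow> 'b star_algebra \<Rightarrow> ('a \<Rightarrow> 'b) \<Rightarrow> bool" where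
  "cstar_hom A B h \<longleftrightarrow>
     (\<forall>x\<in>carrier A. h x \<in> carrier B) \<and>
     (\<forall>x\<in>carrier A. \<forall>y\<in>carrier A. h (x \<oplus>\<^bsub>A\<^esub> y) = h x \<oplus>\<^bsub>B\<^esub> h y) \<and>
     (\<forall>c. \<forall>x\<in>carrier A. h (c \<odot>\<^bsub>A\<^esub> x) = c \<odot>\<^bsub>B\<^esub> h x) \<and>
     (\<forall>x\<in>carrier A. \<forall>y\<in>carrier A. h (x \<otimes>\<^bsub>A\<^esub> y) = h x \<otimes>\<^bsub>B\<^esub> h y) \<and>
     (\<forall>x\<in>carrier A. h (star A x) = star B (h x))"

definition linear_subspace :: "'a star_algebra \<Rightarrow> 'a set \<Rightarrow> bool" where
  "linear_subspace A S \<longleftrightarrow>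
     S \<subseteq> carrier A \<and> \<zero>\<^bsub>A\<^esub> \<in> S \<and>
     (\<forall>x\<in>S. \<forall>y\<in>S. x \<oplus>\<^bsub>A\<^esub> y \<in> S) \<and> (\<forall>c. \<forall>x\<in>S. c \<odot>\<^bsub>A\<^esub> x \<in> S)"

definition cstar_subalgebra :: "'a star_algebra \<Rightarrow> 'a set \<Rightarrow> bool" where
  "cstar_subalgebra A S \<longleftrightarrow>
     linear_subspace A S \<and> (\<forall>x\<in>S. \<forall>y\<in>S. x \<otimes>\<^bsub>A\<^esub> y \<in> S) \<and> (\<forall>x\<in>S. star A x \<in> S) \<and>
     calg_closed A S"

definition generates :: "'a star_algebra \<Rightarrow> 'a set \<Rightarrow> bool" where
  "generates A G \<longleftrightarrow>
     G \<subseteq> carrier A \<and> (\<forall>S. cstar_subalgebra A S \<and> G \<subseteq> S \<longrightarrow> S = carrier A)"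

definition closed_ideal :: "'a star_algebra \<Rightarrow> 'a set \<Rightarrow> bool" where
  "closed_ideal A I \<longleftrightarrow>
     linear_subspace A I \<and>
     (\<forall>a\<in>carrier A. \<forall>x\<in>I. a \<otimes>\<^bsub>A\<^esub> x \<in> I \<and> x \<otimes>\<^bsub>A\<^esub> a \<in> I) \<and>
     calg_closed A I"

text \<open>The order of a C*-algebra, whose positive elements are the elements of the form \<open>c*c\<close>.\<close>

definition cstar_le :: "'a star_algebra \<Rightarrow> 'a \<Rightarrow> 'a \<Rightarrow> bool" where
  "cstar_le A a b \<longleftrightarrow>
     a \<in> carrier A \<and> b \<in> carrier A \<and> (\<exists>c\<in>carrier A. b \<ominus>\<^bsub>A\<^esub> a = star A c \<otimes>\<^bsub>A\<^esub> c)"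

definition projection :: "'a star_algebra \<Rightarrow> 'a \<Rightarrow> bool" where
  "projection A p \<longleftrightarrow> p \<in> carrier A \<and> star A p = p \<and> p \<otimes>\<^bsub>A\<^esub> p = p"

definition partial_isometry :: "'a star_algebra \<Rightarrow> 'a \<Rightarrow> bool" where
  "partial_isometry A s \<longleftrightarrow> s \<in> carrier A \<and> s \<otimes>\<^bsub>A\<^esub> star A s \<otimes>\<^bsub>A\<^esub> s = s"

text \<open>
  Corners are only needed for the algebras of finite hypergraphs. These are unital, with unit the
  sum of all vertex projections, and hence equal to their multiplier algebras, so that it suffices
  to cut down by projections in the algebra itself.
\<close>

definition corner :: "'a star_algebra \<Rightarrow> 'a set \<Rightarrow> bool" where
  "corner A C \<longleftrightarrow> (\<exists>p. projection A p \<and> C = {p \<otimes>\<^bsub>A\<^esub> a \<otimes>\<^bsub>A\<^esub> p | a. a \<in> carrier A})"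

definition full_corner :: "'a star_algebra \<Rightarrow> 'a set \<Rightarrow> bool" where
  "full_corner A C \<longleftrightarrow>
     corner A C \<and> (\<forall>I. closed_ideal A I \<and> C \<subseteq> I \<longrightarrow> I = carrier A)"

section \<open>Hypergraphs\<close>

record ('v, 'e) hypergraph =
  verts :: "'v set"
  edges :: "'e set"
  rng :: "'e \<Rightarrow> 'v set"
  src :: "'e \<Rightarrow> 'v set"

definition finite_hypergraph :: "('v, 'e) hypergraph \<Rightarrow> bool" where
  "finite_hypergraph H \<longleftrightarrow>
     finite (verts H) \<and> finite (edges H) \<and>
     (\<forall>e\<in>edges H. rng H e \<subseteq> verts H \<and> rng H e \<noteq> {} \<and> src H e \<subseteq> verts H \<and> src H e \<noteq> {})"

definition sink :: "('v, 'e) hypergraph \<Rightarrow> 'v \<Rightarrow> bool" where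
  "sink H v \<longleftrightarrow> (\<forall>e\<in>edges H. v \<notin> src H e)"

definition emits_to :: "('v, 'e) hypergraph \<Rightarrow> 'v \<Rightarrow> 'v \<Rightarrow> bool" where
  "emits_to H v w \<longleftrightarrow> (\<exists>e\<in>edges H. v \<in> src H e \<and> w \<in> rng H e)"

definition locally_ultra :: "('v, 'e) hypergraph \<Rightarrow> 'v \<Rightarrow> bool" where
  "locally_ultra H w \<longleftrightarrow> (\<forall>e\<in>edges H. w \<in> src H e \<longrightarrow> src H e = {w})"

text \<open>\<open>Kept e\<close> is the old edge \<open>e\<close>, and \<open>New e\<close> is the new edge \<open>e\<^sub>f\<close>.\<close>

datatype 'e move_edge = Kept 'e | New 'e

definition move_R :: "('v, 'e) hypergraph \<Rightarrow> 'v \<Rightarrow> 'e \<Rightarrow> ('v, 'e move_edge) hypergraph" where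
  "move_R H w f = \<lparr>
     verts = verts H - {w},
     edges = Kept ` (edges H - ({e \<in> edges H. rng H e = {w}} \<union> {f}))
             \<union> New ` {e \<in> edges H. rng H e = {w}},
     rng = (\<lambda>e'. case e' of Kept e \<Rightarrow> rng H e | New e \<Rightarrow> (rng H e - {w}) \<union> rng H f),
     src = (\<lambda>e'. case e' of Kept e \<Rightarrow> src H e | New e \<Rightarrow> src H e)\<rparr>"

section \<open>Hypergraph C*-algebras\<close>

definition hypergraph_family ::
    "('v, 'e) hypergraph \<Rightarrow> 'a star_algebra \<Rightarrow> ('v \<Rightarrow> 'a) \<Rightarrow> ('e \<Rightarrow> 'a) \<Rightarrow> bool" where
  "hypergraph_family H A p s \<longleftrightarrow>
     (\<forall>v\<in>verts H. projection A (p v)) \<and>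
     (\<forall>v\<in>verts H. \<forall>u\<in>verts H. v \<noteq> u \<longrightarrow> p v \<otimes>\<^bsub>A\<^esub> p u = \<zero>\<^bsub>A\<^esub>) \<and>
     (\<forall>e\<in>edges H. partial_isometry A (s e)) \<and>
     (\<forall>e\<in>edges H. \<forall>f\<in>edges H. star A (s e) \<otimes>\<^bsub>A\<^esub> s f =
        (if e = f then (\<Oplus>\<^bsub>A\<^esub>v\<in>rng H e. p v) else \<zero>\<^bsub>A\<^esub>)) \<and>
     (\<forall>e\<in>edges H. cstar_le A (s e \<otimes>\<^bsub>A\<^esub> star A (s e)) (\<Oplus>\<^bsub>A\<^esub>v\<in>src H e. p v)) \<and>
     (\<forall>v\<in>verts H. \<not> sink H v \<longrightarrow>
        cstar_le A (p v) (\<Oplus>\<^bsub>A\<^esub>e\<in>{e \<in> edges H. v \<in> src H e}. s e \<otimes>\<^bsub>A\<^esub> star A (s e)))"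

text \<open>
  \<open>is_hypergraph_algebra H A p s\<close>: the C*-algebra \<open>A\<close> together with its generators \<open>p\<close>, \<open>s\<close> is
  a model of the universal C*-algebra of \<open>H\<close>. HOL cannot quantify over all C*-algebras \<open>B\<close> of all
  types inside a formula, so the universal property is stated for those on subsets of
  \<^typ>\<open>nat \<Rightarrow> nat\<close>. This is no restriction for a finite hypergraph: the image of the universal
  *-homomorphism lies in the C*-subalgebra generated by the finitely many \<open>q v\<close>, \<open>t e\<close>, which is
  separable, hence has at most the cardinality of the continuum and is isomorphic to a C*-algebra
  carried by a subset of \<^typ>\<open>nat \<Rightarrow> nat\<close>.
\<close>

definition is_hypergraph_algebra ::
    "('v, 'e) hypergraph \<Rightarrow> 'a star_algebra \<Rightarrow> ('v \<Rightarrow> 'a) \<Rightarrow> ('e \<Rightarrow> 'a) \<Rightarrow> bool" where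
  "is_hypergraph_algebra H A p s \<longleftrightarrow>
     cstar_algebra A \<and> hypergraph_family H A p s \<and>
     generates A (p ` verts H \<union> s ` edges H) \<and>
     (\<forall>(B :: (nat \<Rightarrow> nat) star_algebra) q t.
        cstar_algebra B \<and> hypergraph_family H B q t \<longrightarrow>
        (\<exists>h. cstar_hom A B h \<and> (\<forall>v\<in>verts H. h (p v) = q v) \<and> (\<forall>e\<in>edges H. h (s e) = t e)))"

end

theory Submission
  imports Defs
begin

text \<open>
  Sending \<open>q\<^sub>v\<close> to \<open>p\<^sub>v\<close>, an old edge \<open>e\<close> to \<open>s\<^sub>e\<close> and a new edge \<open>e\<^sub>f\<close> to \<open>s\<^sub>e s\<^sub>f\<close> respects the
  relations of the modified hypergraph, because \<open>s\<^sub>f s\<^sub>f\<^sup>* = p\<^sub>w\<close>; this gives \<open>\<pi>\<close>. Let \<open>P\<close> be the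
  sum of the \<open>p\<^sub>v\<close> with \<open>v \<noteq> w\<close>. The image of \<open>\<pi>\<close> is a C*-subalgebra \<open>C\<close> of the corner
  \<open>P A P\<close>, and the \<open>a\<close> for which \<open>l\<^sup>* a r\<close> lies in \<open>C\<close> for all \<open>l, r \<in> {P, s\<^sub>f}\<close> form a
  C*-subalgebra (as \<open>P + s\<^sub>f s\<^sub>f\<^sup>* = 1\<close>) containing the generators; so \<open>C\<close> is all of \<open>P A P\<close>. It is full
  since \<open>p\<^sub>w = s\<^sub>e\<^sup>* s\<^sub>e\<close> for any edge \<open>e\<close> into \<open>w\<close>.

  The analytic input is that *-homomorphisms are contractive with closed range, and that
  \<open>b - a = c\<^sup>*c\<close> implies \<open>b a = a\<close> for projections \<open>a\<close> and \<open>b\<close>. Both are obtained without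
  spectral theory by exhibiting bounded elements as real parts of unitaries.
\<close>

section \<open>Norm and algebra in a C*-algebra\<close>

text \<open>The algebras are not assumed unital and no unitization is formed: a statement about
  \<open>1 + X\<close> is made about the map \<open>z \<mapsto> z + X z\<close>, as a norm bound for
  every \<open>z\<close>. Functional calculus is replaced by Banach fixed points. A "cosine" is a
  selfadjoint \<open>a\<close> with a commuting selfadjoint companion \<open>b\<close> such that
  \<open>a^2 + (1 - b)^2 = 1\<close>. This relation is polynomial, so homomorphisms preserve it, and
  it alone bounds the norm; contractivity follows.

  The order is the main obstacle. \<open>cstar_le\<close> supplies only some \<open>c\<close> with
  \<open>b - a = c^* c\<close>, while absorption needs that \<open>y^* y = - x^* x\<close> forces
  \<open>x = 0\<close>. The usual argument compares the spectra of \<open>y^* y\<close> and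
  \<open>y y^*\<close>; here growth rates of iterates of selfadjoint maps take their place.

  A second obstacle is that the universal property speaks only about targets carried by subsets of
  \<open>nat \<Rightarrow> nat\<close>. Before it yields \<open>\<pi>\<close>, the algebra of
  \<open>H\<close> has to be copied into that type, which is possible because it has a countable
  dense subset.\<close>

context cstar_algebra
begin

lemma scalar_closed [simp, intro]: "x \<in> carrier A \<Longrightarrow> c \<odot> x \<in> carrier A"
  using smult_closed[of c x] by (simp add: complex_ring_def)

lemma scalar_add_left: "x \<in> carrier A \<Longrightarrow> (c + d) \<odot> x = c \<odot> x \<oplus> d \<odot> x"
  using smult_l_distr[of c d x] by (simp add: complex_ring_def)

lemma scalar_add_right:
  "\<lbrakk>x \<in> carrier A; y \<in> carrier A\<rbrakk> \<Longrightarrow> c \<odot> (x \<oplus> y) = c \<odot> x \<oplus> c \<odot> y"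
  using smult_r_distr[of c x y] by (simp add: complex_ring_def)

lemma scalar_scalar [simp]: "x \<in> carrier A \<Longrightarrow> c \<odot> (d \<odot> x) = (c * d) \<odot> x"
  using smult_assoc1[of c d x] by (simp add: complex_ring_def)

lemma scalar_one [simp]: "x \<in> carrier A \<Longrightarrow> 1 \<odot> x = x"
  using smult_one[of x] by (simp add: complex_ring_def)

lemma scalar_zero_left [simp]: "x \<in> carrier A \<Longrightarrow> 0 \<odot> x = \<zero>"
  using smult_l_null[of x] by (simp add: complex_ring_def)

lemma scalar_zero_right [simp]: "c \<odot> \<zero> = \<zero>"
  using smult_r_null[of c] by (simp add: complex_ring_def)

lemma uminus_eq_scalar: "x \<in> carrier A \<Longrightarrow> \<ominus> x = (-1) \<odot> x"
  using M.minus_equality[of "(-1) \<odot> x" x] scalar_add_left[of x "-1" 1] by simp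

lemma minus_eq_scalar:
  "\<lbrakk>x \<in> carrier A; y \<in> carrier A\<rbrakk> \<Longrightarrow> x \<ominus> y = x \<oplus> (-1) \<odot> y"
  by (simp add: a_minus_def uminus_eq_scalar)

declare mult_closed [simp, intro] star_closed [simp, intro] star_star [simp]
  M.minus_closed [simp, intro] smult_mult_left [simp] smult_mult_right [simp]

lemma mult_zero_left [simp]: "x \<in> carrier A \<Longrightarrow> \<zero> \<otimes> x = \<zero>"
  using smult_mult_left[of \<zero> x 0] by simp

lemma mult_zero_right [simp]: "x \<in> carrier A \<Longrightarrow> x \<otimes> \<zero> = \<zero>"
  using smult_mult_right[of x \<zero> 0] by simp

lemma star_zero [simp]: "star A \<zero> = \<zero>"
  using star_smult[of \<zero> 0] by simp

lemma star_diff: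
  "\<lbrakk>x \<in> carrier A; y \<in> carrier A\<rbrakk> \<Longrightarrow> star A (x \<ominus> y) = star A x \<ominus> star A y"
  by (simp add: minus_eq_scalar star_add star_smult)

lemma scalar_diff_right:
  "\<lbrakk>x \<in> carrier A; y \<in> carrier A\<rbrakk> \<Longrightarrow> c \<odot> (x \<ominus> y) = c \<odot> x \<ominus> c \<odot> y"
  by (simp add: minus_eq_scalar scalar_add_right)

lemma mult_diff_left:
  "\<lbrakk>x \<in> carrier A; y \<in> carrier A; z \<in> carrier A\<rbrakk> \<Longrightarrow> (x \<ominus> y) \<otimes> z = x \<otimes> z \<ominus> y \<otimes> z"
  by (simp add: minus_eq_scalar mult_add_left)

lemma mult_diff_right:
  "\<lbrakk>x \<in> carrier A; y \<in> carrier A; z \<in> carrier A\<rbrakk> \<Longrightarrow> x \<otimes> (y \<ominus> z) = x \<otimes> y \<ominus> x \<otimes> z"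
  by (simp add: minus_eq_scalar mult_add_right)

lemma diff_eq_zero_iff:
  "\<lbrakk>x \<in> carrier A; y \<in> carrier A\<rbrakk> \<Longrightarrow> x \<ominus> y = \<zero> \<longleftrightarrow> x = y"
  using M.minus_equality[of x "\<ominus> y"] by (auto simp: a_minus_def M.r_neg)

lemma diff_self [simp]: "x \<in> carrier A \<Longrightarrow> x \<ominus> x = \<zero>"
  by (simp add: diff_eq_zero_iff)

lemmas expand_simps = mult_assoc mult_add_left mult_add_right mult_diff_left mult_diff_right
  scalar_add_right scalar_diff_right star_add star_diff star_mult star_smult

end

text \<open>A linear identity is proved by \<open>lin_eqI\<close>: resolving backwards with \<open>lin_reps\<close> reads off the
  coefficients of both sides with respect to a list \<open>xs\<close> of atoms.\<close>

primrec linsum :: "'a star_algebra \<Rightarrow> 'a list \<Rightarrow> (nat \<Rightarrow> complex) \<Rightarrow> 'a" where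
  "linsum A [] c = \<zero>\<^bsub>A\<^esub>"
| "linsum A (x # xs) c = c 0 \<odot>\<^bsub>A\<^esub> x \<oplus>\<^bsub>A\<^esub> linsum A xs (\<lambda>n. c (Suc n))"

text \<open>The carrier condition sits inside the predicate so that backward resolution leaves no
  side goals; \<open>lin_eqI\<close> checks it once for the whole list of atoms.\<close>

definition lin_rep :: "'a star_algebra \<Rightarrow> 'a list \<Rightarrow> 'a \<Rightarrow> (nat \<Rightarrow> complex) \<Rightarrow> bool" where
  "lin_rep A xs x c \<longleftrightarrow> (set xs \<subseteq> carrier A \<longrightarrow> x = linsum A xs c)"

context cstar_algebra
begin

lemma linsum_closed: "set xs \<subseteq> carrier A \<Longrightarrow> linsum A xs c \<in> carrier A"
  by (induction xs arbitrary: c) auto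

lemma linsum_zero: "set xs \<subseteq> carrier A \<Longrightarrow> linsum A xs (\<lambda>n. 0) = \<zero>"
  by (induction xs) auto

lemma linsum_scale:
  "set xs \<subseteq> carrier A \<Longrightarrow> linsum A xs (\<lambda>n. k * c n) = k \<odot> linsum A xs c"
  by (induction xs arbitrary: c) (auto simp: scalar_add_right linsum_closed)

lemma linsum_add:
  "set xs \<subseteq> carrier A \<Longrightarrow> linsum A xs (\<lambda>n. c n + d n) = linsum A xs c \<oplus> linsum A xs d"
  by (induction xs arbitrary: c d) (auto simp: scalar_add_left linsum_closed M.a_ac)

lemma lin_rep_zero: "lin_rep A xs \<zero> (\<lambda>n. 0)"
  by (simp add: lin_rep_def linsum_zero)

lemma lin_rep_add:
  "\<lbrakk>lin_rep A xs x c; lin_rep A xs y d\<rbrakk> \<Longrightarrow> lin_rep A xs (x \<oplus> y) (\<lambda>n. c n + d n)"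
  by (simp add: lin_rep_def linsum_add)

lemma lin_rep_scale: "lin_rep A xs x c \<Longrightarrow> lin_rep A xs (k \<odot> x) (\<lambda>n. k * c n)"
  by (simp add: lin_rep_def linsum_scale)

lemma lin_rep_diff:
  "\<lbrakk>lin_rep A xs x c; lin_rep A xs y d\<rbrakk> \<Longrightarrow> lin_rep A xs (x \<ominus> y) (\<lambda>n. c n + (- 1) * d n)"
  using linsum_add[of xs c "\<lambda>n. (- 1) * d n"] linsum_scale[of xs "- 1" d]
  by (simp add: lin_rep_def minus_eq_scalar linsum_closed)

lemma lin_rep_hd: "lin_rep A (x # xs) x (\<lambda>n. if n = 0 then 1 else 0)"
  by (simp add: lin_rep_def linsum_zero)

lemma lin_rep_tl:
  "lin_rep A xs x c \<Longrightarrow> lin_rep A (y # xs) x (\<lambda>n. case n of 0 \<Rightarrow> 0 | Suc m \<Rightarrow> c m)"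
  by (auto simp: lin_rep_def linsum_closed)

text \<open>The order matters: \<open>lin_rep_tl\<close> matches any term over a nonempty list, so
  it may be tried only after the head has been compared with the atom.\<close>

lemmas lin_reps = lin_rep_zero lin_rep_add lin_rep_diff lin_rep_scale
  lin_rep_hd lin_rep_tl

lemma linsum_cong: "(\<And>n. n < length xs \<Longrightarrow> c n = d n) \<Longrightarrow> linsum A xs c = linsum A xs d"
proof (induction xs arbitrary: c d)
  case (Cons x xs)
  show ?case
    using Cons.prems[of 0] Cons.IH[of "\<lambda>n. c (Suc n)" "\<lambda>n. d (Suc n)"] Cons.prems[of "Suc _"]
    by simp
qed simp

lemma lin_eqI:
  assumes "lin_rep A xs x c" and "lin_rep A xs y d" and "set xs \<subseteq> carrier A"
    and "\<forall>n<length xs. c n = d n"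
  shows "x = y"
  using assms linsum_cong[of xs c d] by (simp add: lin_rep_def)

lemma cnorm_zero [simp]: "cnorm A \<zero> = 0"
  by (simp add: cnorm_eq_0)

lemma cnorm_star [simp]:
  assumes "x \<in> carrier A" shows "cnorm A (star A x) = cnorm A x"
proof -
  have *: "cnorm A x \<le> cnorm A (star A x)" if "x \<in> carrier A" for x
  proof (cases "cnorm A x = 0")
    case False
    have "(cnorm A x)\<^sup>2 \<le> cnorm A (star A x) * cnorm A x"
      using that cnorm_mult[of "star A x" x] cnorm_star_mult[of x] by simp
    with False cnorm_nonneg[OF that] show ?thesis by (simp add: power2_eq_square)
  qed (use that cnorm_nonneg[of "star A x"] in simp)
  from *[of x] *[of "star A x"] assms show ?thesis by simp
qed

lemma cnorm_scalar [simp]: "x \<in> carrier A \<Longrightarrow> cnorm A (c \<odot> x) = cmod c * cnorm A x"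
  by (rule cnorm_smult)

lemma cnorm_minus_commute:
  assumes "x \<in> carrier A" "y \<in> carrier A" shows "cnorm A (x \<ominus> y) = cnorm A (y \<ominus> x)"
proof -
  have "x \<ominus> y = (-1) \<odot> (y \<ominus> x)"
    by (rule lin_eqI[where xs = "[x, y]"], (rule lin_reps)+) (use assms in \<open>auto simp: All_less_Suc\<close>)
  with assms show ?thesis by simp
qed

lemma cnorm_triangle_diff:
  assumes "x \<in> carrier A" "y \<in> carrier A" shows "cnorm A (x \<ominus> y) \<le> cnorm A x + cnorm A y"
  using cnorm_triangle[of x "(-1) \<odot> y"] assms by (simp add: minus_eq_scalar)

lemma cnorm_diff_triangle:
  assumes "x \<in> carrier A" "y \<in> carrier A" "z \<in> carrier A"
  shows "cnorm A (x \<ominus> z) \<le> cnorm A (x \<ominus> y) + cnorm A (y \<ominus> z)"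
proof -
  have "x \<ominus> z = (x \<ominus> y) \<oplus> (y \<ominus> z)"
    by (rule lin_eqI[where xs = "[x, y, z]"], (rule lin_reps)+) (use assms in \<open>auto simp: All_less_Suc\<close>)
  with assms show ?thesis using cnorm_triangle[of "x \<ominus> y" "y \<ominus> z"] by simp
qed

lemma cnorm_le_diff:
  assumes "x \<in> carrier A" "y \<in> carrier A"
  shows "cnorm A x \<le> cnorm A y + cnorm A (x \<ominus> y)"
proof -
  have "x = y \<oplus> (x \<ominus> y)"
    by (rule lin_eqI[where xs = "[x, y]"], (rule lin_reps)+) (use assms in \<open>auto simp: All_less_Suc\<close>)
  with assms show ?thesis using cnorm_triangle[of y "x \<ominus> y"] by simp
qed

lemma cnorm_sa_square:
  assumes "x \<in> carrier A" "star A x = x" shows "cnorm A (x \<otimes> x) = (cnorm A x)\<^sup>2"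
  using cnorm_star_mult[of x] assms by simp

section \<open>Closed sets, fixed points and geometric limits\<close>

interpretation metric: Metric_space "carrier A" "cdist A"
  by (rule Metric_space_cdist)

lemma cdist_eq [simp]:
  "\<lbrakk>x \<in> carrier A; y \<in> carrier A\<rbrakk> \<Longrightarrow> cdist A x y = cnorm A (x \<ominus> y)"
  by (simp add: cdist_def)

lemma calg_closed_iff:
  "calg_closed A S \<longleftrightarrow> S \<subseteq> carrier A \<and>
     (\<forall>l\<in>carrier A. (\<forall>r>0. \<exists>x\<in>S. cnorm A (l \<ominus> x) < r) \<longrightarrow> l \<in> S)" (is "_ \<longleftrightarrow> ?R")
proof (cases "S \<subseteq> carrier A")
  case True
  have "metric.mtopology closure_of S = {l \<in> carrier A. \<forall>r>0. \<exists>x\<in>S. cnorm A (l \<ominus> x) < r}"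
    unfolding metric.metric_closure_of using True by (fastforce simp: metric.in_mball)
  moreover have "calg_closed A S \<longleftrightarrow> metric.mtopology closure_of S \<subseteq> S"
    unfolding calg_closed_def using True
    by (metis closure_of_subset_eq metric.topspace_mtopology)
  ultimately show ?thesis using True by blast
next
  case False
  then show ?thesis unfolding calg_closed_def
    by (metis closedin_subset metric.topspace_mtopology)
qed

lemma calg_closedD:
  "\<lbrakk>calg_closed A S; l \<in> carrier A; \<And>r. 0 < r \<Longrightarrow> \<exists>x\<in>S. cnorm A (l \<ominus> x) < r\<rbrakk> \<Longrightarrow> l \<in> S"
  by (auto simp: calg_closed_iff)

lemma calg_closed_singleton: "x \<in> carrier A \<Longrightarrow> calg_closed A {x}"
  unfolding calg_closed_def by (simp add: metric.Hausdorff_space_mtopology closedin_Hausdorff_sing_eq)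

lemma calg_closed_cball: "calg_closed A {x \<in> carrier A. cnorm A x \<le> r}"
  unfolding calg_closed_iff
proof (intro conjI ballI impI; clarsimp)
  fix l assume l: "l \<in> carrier A"
    and *: "\<forall>e>0. \<exists>x. x \<in> carrier A \<and> cnorm A x \<le> r \<and> cnorm A (l \<ominus> x) < e"
  show "cnorm A l \<le> r"
  proof (rule field_le_epsilon)
    fix e :: real assume "0 < e"
    with * obtain x where "x \<in> carrier A" "cnorm A x \<le> r" "cnorm A (l \<ominus> x) < e" by blast
    with cnorm_le_diff[of l x] l show "cnorm A l \<le> r + e" by linarith
  qed
qed

lemma calg_closed_Int: "\<lbrakk>calg_closed A S; calg_closed A T\<rbrakk> \<Longrightarrow> calg_closed A (S \<inter> T)"
  unfolding calg_closed_def by blast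

text \<open>Stands in for functional calculus: the square root and the rational function below are
  fixed points. A closed subset inherits completeness, so Banach's theorem can be applied on a
  ball.\<close>

lemma fixed_point:
  assumes S: "calg_closed A S" "S \<noteq> {}" and F: "\<And>x. x \<in> S \<Longrightarrow> F x \<in> S" and q: "q < 1"
    and lip: "\<And>x y. \<lbrakk>x \<in> S; y \<in> S\<rbrakk> \<Longrightarrow> cnorm A (F x \<ominus> F y) \<le> q * cnorm A (x \<ominus> y)"
  obtains x where "x \<in> S" "F x = x"
proof -
  have SA: "S \<subseteq> carrier A" using S by (auto simp: calg_closed_iff)
  then interpret sub: Submetric "carrier A" "cdist A" S by unfold_locales
  have "sub.sub.mcomplete"
    using sub.closedin_mcomplete_imp_mcomplete S(1) complete unfolding calg_closed_def by blast
  then obtain x where "x \<in> S" "F x = x"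
  proof (rule sub.sub.Banach_fixedpoint_thm)
    show "F \<in> S \<rightarrow> S" using F by blast
    show "cdist A (F x) (F y) \<le> q * cdist A x y" if "x \<in> S" "y \<in> S" for x y
      using lip[OF that] F that SA by (simp add: subset_iff)
  qed (use S(2) q in auto)
  then show thesis by (rule that)
qed

lemma geometric_limit:
  assumes \<sigma>: "\<And>n. \<sigma> n \<in> carrier A"
    and step: "\<And>n. cnorm A (\<sigma> (Suc n) \<ominus> \<sigma> n) \<le> C * (1/2) ^ n"
  obtains l where "l \<in> carrier A" "\<And>n. cnorm A (l \<ominus> \<sigma> n) \<le> 2 * C * (1/2) ^ n"
proof -
  have C: "0 \<le> C" using step[of 0] cnorm_nonneg[of "\<sigma> (Suc 0) \<ominus> \<sigma> 0"] \<sigma> by simp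
  \<comment> \<open>The factor \<open>1 - (1/2) ^ k\<close> keeps the exact partial geometric sum;
    the bound without it would not be inductive.\<close>
  have tail: "cnorm A (\<sigma> (n + k) \<ominus> \<sigma> n) \<le> 2 * C * (1/2) ^ n * (1 - (1/2) ^ k)" for n k
  proof (induction k)
    case 0
    then show ?case using \<sigma>[of n] by simp
  next
    case (Suc k)
    have "cnorm A (\<sigma> (n + Suc k) \<ominus> \<sigma> n)
        \<le> C * (1/2) ^ (n + k) + 2 * C * (1/2) ^ n * (1 - (1/2) ^ k)"
      using cnorm_diff_triangle[of "\<sigma> (n + Suc k)" "\<sigma> (n + k)" "\<sigma> n"] step[of "n + k"] Suc \<sigma>
      by simp
    also have "\<dots> = 2 * C * (1/2) ^ n * (1 - (1/2) ^ Suc k)"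
      by (simp add: power_add algebra_simps)
    finally show ?case .
  qed
  have tail': "cnorm A (\<sigma> m \<ominus> \<sigma> n) \<le> 2 * C * (1/2) ^ n" if "n \<le> m" for m n
  proof -
    have "2 * C * (1/2) ^ n * (1 - (1/2) ^ (m - n)) \<le> 2 * C * (1/2) ^ n"
      using C by (simp add: mult_left_le)
    with tail[of n "m - n"] that show ?thesis by simp
  qed
  have "metric.MCauchy \<sigma>"
    unfolding metric.MCauchy_def
  proof (intro conjI allI impI)
    show "range \<sigma> \<subseteq> carrier A" using \<sigma> by blast
    fix e :: real assume "0 < e"
    have "(\<lambda>n. 2 * C * (1/2) ^ n) \<longlonglongrightarrow> 2 * C * 0"
      by (intro tendsto_intros) auto
    then have "\<forall>\<^sub>F n in sequentially. 2 * C * (1/2) ^ n < e"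
      using \<open>0 < e\<close> by (simp add: order_tendsto_iff)
    then obtain N where N: "\<And>n. N \<le> n \<Longrightarrow> 2 * C * (1/2) ^ n < e"
      by (auto simp: eventually_sequentially)
    show "\<exists>N. \<forall>n n'. N \<le> n \<longrightarrow> N \<le> n' \<longrightarrow> cdist A (\<sigma> n) (\<sigma> n') < e"
    proof (intro exI allI impI)
      fix n n' assume "N \<le> n" "N \<le> n'"
      then show "cdist A (\<sigma> n) (\<sigma> n') < e"
        using tail'[of n n'] tail'[of n' n] N[of n] N[of n'] cnorm_minus_commute[OF \<sigma>[of n] \<sigma>[of n']]
        unfolding cdist_eq[OF \<sigma>[of n] \<sigma>[of n']] by linarith
    qed
  qed
  then obtain l where lim: "limitin metric.mtopology \<sigma> l sequentially"
    using complete by (auto simp: metric.mcomplete_def)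
  then have l: "l \<in> carrier A" by (simp add: metric.limitin_metric)
  have "cnorm A (l \<ominus> \<sigma> n) \<le> 2 * C * (1/2) ^ n" for n
  proof (rule field_le_epsilon)
    fix e :: real assume "0 < e"
    with lim obtain N where N: "\<And>m. N \<le> m \<Longrightarrow> cdist A (\<sigma> m) l < e"
      unfolding metric.limitin_metric eventually_sequentially by meson
    let ?m = "max N n"
    show "cnorm A (l \<ominus> \<sigma> n) \<le> 2 * C * (1/2) ^ n + e"
      using N[of ?m] tail'[of n ?m] cnorm_diff_triangle[OF l \<sigma>[of ?m] \<sigma>[of n]]
        cnorm_minus_commute[OF l \<sigma>[of ?m]] cdist_eq[OF \<sigma>[of ?m] l] by simp
  qed
  with l show thesis by (rule that)
qed

end

section \<open>Unitaries and contractivity of *-homomorphisms\<close>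

context cstar_algebra
begin

text \<open>In the unitization \<open>b = 1 - sqrt (1 - a\<^sup>2)\<close>, so that \<open>a + \<i> (1 - b)\<close> is unitary.\<close>

lemma sqrt_complement:
  assumes a: "a \<in> carrier A" "star A a = a" "cnorm A a < 1"
  obtains b where "b \<in> carrier A" "star A b = b" "a \<otimes> b = b \<otimes> a" "a \<otimes> a \<oplus> b \<otimes> b = b \<oplus> b"
proof -
  define q where "q = cnorm A a"
  \<comment> \<open>A fixed point satisfies \<open>2 b = a^2 + b^2\<close>, that is
    \<open>(1 - b)^2 = 1 - a^2\<close>. On the ball of radius \<open>q\<close>, the norm of
    \<open>a\<close>, the map has Lipschitz constant \<open>q < 1\<close>.\<close>
  define F where "F = (\<lambda>x. (1/2) \<odot> (a \<otimes> a \<oplus> x \<otimes> x))"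
  have q: "0 \<le> q" "q < 1" using a cnorm_nonneg by (auto simp: q_def)
  let ?S = "{x \<in> carrier A. cnorm A x \<le> q}"
  have sq: "cnorm A (x \<otimes> x) \<le> q * q" if "x \<in> ?S" for x
    using that cnorm_mult[of x x] mult_mono[of "cnorm A x" q "cnorm A x" q] q cnorm_nonneg[of x] by auto
  have Fdiff: "cnorm A (x \<otimes> x \<ominus> y \<otimes> y) \<le> 2 * q * cnorm A (x \<ominus> y)" if "x \<in> ?S" "y \<in> ?S" for x y
  proof -
    have [simp]: "x \<in> carrier A" "y \<in> carrier A" using that by auto
    have "x \<otimes> x \<ominus> y \<otimes> y = x \<otimes> (x \<ominus> y) \<oplus> (x \<ominus> y) \<otimes> y"
      by (simp add: expand_simps, rule lin_eqI[where xs = "[x \<otimes> x, x \<otimes> y, y \<otimes> y]"], (rule lin_reps)+)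
        (auto simp: All_less_Suc)
    also have "cnorm A \<dots> \<le> cnorm A x * cnorm A (x \<ominus> y) + cnorm A (x \<ominus> y) * cnorm A y"
      using that cnorm_triangle[of "x \<otimes> (x \<ominus> y)" "(x \<ominus> y) \<otimes> y"]
        cnorm_mult[of x "x \<ominus> y"] cnorm_mult[of "x \<ominus> y" y] by simp
    also have "\<dots> \<le> q * cnorm A (x \<ominus> y) + cnorm A (x \<ominus> y) * q"
      using that cnorm_nonneg[of "x \<ominus> y"] by (intro add_mono mult_right_mono mult_left_mono) auto
    finally show ?thesis by simp
  qed
  obtain b where b: "b \<in> ?S" "F b = b"
  proof (rule fixed_point[of ?S F q])
    show "calg_closed A ?S" by (rule calg_closed_cball)
    show "?S \<noteq> {}" using a by (auto simp: q_def)
    show "F x \<in> ?S" if "x \<in> ?S" for x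
    proof -
      have "cnorm A (F x) \<le> (1/2) * (q * q + q * q)"
        using that a sq[of a] sq[of x] cnorm_triangle[of "a \<otimes> a" "x \<otimes> x"] by (simp add: F_def q_def)
      also have "\<dots> \<le> q" using q by (simp add: mult_left_le)
      finally show ?thesis using that a by (simp add: F_def)
    qed
    show "cnorm A (F x \<ominus> F y) \<le> q * cnorm A (x \<ominus> y)" if "x \<in> ?S" "y \<in> ?S" for x y
    proof -
      have "F x \<ominus> F y = (1/2) \<odot> (x \<otimes> x \<ominus> y \<otimes> y)"
        unfolding F_def
        by (rule lin_eqI[where xs = "[a \<otimes> a, x \<otimes> x, y \<otimes> y]"], (rule lin_reps)+)
          (use that a in \<open>auto simp: All_less_Suc\<close>)
      with Fdiff[OF that] that show ?thesis by simp
    qed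
  qed (use q in auto)
  have bA: "b \<in> carrier A" "cnorm A b \<le> q" using b by auto
  have *: "(2::complex) \<odot> b = a \<otimes> a \<oplus> b \<otimes> b"
    using arg_cong[OF b(2), of "\<lambda>x. 2 \<odot> x"] a bA by (simp add: F_def)
  \<comment> \<open>The adjoint of \<open>b\<close> solves the same equation in the same ball, so
    the estimate behind uniqueness identifies the two.\<close>
  have sab: "star A b = b"
  proof -
    have "(2::complex) \<odot> (star A b \<ominus> b) = star A b \<otimes> star A b \<ominus> b \<otimes> b"
    proof -
      have "(2::complex) \<odot> star A b = a \<otimes> a \<oplus> star A b \<otimes> star A b"
        using arg_cong[OF *, of "star A"] a bA by (simp add: star_smult star_add star_mult)
      then have "(2::complex) \<odot> (star A b \<ominus> b) = (a \<otimes> a \<oplus> star A b \<otimes> star A b) \<ominus> (a \<otimes> a \<oplus> b \<otimes> b)"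
        using bA * by (simp add: scalar_diff_right)
      also have "\<dots> = star A b \<otimes> star A b \<ominus> b \<otimes> b"
        by (rule lin_eqI[where xs = "[a \<otimes> a, star A b \<otimes> star A b, b \<otimes> b]"], (rule lin_reps)+)
          (use a bA in \<open>auto simp: All_less_Suc\<close>)
      finally show ?thesis .
    qed
    then have "2 * cnorm A (star A b \<ominus> b) \<le> 2 * q * cnorm A (star A b \<ominus> b)"
      using Fdiff[of "star A b" b] bA cnorm_scalar[of "star A b \<ominus> b" 2] by simp
    then have "(1 - q) * cnorm A (star A b \<ominus> b) \<le> 0" by (simp add: algebra_simps)
    then have "cnorm A (star A b \<ominus> b) = 0"
      using q bA cnorm_nonneg[of "star A b \<ominus> b"] by (simp add: mult_le_0_iff)
    then show ?thesis using bA by (simp add: cnorm_eq_0 diff_eq_zero_iff)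
  qed
  \<comment> \<open>The commutator satisfies \<open>2 c = c b + b c\<close>; as \<open>b\<close> has
    norm at most \<open>q < 1\<close>, the norm of \<open>c\<close> is at most \<open>q\<close>
    times itself.\<close>
  have com: "a \<otimes> b = b \<otimes> a"
  proof -
    let ?c = "a \<otimes> b \<ominus> b \<otimes> a"
    note [simp] = a(1) bA(1)
    have "(2::complex) \<odot> ?c = a \<otimes> (a \<otimes> a \<oplus> b \<otimes> b) \<ominus> (a \<otimes> a \<oplus> b \<otimes> b) \<otimes> a"
      using a bA by (simp flip: * add: scalar_diff_right)
    also have "\<dots> = ?c \<otimes> b \<oplus> b \<otimes> ?c"
      by (simp add: expand_simps, rule lin_eqI[where xs = "[a \<otimes> (a \<otimes> a), a \<otimes> (b \<otimes> b),
        b \<otimes> (b \<otimes> a), b \<otimes> (a \<otimes> b)]"], (rule lin_reps)+)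
        (auto simp: All_less_Suc)
    finally have eq: "2 \<odot> ?c = ?c \<otimes> b \<oplus> b \<otimes> ?c" .
    have "2 * cnorm A ?c = cnorm A (2 \<odot> ?c)" by simp
    also have "\<dots> \<le> cnorm A ?c * cnorm A b + cnorm A b * cnorm A ?c"
      unfolding eq using a bA cnorm_triangle[of "?c \<otimes> b" "b \<otimes> ?c"] cnorm_mult[of ?c b] cnorm_mult[of b ?c]
      by (simp add: mult.commute)
    also have "\<dots> \<le> cnorm A ?c * q + q * cnorm A ?c"
      using a bA cnorm_nonneg[of ?c] by (intro add_mono mult_right_mono mult_left_mono) auto
    finally have "(1 - q) * cnorm A ?c \<le> 0" using a bA by (simp add: algebra_simps)
    then have "cnorm A ?c = 0"
      using q a bA cnorm_nonneg[of ?c] by (simp add: mult_le_0_iff)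
    then show ?thesis using a bA by (simp add: cnorm_eq_0 diff_eq_zero_iff)
  qed
  have "a \<otimes> a \<oplus> b \<otimes> b = b \<oplus> b"
    unfolding *[symmetric] by (rule lin_eqI[where xs = "[b]"], (rule lin_reps)+) (use bA in auto)
  with bA sab com show thesis by (intro that) auto
qed

text \<open>For \<open>u = a + k (1 - b)\<close> one has \<open>u^* u = a^2 + (1 - b)^2 = 1\<close>:
  the cross terms cancel because \<open>a\<close> and \<open>b\<close> commute and \<open>k\<close>
  is imaginary.\<close>

lemma cnorm_unitary:
  assumes [simp]: "a \<in> carrier A" "b \<in> carrier A" "star A a = a" "star A b = b"
    and com: "a \<otimes> b = b \<otimes> a" and ab: "a \<otimes> a \<oplus> b \<otimes> b = b \<oplus> b"
    and [simp]: "z \<in> carrier A" and k: "k = \<i> \<or> k = - \<i>"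
  shows "cnorm A (a \<otimes> z \<oplus> k \<odot> (z \<ominus> b \<otimes> z)) = cnorm A z"
proof -
  define P where "P = a \<otimes> z"
  define g where "g = z \<ominus> b \<otimes> z"
  have [simp]: "P \<in> carrier A" "g \<in> carrier A" by (auto simp: P_def g_def)
  have aa: "a \<otimes> a = b \<oplus> b \<ominus> b \<otimes> b"
    unfolding ab[symmetric] by (rule lin_eqI[where xs = "[a \<otimes> a, b \<otimes> b]"], (rule lin_reps)+) (auto simp: All_less_Suc)
  have aaz: "a \<otimes> (a \<otimes> z) = b \<otimes> z \<oplus> b \<otimes> z \<ominus> b \<otimes> (b \<otimes> z)"
    using arg_cong[OF aa, of "\<lambda>t. t \<otimes> z"] by (simp add: expand_simps)
  have abz: "a \<otimes> (b \<otimes> z) = b \<otimes> (a \<otimes> z)"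
    using arg_cong[OF com, of "\<lambda>t. t \<otimes> z"] by (simp add: mult_assoc)
  have sq: "star A P \<otimes> P \<oplus> star A g \<otimes> g = star A z \<otimes> z"
    unfolding P_def g_def
    by (simp add: expand_simps aaz, rule lin_eqI[where xs = "[star A z \<otimes> z, star A z \<otimes> (b \<otimes> z),
        star A z \<otimes> (b \<otimes> (b \<otimes> z))]"], (rule lin_reps)+) (auto simp: All_less_Suc)
  have cross: "star A P \<otimes> g = star A g \<otimes> P"
    unfolding P_def g_def by (simp add: expand_simps abz)
  have "star A (P \<oplus> k \<odot> g) \<otimes> (P \<oplus> k \<odot> g) = star A P \<otimes> P \<oplus> star A g \<otimes> g"
    by (simp add: expand_simps cross,
      rule lin_eqI[where xs = "[star A P \<otimes> P, star A g \<otimes> g, star A g \<otimes> P]"], (rule lin_reps)+)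
      (use k in \<open>auto simp: All_less_Suc\<close>)
  then have "(cnorm A (P \<oplus> k \<odot> g))\<^sup>2 = (cnorm A z)\<^sup>2"
    using cnorm_star_mult[of "P \<oplus> k \<odot> g"] cnorm_star_mult[of z] by (simp add: sq)
  then show ?thesis by (simp add: P_def g_def power2_eq_iff_nonneg cnorm_nonneg)
qed

lemma cnorm_average:
  assumes "x \<in> carrier A" "y \<in> carrier A" "cnorm A x \<le> r" "cnorm A y \<le> r"
  shows "cnorm A ((1/2) \<odot> (x \<oplus> y)) \<le> r"
  using cnorm_triangle[of x y] assms by simp

text \<open>\<open>a\<close> is the mean of the two unitaries
  \<open>a \<plusminus> \<i> (1 - b)\<close>. Since the bound comes from the algebraic relation
  alone, it is also available for images under homomorphisms.\<close>

lemma cnorm_mult_cos_le: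
  assumes ab[simp]: "a \<in> carrier A" "b \<in> carrier A" "star A a = a" "star A b = b"
    and rel: "a \<otimes> b = b \<otimes> a" "a \<otimes> a \<oplus> b \<otimes> b = b \<oplus> b"
    and z[simp]: "z \<in> carrier A"
  shows "cnorm A (a \<otimes> z) \<le> cnorm A z"
proof -
  let ?g = "z \<ominus> b \<otimes> z"
  have "a \<otimes> z = (1/2) \<odot> ((a \<otimes> z \<oplus> \<i> \<odot> ?g) \<oplus> (a \<otimes> z \<oplus> (- \<i>) \<odot> ?g))"
    by (rule lin_eqI[where xs = "[a \<otimes> z, z, b \<otimes> z]"], (rule lin_reps)+) (auto simp: All_less_Suc)
  then show ?thesis
    using cnorm_average[of "a \<otimes> z \<oplus> \<i> \<odot> ?g" "a \<otimes> z \<oplus> (- \<i>) \<odot> ?g" "cnorm A z"]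
      cnorm_unitary[OF ab rel z] by simp
qed

text \<open>The double angle formula: with \<open>a\<close> as cosine, \<open>1 - 2 a^2\<close> is
  minus the mean of the squares of the unitaries \<open>a \<plusminus> \<i> (1 - b)\<close>.\<close>

lemma cnorm_minus_double_square_le:
  assumes a[simp]: "a \<in> carrier A" "star A a = a" and "cnorm A a < 1" and z[simp]: "z \<in> carrier A"
  shows "cnorm A (z \<ominus> 2 \<odot> (a \<otimes> (a \<otimes> z))) \<le> cnorm A z"
proof -
  obtain b where b[simp]: "b \<in> carrier A" "star A b = b"
    and com: "a \<otimes> b = b \<otimes> a" and ab: "a \<otimes> a \<oplus> b \<otimes> b = b \<oplus> b"
    using sqrt_complement assms by metis
  define U where "U k y = a \<otimes> y \<oplus> k \<odot> (y \<ominus> b \<otimes> y)" for k y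
  have [simp]: "U k y \<in> carrier A" if "y \<in> carrier A" for k y using that by (simp add: U_def)
  have U: "cnorm A (U k y) = cnorm A y" if "y \<in> carrier A" "k = \<i> \<or> k = - \<i>" for k y
    unfolding U_def using that by (intro cnorm_unitary com ab) auto
  have aa: "b \<otimes> b = b \<oplus> b \<ominus> a \<otimes> a"
    unfolding ab[symmetric] by (rule lin_eqI[where xs = "[a \<otimes> a, b \<otimes> b]"], (rule lin_reps)+) (auto simp: All_less_Suc)
  have bbz: "b \<otimes> (b \<otimes> z) = b \<otimes> z \<oplus> b \<otimes> z \<ominus> a \<otimes> (a \<otimes> z)"
    using arg_cong[OF aa, of "\<lambda>t. t \<otimes> z"] by (simp add: expand_simps)
  have "z \<ominus> 2 \<odot> (a \<otimes> (a \<otimes> z)) = (-1) \<odot> ((1/2) \<odot> (U \<i> (U \<i> z) \<oplus> U (- \<i>) (U (- \<i>) z)))"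
    unfolding U_def
    by (simp add: expand_simps bbz, rule lin_eqI[where xs = "[z, a \<otimes> z, b \<otimes> z, a \<otimes> (a \<otimes> z),
        a \<otimes> (b \<otimes> z), b \<otimes> (a \<otimes> z)]"], (rule lin_reps)+) (auto simp: All_less_Suc)
  then show ?thesis
    using cnorm_average[of "U \<i> (U \<i> z)" "U (- \<i>) (U (- \<i>) z)" "cnorm A z"] by (simp add: U)
qed

text \<open>The double angle bound applied to \<open>t a\<close> with
  \<open>2 t^2 = \<kappa>\<close>; the condition on \<open>\<kappa>\<close> says that
  \<open>t a\<close> has norm below 1.\<close>

lemma cnorm_minus_square_le:
  assumes a: "a \<in> carrier A" "star A a = a" and \<kappa>: "0 \<le> \<kappa>" "\<kappa> * (cnorm A a)\<^sup>2 < 2"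
    and z: "z \<in> carrier A"
  shows "cnorm A (z \<ominus> complex_of_real \<kappa> \<odot> (a \<otimes> (a \<otimes> z))) \<le> cnorm A z"
proof -
  define t where "t = sqrt (\<kappa> / 2)"
  have t: "0 \<le> t" "t * t = \<kappa> / 2" using \<kappa> by (auto simp: t_def)
  have "(t * cnorm A a)\<^sup>2 = (t * t) * (cnorm A a)\<^sup>2" by (simp add: power2_eq_square)
  then have "(t * cnorm A a)\<^sup>2 < 1" using \<kappa> t by simp
  then have "t * cnorm A a < 1"
    using t cnorm_nonneg[of a] a by (simp add: power_less_one_iff)
  moreover have "2 * (complex_of_real t * complex_of_real t) = complex_of_real \<kappa>"
    using arg_cong[OF t(2), of complex_of_real] by (simp add: mult.commute)
  ultimately show ?thesis
    using cnorm_minus_double_square_le[of "complex_of_real t \<odot> a" z] a z t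
    by (simp add: star_smult)
qed

end

lemma cstar_homD:
  assumes "cstar_hom A B h"
  shows "x \<in> carrier A \<Longrightarrow> h x \<in> carrier B"
    and "\<lbrakk>x \<in> carrier A; y \<in> carrier A\<rbrakk> \<Longrightarrow> h (x \<oplus>\<^bsub>A\<^esub> y) = h x \<oplus>\<^bsub>B\<^esub> h y"
    and "x \<in> carrier A \<Longrightarrow> h (c \<odot>\<^bsub>A\<^esub> x) = c \<odot>\<^bsub>B\<^esub> h x"
    and "\<lbrakk>x \<in> carrier A; y \<in> carrier A\<rbrakk> \<Longrightarrow> h (x \<otimes>\<^bsub>A\<^esub> y) = h x \<otimes>\<^bsub>B\<^esub> h y"
    and "x \<in> carrier A \<Longrightarrow> h (star A x) = star B (h x)"
  using assms by (auto simp: cstar_hom_def)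

locale cstar_homomorphism = A: cstar_algebra A + B: cstar_algebra B
  for A :: "'a star_algebra" and B :: "'b star_algebra" and h :: "'a \<Rightarrow> 'b" +
  assumes hom: "cstar_hom A B h"
begin

lemmas hom_simps [simp] = cstar_homD[OF hom]

lemma hom_zero [simp]: "h \<zero>\<^bsub>A\<^esub> = \<zero>\<^bsub>B\<^esub>"
  using hom_simps(3)[of "\<zero>\<^bsub>A\<^esub>" 0] by (simp del: hom_simps(3))

lemma hom_diff [simp]:
  "\<lbrakk>x \<in> carrier A; y \<in> carrier A\<rbrakk> \<Longrightarrow> h (x \<ominus>\<^bsub>A\<^esub> y) = h x \<ominus>\<^bsub>B\<^esub> h y"
  by (simp add: A.minus_eq_scalar B.minus_eq_scalar)

text \<open>\<open>h\<close> maps the companion \<open>b\<close> of \<open>a\<close> to a companion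
  of \<open>h a\<close>, so \<open>h a\<close> is again a cosine. Multiplying \<open>h a\<close> by
  itself then bounds the square of its norm by its norm.\<close>

lemma contractive_sa:
  assumes a: "a \<in> carrier A" "star A a = a" "cnorm A a < 1"
  shows "cnorm B (h a) \<le> 1"
proof -
  obtain b where b: "b \<in> carrier A" "star A b = b" "a \<otimes>\<^bsub>A\<^esub> b = b \<otimes>\<^bsub>A\<^esub> a"
    "a \<otimes>\<^bsub>A\<^esub> a \<oplus>\<^bsub>A\<^esub> b \<otimes>\<^bsub>A\<^esub> b = b \<oplus>\<^bsub>A\<^esub> b"
    using A.sqrt_complement[OF a] by metis
  have "cnorm B (h a \<otimes>\<^bsub>B\<^esub> h a) \<le> cnorm B (h a)"
  proof (rule B.cnorm_mult_cos_le[where b = "h b"])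
    show "h a \<otimes>\<^bsub>B\<^esub> h b = h b \<otimes>\<^bsub>B\<^esub> h a" using a b by (metis hom_simps(4))
    show "h a \<otimes>\<^bsub>B\<^esub> h a \<oplus>\<^bsub>B\<^esub> h b \<otimes>\<^bsub>B\<^esub> h b = h b \<oplus>\<^bsub>B\<^esub> h b" using a(1) b(1) arg_cong[OF b(4), of h] by simp
  qed (use a b hom_simps(5)[of a] hom_simps(5)[of b] in auto)
  moreover have "star B (h a) = h a" using a hom_simps(5)[of a] by simp
  ultimately have "(cnorm B (h a))\<^sup>2 \<le> cnorm B (h a)"
    using a B.cnorm_sa_square[of "h a"] by simp
  then show ?thesis using B.cnorm_nonneg[of "h a"] a
    by (cases "cnorm B (h a) = 0") (auto simp: power2_eq_square)
qed

text \<open>The C*-identity reduces this to \<open>x^* x\<close>, which is divided by an arbitrary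
  \<open>t\<close> above its norm to meet the strict bound in \<open>contractive_sa\<close>.\<close>

lemma contractive:
  assumes x: "x \<in> carrier A" shows "cnorm B (h x) \<le> cnorm A x"
proof -
  let ?a = "star A x \<otimes>\<^bsub>A\<^esub> x"
  have a: "?a \<in> carrier A" "star A ?a = ?a" using x by (auto simp: A.star_mult)
  have "cnorm B (h ?a) \<le> cnorm A ?a"
  proof (rule dense_ge)
    fix t assume t: "cnorm A ?a < t"
    then have t0: "0 < t" using A.cnorm_nonneg[OF a(1)] by simp
    have "cnorm B (h (complex_of_real (1 / t) \<odot>\<^bsub>A\<^esub> ?a)) \<le> 1"
      using t t0 a by (intro contractive_sa) (auto simp: A.star_smult norm_divide)
    then show "cnorm B (h ?a) \<le> t" using a(1) t0 by (simp add: norm_divide field_simps del: hom_simps(4))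
  qed
  then have "(cnorm B (h x))\<^sup>2 \<le> (cnorm A x)\<^sup>2"
    using x A.cnorm_star_mult[of x] B.cnorm_star_mult[of "h x"] by simp
  then show ?thesis using x A.cnorm_nonneg[of x] by (simp add: power2_le_iff_abs_le B.cnorm_nonneg)
qed

end

section \<open>Images of *-homomorphisms are closed\<close>

context cstar_algebra
begin

text \<open>\<open>N - b^2 = N (1 - b^2 / N)\<close>, and the second factor is a contraction for
  this \<open>N\<close>.\<close>

lemma cnorm_mult_scaled_le:
  assumes [simp]: "b \<in> carrier A" "star A b = b" "y \<in> carrier A"
    and N: "N = (cnorm A b)\<^sup>2 + 1"
  shows "cnorm A (complex_of_real N \<odot> y \<ominus> b \<otimes> (b \<otimes> y)) \<le> N * cnorm A y"
proof -
  have N0: "0 < N" using N by (simp add: add_nonneg_pos)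
  have "complex_of_real N \<odot> y \<ominus> b \<otimes> (b \<otimes> y)
      = complex_of_real N \<odot> (y \<ominus> complex_of_real (1 / N) \<odot> (b \<otimes> (b \<otimes> y)))"
    using N0 by (simp add: scalar_diff_right)
  moreover have "1 / N * (cnorm A b)\<^sup>2 < 2" using N N0 by (simp add: field_simps)
  ultimately show ?thesis
    using cnorm_minus_square_le[of b "1 / N" y] N0 by simp
qed

text \<open>Takes the place of the invertibility of \<open>1 + b^2\<close>. It is read off from
  \<open>(1 + N) y = (1 + b^2) y + (N - b^2) y\<close>.\<close>

lemma cnorm_le_plus_square:
  assumes b[simp]: "b \<in> carrier A" "star A b = b" and y[simp]: "y \<in> carrier A"
  shows "cnorm A y \<le> cnorm A (y \<oplus> b \<otimes> (b \<otimes> y))"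
proof -
  define N where "N = (cnorm A b)\<^sup>2 + 1"
  have N0: "0 < N" by (simp add: N_def add_nonneg_pos)
  have "complex_of_real (1 + N) \<odot> y
      = (y \<oplus> b \<otimes> (b \<otimes> y)) \<oplus> (complex_of_real N \<odot> y \<ominus> b \<otimes> (b \<otimes> y))"
    by (rule lin_eqI[where xs = "[y, b \<otimes> (b \<otimes> y)]"], (rule lin_reps)+) (auto simp: All_less_Suc)
  then have "(1 + N) * cnorm A y \<le> cnorm A (y \<oplus> b \<otimes> (b \<otimes> y)) + N * cnorm A y"
    using cnorm_triangle[of "y \<oplus> b \<otimes> (b \<otimes> y)" "complex_of_real N \<odot> y \<ominus> b \<otimes> (b \<otimes> y)"]
      cnorm_mult_scaled_le[OF b y N_def] cnorm_scalar[OF y, of "complex_of_real (1 + N)"] N0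
    by (simp del: cnorm_scalar of_real_add)
  then show ?thesis by (simp add: algebra_simps)
qed

lemma plus_square_inj:
  assumes "b \<in> carrier A" "star A b = b" "y \<in> carrier A" "y \<oplus> b \<otimes> (b \<otimes> y) = \<zero>"
  shows "y = \<zero>"
  using cnorm_le_plus_square[of b y] assms cnorm_nonneg[of y] cnorm_eq_0[of y] by simp

text \<open>Here \<open>d = 2b / (1 + b\<^sup>2)\<close>; it is bounded independently of \<open>b\<close> because
  \<open>d\<^sup>2 + ((1 - b\<^sup>2) / (1 + b\<^sup>2))\<^sup>2 = 1\<close>.\<close>

lemma rational_truncation:
  assumes b[simp]: "b \<in> carrier A" "star A b = b"
  obtains d where "d \<in> carrier A" "star A d = d" "cnorm A d \<le> 1" "d \<oplus> d \<otimes> (b \<otimes> b) = b \<oplus> b"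
proof -
  define N where "N = (cnorm A b)\<^sup>2 + 1"
  have N0: "0 < N" by (simp add: N_def add_nonneg_pos)
  \<comment> \<open>A fixed point satisfies \<open>(1 + b^2) e = 2 b^2\<close>; adding
    \<open>N e\<close> to both sides turns this equation into a contraction with constant
    \<open>N / (1 + N)\<close>.\<close>
  define F where "F x = complex_of_real (1 / (1 + N)) \<odot>
      ((b \<otimes> b \<oplus> b \<otimes> b) \<oplus> (complex_of_real N \<odot> x \<ominus> b \<otimes> (b \<otimes> x)))" for x
  have F[simp]: "F x \<in> carrier A" if "x \<in> carrier A" for x using that by (simp add: F_def)
  obtain e where e[simp]: "e \<in> carrier A" and Fe: "F e = e"
  proof (rule fixed_point[of "carrier A" F "N / (1 + N)"])
    show "calg_closed A (carrier A)" by (simp add: calg_closed_iff)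
    show "carrier A \<noteq> {}" using b by blast
    fix x y assume [simp]: "x \<in> carrier A" "y \<in> carrier A"
    have "F x \<ominus> F y = complex_of_real (1 / (1 + N)) \<odot>
        (complex_of_real N \<odot> (x \<ominus> y) \<ominus> b \<otimes> (b \<otimes> (x \<ominus> y)))"
      unfolding F_def
      by (simp add: expand_simps, rule lin_eqI[where xs = "[x, y, b \<otimes> b, b \<otimes> (b \<otimes> x), b \<otimes> (b \<otimes> y)]"],
        (rule lin_reps)+) (auto simp: All_less_Suc algebra_simps)
    then show "cnorm A (F x \<ominus> F y) \<le> N / (1 + N) * cnorm A (x \<ominus> y)"
      using cnorm_mult_scaled_le[of b "x \<ominus> y" N] N0 by (simp add: N_def[symmetric] norm_divide divide_right_mono flip: of_real_add)
  qed (use N0 in auto)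
  have eq: "e \<oplus> b \<otimes> (b \<otimes> e) = b \<otimes> b \<oplus> b \<otimes> b"
  proof -
    have "complex_of_real (1 + N) \<odot> e =
        (b \<otimes> b \<oplus> b \<otimes> b) \<oplus> (complex_of_real N \<odot> e \<ominus> b \<otimes> (b \<otimes> e))"
      using arg_cong[OF Fe, of "\<lambda>t. complex_of_real (1 + N) \<odot> t"] N0
      by (simp add: F_def del: of_real_add flip: of_real_mult)
    then have "b \<otimes> b \<oplus> b \<otimes> b = complex_of_real (1 + N) \<odot> e \<ominus> (complex_of_real N \<odot> e \<ominus> b \<otimes> (b \<otimes> e))"
      by (simp only:) (rule lin_eqI[where xs = "[b \<otimes> b, e, b \<otimes> (b \<otimes> e)]"], (rule lin_reps)+, auto simp: All_less_Suc)
    also have "\<dots> = e \<oplus> b \<otimes> (b \<otimes> e)"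
      by (rule lin_eqI[where xs = "[e, b \<otimes> (b \<otimes> e)]"], (rule lin_reps)+) (auto simp: All_less_Suc)
    finally show ?thesis ..
  qed
  \<comment> \<open>\<open>e b\<close> and \<open>b e\<close> both solve
    \<open>(1 + b^2) y = 2 b^3\<close>, and solutions are unique by \<open>plus_square_inj\<close>.
    The adjoint of \<open>e\<close> is treated in the same way below.\<close>
  have eb: "e \<otimes> b = b \<otimes> e"
  proof -
    have *: "b \<otimes> e \<oplus> b \<otimes> (b \<otimes> (b \<otimes> e)) = b \<otimes> (b \<otimes> b) \<oplus> b \<otimes> (b \<otimes> b)"
      using arg_cong[OF eq, of "\<lambda>t. b \<otimes> t"] by (simp add: expand_simps)
    have **: "e \<otimes> b \<oplus> b \<otimes> (b \<otimes> (e \<otimes> b)) = b \<otimes> (b \<otimes> b) \<oplus> b \<otimes> (b \<otimes> b)"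
      using arg_cong[OF eq, of "\<lambda>t. t \<otimes> b"] by (simp add: expand_simps)
    let ?y = "b \<otimes> e \<ominus> e \<otimes> b"
    have "?y \<oplus> b \<otimes> (b \<otimes> ?y) = (b \<otimes> e \<oplus> b \<otimes> (b \<otimes> (b \<otimes> e))) \<ominus> (e \<otimes> b \<oplus> b \<otimes> (b \<otimes> (e \<otimes> b)))"
      by (simp add: expand_simps, rule lin_eqI[where xs = "[b \<otimes> e, e \<otimes> b, b \<otimes> (b \<otimes> (b \<otimes> e)), b \<otimes> (b \<otimes> (e \<otimes> b))]"],
        (rule lin_reps)+) (auto simp: All_less_Suc)
    then have "?y = \<zero>" by (intro plus_square_inj[of b ?y]) (simp_all add: * **)
    then show ?thesis by (simp add: diff_eq_zero_iff)
  qed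
  have ebz: "e \<otimes> (b \<otimes> z) = b \<otimes> (e \<otimes> z)" if "z \<in> carrier A" for z
    using that arg_cong[OF eb, of "\<lambda>t. t \<otimes> z"] by (simp add: mult_assoc)
  have se: "star A e = e"
  proof -
    have sb: "star A e \<otimes> b = b \<otimes> star A e" using arg_cong[OF eb, of "star A"] by (simp add: star_mult)
    have sbz: "star A e \<otimes> (b \<otimes> z) = b \<otimes> (star A e \<otimes> z)" if "z \<in> carrier A" for z
      using that arg_cong[OF sb, of "\<lambda>t. t \<otimes> z"] by (simp add: mult_assoc)
    have *: "star A e \<oplus> b \<otimes> (b \<otimes> star A e) = b \<otimes> b \<oplus> b \<otimes> b"
      using arg_cong[OF eq, of "star A"] by (simp add: expand_simps sb sbz)
    let ?y = "star A e \<ominus> e"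
    have "?y \<oplus> b \<otimes> (b \<otimes> ?y) = (star A e \<oplus> b \<otimes> (b \<otimes> star A e)) \<ominus> (e \<oplus> b \<otimes> (b \<otimes> e))"
      by (simp add: expand_simps, rule lin_eqI[where xs = "[star A e, e, b \<otimes> (b \<otimes> star A e), b \<otimes> (b \<otimes> e)]"],
        (rule lin_reps)+) (auto simp: All_less_Suc)
    then have "?y = \<zero>" by (intro plus_square_inj[of b ?y]) (simp_all add: * eq)
    then show ?thesis by (simp add: diff_eq_zero_iff)
  qed
  have bbe: "b \<otimes> (b \<otimes> e) = (b \<otimes> b \<oplus> b \<otimes> b) \<ominus> e"
    unfolding eq[symmetric]
    by (rule lin_eqI[where xs = "[e, b \<otimes> (b \<otimes> e)]"], (rule lin_reps)+) (auto simp: All_less_Suc)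
  have bbez: "b \<otimes> (b \<otimes> (e \<otimes> z)) = (b \<otimes> (b \<otimes> z) \<oplus> b \<otimes> (b \<otimes> z)) \<ominus> e \<otimes> z" if "z \<in> carrier A" for z
    using that arg_cong[OF bbe, of "\<lambda>t. t \<otimes> z"] by (simp add: expand_simps)
  \<comment> \<open>For \<open>e = 2 b^2 / (1 + b^2)\<close> the target
    \<open>2 b / (1 + b^2)\<close> equals \<open>2 b - b e\<close>. Moreover
    \<open>1 - e = (1 - b^2) / (1 + b^2)\<close>, so \<open>d\<close> is a cosine with companion
    \<open>e\<close>.\<close>
  define d where "d = (b \<oplus> b) \<ominus> b \<otimes> e"
  have d[simp]: "d \<in> carrier A" "star A d = d" by (simp_all add: d_def expand_simps se eb)
  have de: "d \<otimes> e = e \<otimes> d" by (simp add: d_def expand_simps eb ebz)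
  have dd: "d \<otimes> d \<oplus> e \<otimes> e = e \<oplus> e"
    unfolding d_def
    by (simp add: expand_simps eb ebz bbe bbez, rule lin_eqI[where xs = "[b \<otimes> b, e, e \<otimes> e]"], (rule lin_reps)+)
      (auto simp: All_less_Suc)
  have "d \<oplus> d \<otimes> (b \<otimes> b) = b \<oplus> b"
    unfolding d_def
    by (simp add: expand_simps eb ebz bbe bbez, rule lin_eqI[where xs = "[b, b \<otimes> (b \<otimes> b), b \<otimes> e]"], (rule lin_reps)+)
      (auto simp: All_less_Suc)
  moreover have "cnorm A d \<le> 1"
  proof -
    have "(cnorm A d)\<^sup>2 \<le> cnorm A d"
      using cnorm_mult_cos_le[OF d(1) e d(2) se de dd d(1)] cnorm_sa_square[OF d] by simp
    then show ?thesis using cnorm_nonneg[OF d(1)]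
      by (cases "cnorm A d = 0") (auto simp: power2_eq_square)
  qed
  ultimately show thesis using d that by blast
qed

end

context cstar_homomorphism
begin

text \<open>A preimage of an approximation of \<open>y\<close> may have large norm; its truncation has small norm and
  still approximates \<open>y\<close> up to third order. Iterating as in the open mapping theorem then gives
  an exact preimage.\<close>

lemma approx_sa_half:
  assumes y[simp]: "y \<in> carrier B" "star B y = y" and "cnorm B y \<le> 1/2"
    and cl: "\<And>r. 0 < r \<Longrightarrow> \<exists>x\<in>carrier A. cnorm B (y \<ominus>\<^bsub>B\<^esub> h x) < r"
  obtains a where "a \<in> carrier A" "star A a = a" "cnorm A a \<le> 1/2" "cnorm B (y \<ominus>\<^bsub>B\<^esub> h a) \<le> 1/4"
proof -
  \<comment> \<open>With \<open>1/20\<close> here, \<open>h b\<close> has norm at most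
    \<open>11/20\<close>, truncation costs at most \<open>1/2 * (11/20)^2 < 1/5\<close>, and
    \<open>1/20 + 1/5 = 1/4\<close>.\<close>
  obtain x where x[simp]: "x \<in> carrier A" and xr: "cnorm B (y \<ominus>\<^bsub>B\<^esub> h x) < 1/20"
    using cl[of "1/20"] by auto
  define b where "b = (1/2) \<odot>\<^bsub>A\<^esub> (x \<oplus>\<^bsub>A\<^esub> star A x)"
  have b[simp]: "b \<in> carrier A" "star A b = b"
    by (simp_all add: b_def A.star_smult A.star_add A.M.a_comm)
  obtain d where d[simp]: "d \<in> carrier A" "star A d = d" and d1: "cnorm A d \<le> 1"
    and db: "d \<oplus>\<^bsub>A\<^esub> d \<otimes>\<^bsub>A\<^esub> (b \<otimes>\<^bsub>A\<^esub> b) = b \<oplus>\<^bsub>A\<^esub> b"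
    using A.rational_truncation[OF b] by metis
  have "y \<ominus>\<^bsub>B\<^esub> h b = (1/2) \<odot>\<^bsub>B\<^esub> ((y \<ominus>\<^bsub>B\<^esub> h x) \<oplus>\<^bsub>B\<^esub> star B (y \<ominus>\<^bsub>B\<^esub> h x))"
    by (simp add: b_def B.expand_simps, rule B.lin_eqI[where xs = "[y, h x, star B (h x)]"], (rule B.lin_reps)+)
      (auto simp: All_less_Suc)
  then have yb: "cnorm B (y \<ominus>\<^bsub>B\<^esub> h b) \<le> 1/20"
    using B.cnorm_average[of "y \<ominus>\<^bsub>B\<^esub> h x" "star B (y \<ominus>\<^bsub>B\<^esub> h x)" "1/20"] xr by simp
  then have hb: "cnorm B (h b) \<le> 11/20"
    using B.cnorm_le_diff[of "h b" y] B.cnorm_minus_commute[of y "h b"] assms(3) by simp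
  \<comment> \<open>By \<open>db\<close>, \<open>b - d / 2 = d b^2 / 2\<close>. Its image is small
    because \<open>h d\<close> is bounded by 1 and \<open>h b\<close> is small, however large
    \<open>b\<close> itself may be.\<close>
  have "h b \<ominus>\<^bsub>B\<^esub> h ((1/2) \<odot>\<^bsub>A\<^esub> d) = (1/2) \<odot>\<^bsub>B\<^esub> (h d \<otimes>\<^bsub>B\<^esub> (h b \<otimes>\<^bsub>B\<^esub> h b))"
  proof -
    have "h b = (1/2) \<odot>\<^bsub>B\<^esub> h (b \<oplus>\<^bsub>A\<^esub> b)"
      by (simp, rule B.lin_eqI[where xs = "[h b]"], (rule B.lin_reps)+) auto
    also have "\<dots> = (1/2) \<odot>\<^bsub>B\<^esub> (h d \<oplus>\<^bsub>B\<^esub> h d \<otimes>\<^bsub>B\<^esub> (h b \<otimes>\<^bsub>B\<^esub> h b))"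
      unfolding db[symmetric] by simp
    finally have "h b \<ominus>\<^bsub>B\<^esub> h ((1/2) \<odot>\<^bsub>A\<^esub> d) =
        (1/2) \<odot>\<^bsub>B\<^esub> (h d \<oplus>\<^bsub>B\<^esub> h d \<otimes>\<^bsub>B\<^esub> (h b \<otimes>\<^bsub>B\<^esub> h b)) \<ominus>\<^bsub>B\<^esub> h ((1/2) \<odot>\<^bsub>A\<^esub> d)"
      by (rule arg_cong)
    also have "\<dots> = (1/2) \<odot>\<^bsub>B\<^esub> (h d \<otimes>\<^bsub>B\<^esub> (h b \<otimes>\<^bsub>B\<^esub> h b))"
      by (simp, rule B.lin_eqI[where xs = "[h d, h d \<otimes>\<^bsub>B\<^esub> (h b \<otimes>\<^bsub>B\<^esub> h b)]"], (rule B.lin_reps)+)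
        (auto simp: All_less_Suc)
    finally show ?thesis .
  qed
  moreover have "cnorm B (h d \<otimes>\<^bsub>B\<^esub> (h b \<otimes>\<^bsub>B\<^esub> h b)) \<le> 1 * (11/20 * (11/20))"
  proof -
    have "cnorm B (h d \<otimes>\<^bsub>B\<^esub> (h b \<otimes>\<^bsub>B\<^esub> h b)) \<le> cnorm B (h d) * cnorm B (h b \<otimes>\<^bsub>B\<^esub> h b)"
      by (simp add: B.cnorm_mult)
    also have "\<dots> \<le> cnorm B (h d) * (cnorm B (h b) * cnorm B (h b))"
      by (simp add: B.cnorm_mult mult_left_mono B.cnorm_nonneg)
    also have "\<dots> \<le> 1 * (11/20 * (11/20))"
      using contractive[OF d(1)] d1 hb
      by (intro mult_mono) (auto simp: B.cnorm_nonneg)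
    finally show ?thesis .
  qed
  ultimately have "cnorm B (h b \<ominus>\<^bsub>B\<^esub> h ((1/2) \<odot>\<^bsub>A\<^esub> d)) \<le> 1/5" by simp
  then have "cnorm B (y \<ominus>\<^bsub>B\<^esub> h ((1/2) \<odot>\<^bsub>A\<^esub> d)) \<le> 1/4"
    using B.cnorm_diff_triangle[of y "h b" "h ((1/2) \<odot>\<^bsub>A\<^esub> d)"] yb by simp
  then show thesis using that[of "(1/2) \<odot>\<^bsub>A\<^esub> d"] d1 by (simp add: A.star_smult)
qed

text \<open>Scaling by \<open>1 / (2 M)\<close> brings \<open>y\<close> to the size at which
  truncation halves the error bound; scaling back, the approximate preimage has norm at most
  \<open>M\<close>.\<close>

lemma approx_sa:
  assumes y: "y \<in> carrier B" "star B y = y" and M: "cnorm B y \<le> M" "0 < M"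
    and cl: "\<And>r. 0 < r \<Longrightarrow> \<exists>x\<in>carrier A. cnorm B (y \<ominus>\<^bsub>B\<^esub> h x) < r"
  obtains a where "a \<in> carrier A" "star A a = a" "cnorm A a \<le> M" "cnorm B (y \<ominus>\<^bsub>B\<^esub> h a) \<le> M / 2"
proof -
  define t where "t = complex_of_real (1 / (2 * M))"
  have t: "cmod t = 1 / (2 * M)" "cnj t = t" "t \<noteq> 0" using M by (auto simp: t_def norm_divide norm_mult)
  obtain a where a: "a \<in> carrier A" "star A a = a" "cnorm A a \<le> 1/2"
    "cnorm B (t \<odot>\<^bsub>B\<^esub> y \<ominus>\<^bsub>B\<^esub> h a) \<le> 1/4"
  proof (rule approx_sa_half[of "t \<odot>\<^bsub>B\<^esub> y"])
    show "cnorm B (t \<odot>\<^bsub>B\<^esub> y) \<le> 1/2"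
      unfolding B.cnorm_scalar[OF y(1)] t(1) using M by (simp add: field_simps)
    fix r :: real assume "0 < r"
    then obtain x where x: "x \<in> carrier A" "cnorm B (y \<ominus>\<^bsub>B\<^esub> h x) < r * (2 * M)"
      using cl[of "r * (2 * M)"] M by auto
    have "cnorm B (t \<odot>\<^bsub>B\<^esub> y \<ominus>\<^bsub>B\<^esub> h (t \<odot>\<^bsub>A\<^esub> x)) = 1 / (2 * M) * cnorm B (y \<ominus>\<^bsub>B\<^esub> h x)"
      using x y B.scalar_diff_right[of y "h x" t] t B.cnorm_scalar[of "y \<ominus>\<^bsub>B\<^esub> h x" t] by simp
    also have "\<dots> < r" using x M by (simp add: field_simps)
    finally show "\<exists>x\<in>carrier A. cnorm B (t \<odot>\<^bsub>B\<^esub> y \<ominus>\<^bsub>B\<^esub> h x) < r" using x by blast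
  qed (use y t in \<open>auto simp: B.star_smult\<close>)
  have "y \<ominus>\<^bsub>B\<^esub> h ((1 / t) \<odot>\<^bsub>A\<^esub> a) = (1 / t) \<odot>\<^bsub>B\<^esub> (t \<odot>\<^bsub>B\<^esub> y \<ominus>\<^bsub>B\<^esub> h a)"
    using y a t by (simp add: B.scalar_diff_right)
  then have "cnorm B (y \<ominus>\<^bsub>B\<^esub> h ((1 / t) \<odot>\<^bsub>A\<^esub> a)) = 2 * M * cnorm B (t \<odot>\<^bsub>B\<^esub> y \<ominus>\<^bsub>B\<^esub> h a)"
    using y a t B.cnorm_scalar[of "t \<odot>\<^bsub>B\<^esub> y \<ominus>\<^bsub>B\<^esub> h a" "1 / t"] by (simp add: norm_divide)
  also have "\<dots> \<le> M / 2" using a(4) M by simp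
  finally show thesis
    using that[of "(1 / t) \<odot>\<^bsub>A\<^esub> a"] a t M by (simp add: A.star_smult norm_divide)
qed

lemma closure_sa_in_image:
  assumes y: "y \<in> carrier B" "star B y = y"
    and cl: "\<And>r. 0 < r \<Longrightarrow> \<exists>x\<in>carrier A. cnorm B (y \<ominus>\<^bsub>B\<^esub> h x) < r"
  shows "y \<in> h ` carrier A"
proof -
  define M where "M = cnorm B y + 1"
  have M: "0 < M" "cnorm B y \<le> M" using B.cnorm_nonneg[OF y(1)] by (auto simp: M_def)
  \<comment> \<open>Step \<open>n\<close> corrects the remainder, of norm at most
    \<open>M / 2^n\<close>, by a selfadjoint element of at most that norm, so the partial sums
    converge in \<open>A\<close>.\<close>
  let ?P = "\<lambda>n x. x \<in> carrier A \<and> star A x = x \<and> cnorm B (y \<ominus>\<^bsub>B\<^esub> h x) \<le> M * (1/2) ^ n"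
  let ?Q = "\<lambda>n x x'. cnorm A (x' \<ominus>\<^bsub>A\<^esub> x) \<le> M * (1/2) ^ n"
  have "\<exists>\<sigma>. \<forall>n. ?P n (\<sigma> n) \<and> ?Q n (\<sigma> n) (\<sigma> (Suc n))"
  proof (rule dependent_nat_choice)
    have "y \<ominus>\<^bsub>B\<^esub> \<zero>\<^bsub>B\<^esub> = y"
      by (rule B.lin_eqI[where xs = "[y]"], (rule B.lin_reps)+) (use y in auto)
    then show "\<exists>x. ?P 0 x" using M y by (intro exI[of _ "\<zero>\<^bsub>A\<^esub>"]) simp
  next
    fix x n assume P: "?P n x"
    then have x[simp]: "x \<in> carrier A" "star A x = x" by auto
    obtain a where a: "a \<in> carrier A" "star A a = a" "cnorm A a \<le> M * (1/2) ^ n"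
      "cnorm B ((y \<ominus>\<^bsub>B\<^esub> h x) \<ominus>\<^bsub>B\<^esub> h a) \<le> M * (1/2) ^ n / 2"
    proof (rule approx_sa[of "y \<ominus>\<^bsub>B\<^esub> h x" "M * (1/2) ^ n"])
      fix r :: real assume "0 < r"
      then obtain u where u: "u \<in> carrier A" "cnorm B (y \<ominus>\<^bsub>B\<^esub> h u) < r" using cl by blast
      have "(y \<ominus>\<^bsub>B\<^esub> h x) \<ominus>\<^bsub>B\<^esub> h (u \<ominus>\<^bsub>A\<^esub> x) = y \<ominus>\<^bsub>B\<^esub> h u"
        unfolding hom_diff[OF u(1) x(1)]
        by (rule B.lin_eqI[where xs = "[y, h x, h u]"], (rule B.lin_reps)+)
          (use y u in \<open>auto simp: All_less_Suc\<close>)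
      with u show "\<exists>u\<in>carrier A. cnorm B ((y \<ominus>\<^bsub>B\<^esub> h x) \<ominus>\<^bsub>B\<^esub> h u) < r"
        by (intro bexI[of _ "u \<ominus>\<^bsub>A\<^esub> x"]) auto
    next
      show "star B (y \<ominus>\<^bsub>B\<^esub> h x) = y \<ominus>\<^bsub>B\<^esub> h x"
        using y hom_simps(5)[OF x(1)] by (simp add: B.star_diff)
    qed (use P M y in auto)
    have "(y \<ominus>\<^bsub>B\<^esub> h x) \<ominus>\<^bsub>B\<^esub> h a = y \<ominus>\<^bsub>B\<^esub> h (x \<oplus>\<^bsub>A\<^esub> a)"
      unfolding hom_simps(2)[OF x(1) a(1)]
      by (rule B.lin_eqI[where xs = "[y, h x, h a]"], (rule B.lin_reps)+)
        (use y a in \<open>auto simp: All_less_Suc\<close>)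
    moreover have "(x \<oplus>\<^bsub>A\<^esub> a) \<ominus>\<^bsub>A\<^esub> x = a"
      by (rule A.lin_eqI[where xs = "[x, a]"], (rule A.lin_reps)+) (use a in \<open>auto simp: All_less_Suc\<close>)
    ultimately show "\<exists>x'. ?P (Suc n) x' \<and> ?Q n x x'"
      using a by (intro exI[of _ "x \<oplus>\<^bsub>A\<^esub> a"]) (simp add: A.star_add)
  qed
  then obtain \<sigma> where \<sigma>: "\<And>n. ?P n (\<sigma> n)" "\<And>n. ?Q n (\<sigma> n) (\<sigma> (Suc n))" by blast
  then have \<sigma>A[simp]: "\<sigma> n \<in> carrier A" for n by blast
  obtain l where l[simp]: "l \<in> carrier A" and l_lim: "\<And>n. cnorm A (l \<ominus>\<^bsub>A\<^esub> \<sigma> n) \<le> 2 * M * (1/2) ^ n"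
    using A.geometric_limit[of \<sigma> M] \<sigma> by metis
  have "cnorm B (y \<ominus>\<^bsub>B\<^esub> h l) \<le> 3 * M * (1/2) ^ n" for n
  proof -
    have "cnorm B (h (\<sigma> n) \<ominus>\<^bsub>B\<^esub> h l) \<le> 2 * M * (1/2) ^ n"
      using contractive[of "\<sigma> n \<ominus>\<^bsub>A\<^esub> l"] l_lim[of n] A.cnorm_minus_commute[of "\<sigma> n" l] by simp
    then show ?thesis
      using B.cnorm_diff_triangle[of y "h (\<sigma> n)" "h l"] \<sigma>(1)[of n] y by simp
  qed
  moreover have "(\<lambda>n. 3 * M * (1/2) ^ n) \<longlonglongrightarrow> 3 * M * 0"
    by (intro tendsto_intros) auto
  ultimately have "cnorm B (y \<ominus>\<^bsub>B\<^esub> h l) \<le> 0"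
    by (intro LIMSEQ_le_const[of "\<lambda>n. 3 * M * (1/2) ^ n"]) auto
  then have "y = h l"
    using B.cnorm_nonneg[of "y \<ominus>\<^bsub>B\<^esub> h l"] y by (simp add: B.cnorm_eq_0 B.diff_eq_zero_iff)
  then show ?thesis by auto
qed

lemma image_closed: "calg_closed B (h ` carrier A)"
  unfolding B.calg_closed_iff
proof (intro conjI ballI impI)
  fix l assume l[simp]: "l \<in> carrier B" and cl: "\<forall>r>0. \<exists>x\<in>h ` carrier A. cnorm B (l \<ominus>\<^bsub>B\<^esub> x) < r"
  \<comment> \<open>The selfadjoint part of \<open>c l\<close>, with \<open>c\<close> factored out.
    The cases \<open>c = 1\<close> and \<open>c = \<i>\<close> give two selfadjoint elements of the
    image from which \<open>l\<close> is recombined.\<close>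
  have part: "(c / 2) \<odot>\<^bsub>B\<^esub> (l \<oplus>\<^bsub>B\<^esub> (cnj c / c) \<odot>\<^bsub>B\<^esub> star B l) \<in> h ` carrier A"
    if c: "cmod c = 1" for c
  proof (rule closure_sa_in_image)
    let ?R = "\<lambda>x. (c / 2) \<odot>\<^bsub>B\<^esub> (x \<oplus>\<^bsub>B\<^esub> (cnj c / c) \<odot>\<^bsub>B\<^esub> star B x)"
    have c0[simp]: "c \<noteq> 0" using c by auto
    show "star B (?R l) = ?R l"
      by (simp add: B.expand_simps, rule B.lin_eqI[where xs = "[l, star B l]"], (rule B.lin_reps)+)
        (auto simp: All_less_Suc)
    fix r :: real assume "0 < r"
    with cl obtain x where x[simp]: "x \<in> carrier A" and xr: "cnorm B (l \<ominus>\<^bsub>B\<^esub> h x) < r" by blast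
    let ?x = "(c / 2) \<odot>\<^bsub>A\<^esub> (x \<oplus>\<^bsub>A\<^esub> (cnj c / c) \<odot>\<^bsub>A\<^esub> star A x)"
    have "?R l \<ominus>\<^bsub>B\<^esub> h ?x = (1/2) \<odot>\<^bsub>B\<^esub> (c \<odot>\<^bsub>B\<^esub> (l \<ominus>\<^bsub>B\<^esub> h x) \<oplus>\<^bsub>B\<^esub> cnj c \<odot>\<^bsub>B\<^esub> star B (l \<ominus>\<^bsub>B\<^esub> h x))"
      by (simp add: B.expand_simps, rule B.lin_eqI[where xs = "[l, star B l, h x, star B (h x)]"], (rule B.lin_reps)+)
        (auto simp: All_less_Suc)
    also have "cnorm B \<dots> \<le> cnorm B (l \<ominus>\<^bsub>B\<^esub> h x)"
      using c by (intro B.cnorm_average) auto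
    finally show "\<exists>x\<in>carrier A. cnorm B (?R l \<ominus>\<^bsub>B\<^esub> h x) < r" using xr by (intro bexI[of _ ?x]) auto
  qed simp
  obtain x where x: "x \<in> carrier A" "h x = (1 / 2) \<odot>\<^bsub>B\<^esub> (l \<oplus>\<^bsub>B\<^esub> star B l)"
    using part[of 1] by force
  obtain y where y: "y \<in> carrier A" "h y = (\<i> / 2) \<odot>\<^bsub>B\<^esub> (l \<oplus>\<^bsub>B\<^esub> (- 1) \<odot>\<^bsub>B\<^esub> star B l)"
    using part[of \<i>] by force
  have "l = h x \<oplus>\<^bsub>B\<^esub> (- \<i>) \<odot>\<^bsub>B\<^esub> h y"
    unfolding x y by (rule B.lin_eqI[where xs = "[l, star B l]"], (rule B.lin_reps)+) (auto simp: All_less_Suc)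
  then have "l = h (x \<oplus>\<^bsub>A\<^esub> (- \<i>) \<odot>\<^bsub>A\<^esub> y)" using x y by simp
  then show "l \<in> h ` carrier A" using x(1) y(1) by (metis A.M.a_closed A.scalar_closed imageI)
qed auto

lemma image_subalgebra: "cstar_subalgebra B (h ` carrier A)"
proof -
  have "\<zero>\<^bsub>B\<^esub> \<in> h ` carrier A" using hom_zero by (metis A.M.zero_closed imageI)
  moreover have "h x \<oplus>\<^bsub>B\<^esub> h y \<in> h ` carrier A" if "x \<in> carrier A" "y \<in> carrier A" for x y
    using that hom_simps(2) by (metis A.M.a_closed imageI)
  moreover have "c \<odot>\<^bsub>B\<^esub> h x \<in> h ` carrier A" if "x \<in> carrier A" for x c
    using that hom_simps(3) by (metis A.scalar_closed imageI)
  moreover have "h x \<otimes>\<^bsub>B\<^esub> h y \<in> h ` carrier A" if "x \<in> carrier A" "y \<in> carrier A" for x y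
    using that hom_simps(4) by (metis A.mult_closed imageI)
  moreover have "star B (h x) \<in> h ` carrier A" if "x \<in> carrier A" for x
    using that hom_simps(5) by (metis A.star_closed imageI)
  ultimately show ?thesis
    using image_closed by (auto simp: cstar_subalgebra_def linear_subspace_def)
qed

end

section \<open>The order of projections\<close>

context cstar_algebra
begin

text \<open>The C*-identity makes \<open>n \<mapsto> \<parallel>m\<^sup>n z\<parallel>\<close> log-convex, so it grows exponentially as
  soon as its first step is expanding.\<close>

lemma selfadjoint_power_bounded:
  assumes m[simp]: "\<And>z. z \<in> carrier A \<Longrightarrow> m z \<in> carrier A"
    and adj: "\<And>x y. \<lbrakk>x \<in> carrier A; y \<in> carrier A\<rbrakk> \<Longrightarrow> star A (m x) \<otimes> y = star A x \<otimes> m y"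
    and z[simp]: "z \<in> carrier A" and bound: "\<And>n. cnorm A ((m ^^ n) z) \<le> C + D * real n"
  shows "cnorm A (m z) \<le> cnorm A z"
proof (rule ccontr)
  define a where "a n = cnorm A ((m ^^ n) z)" for n
  assume "\<not> ?thesis"
  then have lt: "a 0 < a 1" by (simp add: a_def)
  have iter[simp]: "(m ^^ n) z \<in> carrier A" for n by (induction n) auto
  have conv: "a (Suc n) * a (Suc n) \<le> a n * a (Suc (Suc n))" for n
  proof -
    let ?x = "(m ^^ n) z"
    have "a (Suc n) * a (Suc n) = cnorm A (star A (m ?x) \<otimes> m ?x)"
      by (simp add: cnorm_star_mult power2_eq_square a_def)
    also have "\<dots> \<le> cnorm A (star A ?x) * cnorm A (m (m ?x))"
      using cnorm_mult[of "star A ?x" "m (m ?x)"] by (simp add: adj)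
    finally show ?thesis by (simp add: a_def)
  qed
  have a_nonneg: "0 \<le> a n" for n by (simp add: a_def cnorm_nonneg)
  have "a 0 \<noteq> 0"
  proof
    assume "a 0 = 0"
    with conv[of 0] have "a 1 * a 1 \<le> 0" by simp
    with lt a_nonneg[of 0] show False by (simp add: mult_le_0_iff)
  qed
  then have a0: "0 < a 0" using a_nonneg[of 0] by simp
  define \<rho> where "\<rho> = a 1 / a 0"
  have \<rho>: "1 < \<rho>" using lt a0 by (simp add: \<rho>_def)
  have grow: "0 < a n \<and> \<rho> * a n \<le> a (Suc n)" for n
  proof (induction n)
    case 0
    then show ?case using a0 by (simp add: \<rho>_def)
  next
    case (Suc n)
    then have pos: "0 < a (Suc n)" using \<rho> by (meson less_le_trans mult_pos_pos order_less_trans zero_less_one)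
    have "a n * (\<rho> * a (Suc n)) \<le> a (Suc n) * a (Suc n)"
      using Suc mult_right_mono[of "\<rho> * a n" "a (Suc n)" "a (Suc n)"] pos by (simp add: mult.assoc mult.left_commute)
    also note conv[of n]
    finally show ?case using Suc pos by simp
  qed
  have lower: "\<rho> ^ n * a 0 \<le> a n" for n
  proof (induction n)
    case (Suc n)
    then have "\<rho> ^ Suc n * a 0 \<le> \<rho> * a n" using \<rho> by simp
    with grow[of n] show ?case by linarith
  qed simp
  have "a 0 \<le> C * (1 / \<rho>) ^ n + D * (real n * (1 / \<rho>) ^ n)" for n
  proof -
    have "\<rho> ^ n * a 0 \<le> C + D * real n" using lower[of n] bound[of n] by (simp add: a_def)
    then have "a 0 \<le> (C + D * real n) / \<rho> ^ n" using \<rho> by (simp add: field_simps)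
    then show ?thesis by (simp add: power_one_over add_divide_distrib)
  qed
  moreover have "(\<lambda>n. C * (1 / \<rho>) ^ n + D * (real n * (1 / \<rho>) ^ n)) \<longlonglongrightarrow> C * 0 + D * 0"
    using \<rho> by (intro tendsto_intros powser_times_n_limit_0) auto
  ultimately have "a 0 \<le> 0" by (intro LIMSEQ_le_const) auto
  with a0 show False by simp
qed

text \<open>Takes the place of the equality of the nonzero spectra of \<open>y^* y\<close> and
  \<open>y y^*\<close>. The iterates of \<open>1 + y y^*\<close> on \<open>z\<close> have the form
  \<open>z + y x_n\<close> with \<open>x_(n+1) = (1 + y^* y) x_n + y^* z\<close>. By hypothesis the
  norms of the \<open>x_n\<close> grow at most linearly, which rules out an expanding first
  step.\<close>

lemma cnorm_plus_swap:
  assumes y[simp]: "y \<in> carrier A" and z[simp]: "z \<in> carrier A"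
    and le: "\<And>z. z \<in> carrier A \<Longrightarrow> cnorm A (z \<oplus> star A y \<otimes> (y \<otimes> z)) \<le> cnorm A z"
  shows "cnorm A (z \<oplus> y \<otimes> (star A y \<otimes> z)) \<le> cnorm A z"
proof (rule selfadjoint_power_bounded[of "\<lambda>z. z \<oplus> y \<otimes> (star A y \<otimes> z)" z "cnorm A z" "cnorm A y * (cnorm A y * cnorm A z)"])
  let ?m = "\<lambda>z. z \<oplus> y \<otimes> (star A y \<otimes> z)"
  fix n
  have "\<exists>x\<in>carrier A. (?m ^^ n) z = z \<oplus> y \<otimes> x \<and> cnorm A x \<le> real n * (cnorm A y * cnorm A z)"
  proof (induction n)
    case 0
    then show ?case by (intro bexI[of _ \<zero>]) auto
  next
    case (Suc n)
    then obtain x where x[simp]: "x \<in> carrier A" and eq: "(?m ^^ n) z = z \<oplus> y \<otimes> x"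
      and xn: "cnorm A x \<le> real n * (cnorm A y * cnorm A z)" by blast
    let ?x = "(x \<oplus> star A y \<otimes> (y \<otimes> x)) \<oplus> star A y \<otimes> z"
    have "(?m ^^ Suc n) z = z \<oplus> y \<otimes> ?x"
      by (simp add: eq expand_simps, rule lin_eqI[where xs = "[z, y \<otimes> x, y \<otimes> (star A y \<otimes> z),
        y \<otimes> (star A y \<otimes> (y \<otimes> x))]"], (rule lin_reps)+) (auto simp: All_less_Suc)
    moreover have "cnorm A ?x \<le> cnorm A x + cnorm A y * cnorm A z"
      using cnorm_triangle[of "x \<oplus> star A y \<otimes> (y \<otimes> x)" "star A y \<otimes> z"] le[of x]
        cnorm_mult[of "star A y" z] by simp
    ultimately show ?case using xn by (intro bexI[of _ ?x]) (auto simp: algebra_simps)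
  qed
  then obtain x where x[simp]: "x \<in> carrier A" and eq: "(?m ^^ n) z = z \<oplus> y \<otimes> x"
    and xn: "cnorm A x \<le> real n * (cnorm A y * cnorm A z)" by blast
  have "cnorm A (z \<oplus> y \<otimes> x) \<le> cnorm A z + cnorm A y * cnorm A x"
    using cnorm_triangle[of z "y \<otimes> x"] cnorm_mult[of y x] by simp
  also have "\<dots> \<le> cnorm A z + cnorm A y * (real n * (cnorm A y * cnorm A z))"
    using xn by (simp add: mult_left_mono cnorm_nonneg)
  finally show "cnorm A ((?m ^^ n) z) \<le> cnorm A z + cnorm A y * (cnorm A y * cnorm A z) * real n"
    unfolding eq by (simp add: mult_ac)
qed (auto simp: expand_simps)

lemma projectionD:
  assumes "projection A e"
  shows "e \<in> carrier A" "star A e = e" "e \<otimes> e = e" "z \<in> carrier A \<Longrightarrow> e \<otimes> (e \<otimes> z) = e \<otimes> z"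
  using assms mult_assoc[of e e z] by (auto simp: projection_def)

lemma cnorm_projection_le:
  assumes e: "projection A e" shows "cnorm A e \<le> 1"
proof -
  have "(cnorm A e)\<^sup>2 = cnorm A e" using cnorm_sa_square[of e] projectionD[OF e] by simp
  then show ?thesis by (auto simp: power2_eq_square)
qed

lemma cnorm_projection_mult_le:
  assumes e: "projection A e" and [simp]: "z \<in> carrier A" shows "cnorm A (e \<otimes> z) \<le> cnorm A z"
proof -
  note [simp] = projectionD(1)[OF e]
  have "cnorm A (e \<otimes> z) \<le> cnorm A e * cnorm A z" by (simp add: cnorm_mult)
  also have "\<dots> \<le> 1 * cnorm A z"
    using cnorm_projection_le[OF e] by (intro mult_right_mono) (auto simp: cnorm_nonneg)
  finally show ?thesis by simp
qed

lemma cnorm_coprojection_mult_le: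
  assumes e: "projection A e" and [simp]: "z \<in> carrier A" shows "cnorm A (z \<ominus> e \<otimes> z) \<le> cnorm A z"
proof -
  have "(cnorm A e)\<^sup>2 \<le> 1"
    using cnorm_projection_le[OF e] cnorm_nonneg[of e] projectionD(1)[OF e] by (simp add: power_le_one)
  then show ?thesis
    using cnorm_minus_square_le[of e 1 z] projectionD[OF e] by simp
qed

text \<open>The map is \<open>1 - (1 - b) a (1 - b)\<close>. Its iterates keep the component
  \<open>b z\<close> and act on the rest by \<open>(1 - b) (1 - a)\<close>, a product of
  contractions, so they stay below twice the norm of \<open>z\<close>.\<close>

lemma cnorm_minus_compression_le:
  assumes a: "projection A a" and b: "projection A b" and z[simp]: "z \<in> carrier A"
  defines "E \<equiv> \<lambda>x. x \<ominus> b \<otimes> x"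
  shows "cnorm A (z \<ominus> E (a \<otimes> E z)) \<le> cnorm A z"
proof (rule selfadjoint_power_bounded[of "\<lambda>z. z \<ominus> E (a \<otimes> E z)" z "2 * cnorm A z" 0])
  note ab = projectionD[OF a] projectionD[OF b]
  note [simp] = ab(1,5)
  have E[simp]: "E x \<in> carrier A" if "x \<in> carrier A" for x using that by (simp add: E_def)
  show "star A (x \<ominus> E (a \<otimes> E x)) \<otimes> y = star A x \<otimes> (y \<ominus> E (a \<otimes> E y))"
    if [simp]: "x \<in> carrier A" "y \<in> carrier A" for x y
    unfolding E_def
    by (simp add: expand_simps ab(2,6), rule lin_eqI[where xs = "[star A x \<otimes> y, star A x \<otimes> (a \<otimes> y),
      star A x \<otimes> (b \<otimes> (a \<otimes> y)), star A x \<otimes> (a \<otimes> (b \<otimes> y)), star A x \<otimes> (b \<otimes> (a \<otimes> (b \<otimes> y)))]"],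
      (rule lin_reps)+) (auto simp: All_less_Suc)
  let ?m = "\<lambda>z. z \<ominus> E (a \<otimes> E z)"
  fix n
  have "\<exists>u\<in>carrier A. (?m ^^ n) z = b \<otimes> z \<oplus> u \<and> b \<otimes> u = \<zero> \<and> cnorm A u \<le> cnorm A z"
  proof (induction n)
    case 0
    have "z = b \<otimes> z \<oplus> E z" unfolding E_def
      by (rule lin_eqI[where xs = "[z, b \<otimes> z]"], (rule lin_reps)+) (auto simp: All_less_Suc)
    moreover have "b \<otimes> E z = \<zero>" by (simp add: E_def expand_simps ab)
    moreover have "cnorm A (E z) \<le> cnorm A z" unfolding E_def by (rule cnorm_coprojection_mult_le[OF b z])
    ultimately show ?case by (intro bexI[of _ "E z"]) auto
  next
    case (Suc n)
    then obtain u where u[simp]: "u \<in> carrier A" and eq: "(?m ^^ n) z = b \<otimes> z \<oplus> u" and bu: "b \<otimes> u = \<zero>"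
      and un: "cnorm A u \<le> cnorm A z" by blast
    have Eu: "E (b \<otimes> z \<oplus> u) = u"
      unfolding E_def by (simp add: expand_simps ab bu, rule lin_eqI[where xs = "[b \<otimes> z, u]"], (rule lin_reps)+)
        (auto simp: All_less_Suc)
    let ?u = "E (u \<ominus> a \<otimes> u)"
    have "(?m ^^ Suc n) z = b \<otimes> z \<oplus> ?u"
      by (simp add: eq Eu, simp add: E_def expand_simps bu, rule lin_eqI[where xs = "[b \<otimes> z, u, a \<otimes> u, b \<otimes> (a \<otimes> u)]"],
        (rule lin_reps)+) (auto simp: All_less_Suc)
    moreover have "b \<otimes> ?u = \<zero>" by (simp add: E_def expand_simps ab)
    moreover have "cnorm A ?u \<le> cnorm A u"
      using cnorm_coprojection_mult_le[OF b, of "u \<ominus> a \<otimes> u"] cnorm_coprojection_mult_le[OF a u]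
      by (simp add: E_def)
    ultimately show ?case using un by (intro bexI[of _ ?u]) auto
  qed
  then obtain u where u: "u \<in> carrier A" "(?m ^^ n) z = b \<otimes> z \<oplus> u" "cnorm A u \<le> cnorm A z" by blast
  then show "cnorm A ((?m ^^ n) z) \<le> 2 * cnorm A z + 0 * real n"
    using cnorm_triangle[of "b \<otimes> z" u] cnorm_projection_mult_le[OF b z] by simp
qed (use projectionD(1)[OF a] projectionD(1)[OF b] in \<open>auto simp: E_def\<close>)

text \<open>In the unitization the next lemma says that the unit is an extreme point among selfadjoint
  contractions. If \<open>1 \<plusminus> X\<close> are contractions, then so are \<open>1 \<plusminus> 4/3 X\<close>, because
  \<open>1 \<plusminus> 4/3 X = 2/3 (1 \<plusminus> X)\<^sup>2 + 1/3 (1 - 2 X\<^sup>2)\<close>.\<close>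

lemma unit_extreme:
  assumes X: "X \<in> carrier A" "star A X = X"
    and plus: "\<And>z. z \<in> carrier A \<Longrightarrow> cnorm A (z \<oplus> X \<otimes> z) \<le> cnorm A z"
    and minus: "\<And>z. z \<in> carrier A \<Longrightarrow> cnorm A (z \<ominus> X \<otimes> z) \<le> cnorm A z"
  shows "X = \<zero>"
proof -
  define P where "P X \<longleftrightarrow> X \<in> carrier A \<and> star A X = X \<and>
    (\<forall>z\<in>carrier A. \<forall>k\<in>{1, -1}. cnorm A (z \<oplus> k \<odot> (X \<otimes> z)) \<le> cnorm A z)" for X
  \<comment> \<open>\<open>(1 + X)^2 X - (1 - X)^2 X = 4 X^2\<close> bounds four times the squared
    norm of \<open>X\<close> by twice its norm. The result makes \<open>1 - 2 X^2\<close> a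
    contraction, and it limits the growth of \<open>(4/3)^n X\<close>, which forces
    \<open>X = 0\<close>.\<close>
  have half: "cnorm A X \<le> 1/2" if PX: "P X" for X
  proof -
    have X[simp]: "X \<in> carrier A" "star A X = X" using PX by (auto simp: P_def)
    define V where "V k z = z \<oplus> k \<odot> (X \<otimes> z)" for k z
    have V[simp]: "V k z \<in> carrier A" if "z \<in> carrier A" for k z using that by (simp add: V_def)
    have Vc: "cnorm A (V k (V k z)) \<le> cnorm A z" if "z \<in> carrier A" "k \<in> {1, -1}" for k z
      using PX that V unfolding P_def V_def[symmetric] by (meson order_trans)
    have "4 \<odot> (X \<otimes> X) = V 1 (V 1 X) \<ominus> V (-1) (V (-1) X)"
      unfolding V_def by (simp add: expand_simps, rule lin_eqI[where xs = "[X, X \<otimes> X, X \<otimes> (X \<otimes> X)]"],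
        (rule lin_reps)+) (auto simp: All_less_Suc)
    then have "4 * cnorm A (X \<otimes> X) \<le> 2 * cnorm A X"
      using cnorm_triangle_diff[of "V 1 (V 1 X)" "V (-1) (V (-1) X)"] Vc[of X 1] Vc[of X "-1"]
        cnorm_scalar[of "X \<otimes> X" 4] by simp
    then show ?thesis using cnorm_sa_square[OF X] cnorm_nonneg[OF X(1)]
      by (cases "cnorm A X = 0") (auto simp: power2_eq_square)
  qed
  have step: "P ((4/3) \<odot> X)" if PX: "P X" for X
    unfolding P_def
  proof (intro conjI ballI)
    have X[simp]: "X \<in> carrier A" "star A X = X" using PX by (auto simp: P_def)
    show "(4/3) \<odot> X \<in> carrier A" "star A ((4/3) \<odot> X) = (4/3) \<odot> X" by (simp_all add: star_smult)
    fix z k assume z[simp]: "z \<in> carrier A" and k: "k \<in> {1::complex, -1}"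
    define V where "V z = z \<oplus> k \<odot> (X \<otimes> z)" for z
    have V[simp]: "V z \<in> carrier A" if "z \<in> carrier A" for z using that by (simp add: V_def)
    have Vle: "cnorm A (V u) \<le> cnorm A u" if "u \<in> carrier A" for u
      using PX k that by (auto simp: P_def V_def)
    have "cnorm A (V (V z)) \<le> cnorm A z"
      using Vle[of z] Vle[of "V z"] by simp
    moreover have "cnorm A (z \<ominus> 2 \<odot> (X \<otimes> (X \<otimes> z))) \<le> cnorm A z"
      using half[OF PX] by (intro cnorm_minus_double_square_le) auto
    moreover have "z \<oplus> k \<odot> (((4/3) \<odot> X) \<otimes> z) = (2/3) \<odot> V (V z) \<oplus> (1/3) \<odot> (z \<ominus> 2 \<odot> (X \<otimes> (X \<otimes> z)))"
      unfolding V_def by (simp add: expand_simps, rule lin_eqI[where xs = "[z, X \<otimes> z, X \<otimes> (X \<otimes> z)]"],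
        (rule lin_reps)+) (use k in \<open>auto simp: All_less_Suc\<close>)
    ultimately show "cnorm A (z \<oplus> k \<odot> (((4/3) \<odot> X) \<otimes> z)) \<le> cnorm A z"
      using cnorm_triangle[of "(2/3) \<odot> V (V z)" "(1/3) \<odot> (z \<ominus> 2 \<odot> (X \<otimes> (X \<otimes> z)))"] by simp
  qed
  have "P ((4/3) ^ n \<odot> X)" for n
  proof (induction n)
    case 0
    then show ?case using X plus minus by (auto simp: P_def minus_eq_scalar)
  next
    case (Suc n)
    then show ?case using step[of "(4/3) ^ n \<odot> X"] X by simp
  qed
  from half[OF this] have bound: "(4/3) ^ n * cnorm A X \<le> 1/2" for n using X by (simp add: norm_power)
  have "cnorm A X = 0"
  proof (rule ccontr)
    assume "cnorm A X \<noteq> 0"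
    then have pos: "0 < cnorm A X" using cnorm_nonneg[OF X(1)] by simp
    obtain n where "1 / cnorm A X < (4/3) ^ n" using real_arch_pow[of "4/3" "1 / cnorm A X"] by auto
    then have "1 < (4/3) ^ n * cnorm A X" using pos by (simp add: pos_divide_less_eq)
    with bound[of n] show False by linarith
  qed
  then show ?thesis using X by (simp add: cnorm_eq_0)
qed

text \<open>With \<open>y = c (1 - b)\<close> and \<open>x = a (1 - b)\<close> one has \<open>y\<^sup>*y = - x\<^sup>*x\<close>. Both
  \<open>1 + y\<^sup>*y\<close> and hence \<open>1 + yy\<^sup>*\<close> are contractions, while \<open>2 (y\<^sup>*y + yy\<^sup>*)\<close> is the sum of the squares of
  the selfadjoint elements \<open>y + y\<^sup>*\<close> and \<open>\<i> (y - y\<^sup>*)\<close>; so \<open>1 \<plusminus> \<delta> y\<^sup>*y\<close> are contractions for small \<open>\<delta>\<close>.\<close>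

lemma projection_le_absorb:
  assumes a: "projection A a" and b: "projection A b" and le: "cstar_le A a b"
  shows "b \<otimes> a = a" "a \<otimes> b = a"
proof -
  note ab = projectionD[OF a] projectionD[OF b]
  note [simp] = ab(1,5)
  obtain c where c[simp]: "c \<in> carrier A" and bc: "b \<ominus> a = star A c \<otimes> c"
    using le by (auto simp: cstar_le_def)
  have cc: "star A c \<otimes> (c \<otimes> z) = b \<otimes> z \<ominus> a \<otimes> z" if "z \<in> carrier A" for z
    using that arg_cong[OF bc, of "\<lambda>t. t \<otimes> z"] by (simp add: expand_simps)
  define y where "y = c \<ominus> c \<otimes> b"
  define x where "x = a \<ominus> a \<otimes> b"
  have y[simp]: "y \<in> carrier A" and x[simp]: "x \<in> carrier A" by (simp_all add: y_def x_def)
  \<comment> \<open>\<open>y^* y = (1 - b) (b - a) (1 - b)\<close>, and the contribution of the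
    middle \<open>b\<close> vanishes.\<close>
  have yx: "star A y \<otimes> y = (-1) \<odot> (star A x \<otimes> x)"
    unfolding y_def x_def
    by (simp add: expand_simps cc ab flip: bc, rule lin_eqI[where xs = "[a, b, a \<otimes> b, b \<otimes> a, b \<otimes> (a \<otimes> b)]"],
      (rule lin_reps)+) (auto simp: All_less_Suc)
  have yyz: "star A y \<otimes> (y \<otimes> z) = (-1) \<odot> (star A x \<otimes> (x \<otimes> z))" if "z \<in> carrier A" for z
    using that arg_cong[OF yx, of "\<lambda>t. t \<otimes> z"] by (simp add: expand_simps)
  have le1: "cnorm A (z \<oplus> star A y \<otimes> (y \<otimes> z)) \<le> cnorm A z" if z[simp]: "z \<in> carrier A" for z
  proof -
    have "z \<oplus> star A y \<otimes> (y \<otimes> z) = z \<ominus> (a \<otimes> (z \<ominus> b \<otimes> z) \<ominus> b \<otimes> (a \<otimes> (z \<ominus> b \<otimes> z)))"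
      unfolding yyz[OF z] unfolding x_def
      by (simp add: expand_simps ab, rule lin_eqI[where xs = "[z, a \<otimes> z, a \<otimes> (b \<otimes> z), b \<otimes> (a \<otimes> z), b \<otimes> (a \<otimes> (b \<otimes> z))]"],
        (rule lin_reps)+) (auto simp: All_less_Suc)
    with cnorm_minus_compression_le[OF a b z] show ?thesis by simp
  qed
  have le2: "cnorm A (z \<oplus> y \<otimes> (star A y \<otimes> z)) \<le> cnorm A z" if "z \<in> carrier A" for z
    by (rule cnorm_plus_swap[OF y that le1])
  define r where "r = y \<oplus> star A y"
  define s where "s = \<i> \<odot> (y \<ominus> star A y)"
  have r[simp]: "r \<in> carrier A" "star A r = r" by (simp_all add: r_def star_add M.a_comm)
  have s[simp]: "s \<in> carrier A" by (simp add: s_def)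
  have s'[simp]: "star A s = s" unfolding s_def
    by (simp add: expand_simps, rule lin_eqI[where xs = "[y, star A y]"], (rule lin_reps)+) (auto simp: All_less_Suc)
  \<comment> \<open>\<open>3 \<delta> \<le> 1\<close> lets convexity shrink \<open>1 + y y^*\<close>
    to \<open>1 + 3 \<delta> y y^*\<close>; the other two bounds make
    \<open>1 - 3/2 \<delta> r^2\<close> and \<open>1 - 3/2 \<delta> s^2\<close>
    contractions.\<close>
  define \<delta> where "\<delta> = 1 / (3 * (1 + (cnorm A r)\<^sup>2 + (cnorm A s)\<^sup>2))"
  have \<delta>: "0 < \<delta>" "3 * \<delta> \<le> 1" "3 / 2 * \<delta> * (cnorm A r)\<^sup>2 < 2" "3 / 2 * \<delta> * (cnorm A s)\<^sup>2 < 2"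
  proof -
    obtain R S where R: "R = (cnorm A r)\<^sup>2" "S = (cnorm A s)\<^sup>2" "0 \<le> R" "0 \<le> S" by simp
    then show "0 < \<delta>" "3 * \<delta> \<le> 1" "3 / 2 * \<delta> * (cnorm A r)\<^sup>2 < 2" "3 / 2 * \<delta> * (cnorm A s)\<^sup>2 < 2"
      unfolding \<delta>_def R(1,2)[symmetric] by (auto simp: field_simps)
  qed
  have conv: "cnorm A (z \<oplus> complex_of_real t \<odot> u) \<le> cnorm A z"
    if "z \<in> carrier A" "u \<in> carrier A" "cnorm A (z \<oplus> u) \<le> cnorm A z" "0 \<le> t" "t \<le> 1" for z u t
  proof -
    have "z \<oplus> complex_of_real t \<odot> u = complex_of_real (1 - t) \<odot> z \<oplus> complex_of_real t \<odot> (z \<oplus> u)"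
      by (rule lin_eqI[where xs = "[z, u]"], (rule lin_reps)+) (use that in \<open>auto simp: All_less_Suc\<close>)
    then have "cnorm A (z \<oplus> complex_of_real t \<odot> u) \<le> (1 - t) * cnorm A z + t * cnorm A (z \<oplus> u)"
      using that cnorm_triangle[of "complex_of_real (1 - t) \<odot> z" "complex_of_real t \<odot> (z \<oplus> u)"]
      by (simp del: of_real_diff)
    also have "\<dots> \<le> (1 - t) * cnorm A z + t * cnorm A z" using that by (intro add_left_mono mult_left_mono)
    finally show ?thesis by (simp add: algebra_simps)
  qed
  define X where "X = complex_of_real (- \<delta>) \<odot> (star A y \<otimes> y)"
  have "X = \<zero>"
  proof (rule unit_extreme)
    show "X \<in> carrier A" "star A X = X" by (simp_all add: X_def star_smult star_mult)
    fix z assume z[simp]: "z \<in> carrier A"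
    have "z \<ominus> X \<otimes> z = z \<oplus> complex_of_real \<delta> \<odot> (star A y \<otimes> (y \<otimes> z))"
      by (simp add: X_def minus_eq_scalar mult_assoc)
    then show "cnorm A (z \<ominus> X \<otimes> z) \<le> cnorm A z" using conv[OF z _ le1[OF z], of \<delta>] \<delta> by simp
    let ?u = "z \<oplus> complex_of_real (3 * \<delta>) \<odot> (y \<otimes> (star A y \<otimes> z))"
    let ?R = "\<lambda>r. z \<ominus> complex_of_real (3 / 2 * \<delta>) \<odot> (r \<otimes> (r \<otimes> z))"
    have "cnorm A ?u \<le> cnorm A z" using conv[OF z _ le2[OF z], of "3 * \<delta>"] \<delta> by simp
    moreover have "cnorm A (?R r) \<le> cnorm A z" "cnorm A (?R s) \<le> cnorm A z"
      using \<delta> by (intro cnorm_minus_square_le; simp)+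
    \<comment> \<open>As \<open>r^2 + s^2 = 2 y^* y + 2 y y^*\<close>, the terms in
      \<open>y y^*\<close> cancel in the mean of the three contractions and
      \<open>1 - \<delta> y^* y\<close> remains.\<close>
    moreover have "z \<oplus> X \<otimes> z = (1/3) \<odot> ((?u \<oplus> ?R r) \<oplus> ?R s)"
      unfolding X_def r_def s_def
      by (simp add: expand_simps, rule lin_eqI[where xs = "[z, y \<otimes> (y \<otimes> z), y \<otimes> (star A y \<otimes> z),
        star A y \<otimes> (y \<otimes> z), star A y \<otimes> (star A y \<otimes> z)]"], (rule lin_reps)+) (auto simp: All_less_Suc algebra_simps)
    ultimately show "cnorm A (z \<oplus> X \<otimes> z) \<le> cnorm A z"
      using cnorm_triangle[of "?u \<oplus> ?R r" "?R s"] cnorm_triangle[of ?u "?R r"] by simp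
  qed
  then have "cnorm A X = 0" by simp
  then have "cnorm A (star A x \<otimes> x) = 0" using \<delta> by (simp add: X_def yx)
  then have "x = \<zero>" by (simp add: cnorm_star_mult cnorm_eq_0)
  then show 1: "a \<otimes> b = a" by (simp add: x_def diff_eq_zero_iff)
  show "b \<otimes> a = a" using arg_cong[OF 1, of "star A"] by (simp add: star_mult ab)
qed

end

section \<open>Separable C*-algebras and the universal property\<close>

lemma generatesD:
  "\<lbrakk>generates A G; cstar_subalgebra A S; G \<subseteq> S; x \<in> carrier A\<rbrakk> \<Longrightarrow> x \<in> S"
  unfolding generates_def by blast

context cstar_algebra
begin

definition dense_in :: "'a set \<Rightarrow> bool" where
  "dense_in D \<longleftrightarrow> D \<subseteq> carrier A \<and> (\<forall>l\<in>carrier A. \<forall>r>0. \<exists>x\<in>D. cnorm A (l \<ominus> x) < r)"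

lemma calg_closed_preimage:
  assumes T: "\<And>x. x \<in> carrier A \<Longrightarrow> T x \<in> carrier A"
    and diff: "\<And>x y. \<lbrakk>x \<in> carrier A; y \<in> carrier A\<rbrakk> \<Longrightarrow> T (x \<ominus> y) = T x \<ominus> T y"
    and bound: "\<And>x. x \<in> carrier A \<Longrightarrow> cnorm A (T x) \<le> K * cnorm A x"
    and S: "calg_closed A S"
  shows "calg_closed A {x \<in> carrier A. T x \<in> S}"
  unfolding calg_closed_iff
proof (intro conjI ballI impI)
  fix l assume l: "l \<in> carrier A" and cl: "\<forall>r>0. \<exists>x\<in>{x \<in> carrier A. T x \<in> S}. cnorm A (l \<ominus> x) < r"
  have "T l \<in> S"
  proof (rule calg_closedD[OF S T[OF l]])
    fix r :: real assume r: "0 < r"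
    then obtain x where x: "x \<in> carrier A" "T x \<in> S" "cnorm A (l \<ominus> x) < r / (\<bar>K\<bar> + 1)"
      using cl[rule_format, of "r / (\<bar>K\<bar> + 1)"] by auto
    have "cnorm A (T l \<ominus> T x) \<le> K * cnorm A (l \<ominus> x)" using bound[of "l \<ominus> x"] diff l x by simp
    also have "\<dots> \<le> (\<bar>K\<bar> + 1) * cnorm A (l \<ominus> x)"
      using cnorm_nonneg[of "l \<ominus> x"] l x by (intro mult_right_mono) auto
    also have "\<dots> < r" using x r by (simp add: field_simps)
    finally show "\<exists>x\<in>S. cnorm A (T l \<ominus> x) < r" using x by blast
  qed
  with l show "l \<in> {x \<in> carrier A. T x \<in> S}" by simp
qed auto

text \<open>Only scalars from a dense set \<open>Q\<close> act on \<open>D\<close>, which allows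
  \<open>D\<close> to be countable; passing to the closure restores all complex scalars.\<close>

lemma closure_subalgebra:
  assumes D: "D \<subseteq> carrier A" "\<zero> \<in> D" and add: "\<And>x y. \<lbrakk>x \<in> D; y \<in> D\<rbrakk> \<Longrightarrow> x \<oplus> y \<in> D"
    and mult: "\<And>x y. \<lbrakk>x \<in> D; y \<in> D\<rbrakk> \<Longrightarrow> x \<otimes> y \<in> D"
    and star: "\<And>x. x \<in> D \<Longrightarrow> star A x \<in> D"
    and Q: "\<And>S. \<lbrakk>open S; S \<noteq> {}\<rbrakk> \<Longrightarrow> \<exists>c\<in>Q. c \<in> S"
    and scale: "\<And>c x. \<lbrakk>c \<in> Q; x \<in> D\<rbrakk> \<Longrightarrow> c \<odot> x \<in> D"
  shows "cstar_subalgebra A {l \<in> carrier A. \<forall>r>0. \<exists>x\<in>D. cnorm A (l \<ominus> x) < r}" (is "cstar_subalgebra A ?C")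
  unfolding cstar_subalgebra_def linear_subspace_def
proof (intro conjI ballI allI)
  have DA: "x \<in> D \<Longrightarrow> x \<in> carrier A" for x using D by blast
  \<comment> \<open>An error \<open>K r\<close> for all \<open>r < 1\<close> suffices, so the
    estimates for products and scalars below need no tuned tolerances. Using
    \<open>\<bar>K\<bar> + 1\<close> avoids a division by zero.\<close>
  have CI: "l \<in> ?C" if l: "l \<in> carrier A" and approx: "\<And>r. \<lbrakk>0 < r; r < 1\<rbrakk> \<Longrightarrow> \<exists>x\<in>D. cnorm A (l \<ominus> x) \<le> K * r" for l K
  proof (clarsimp simp: l)
    fix r :: real assume r: "0 < r"
    define r' where "r' = min (1/2) (r / (2 * (\<bar>K\<bar> + 1)))"
    have r': "0 < r'" "r' < 1" "r' \<le> r / (2 * (\<bar>K\<bar> + 1))" using r by (auto simp: r'_def)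
    then obtain x where x: "x \<in> D" "cnorm A (l \<ominus> x) \<le> K * r'" using approx[OF r'(1,2)] by blast
    have "K * r' \<le> (\<bar>K\<bar> + 1) * r'" using r' by (intro mult_right_mono) auto
    also have "\<dots> \<le> (\<bar>K\<bar> + 1) * (r / (2 * (\<bar>K\<bar> + 1)))" using r' by (intro mult_left_mono) auto
    also have "\<dots> < r" using r by (simp add: field_simps add_pos_nonneg)
    finally show "\<exists>x\<in>D. cnorm A (l \<ominus> x) < r" using x by (intro bexI[of _ x]) auto
  qed
  have CE: "l \<in> carrier A" "\<exists>x\<in>D. x \<in> carrier A \<and> cnorm A (l \<ominus> x) < r" if "l \<in> ?C" "0 < r" for l r
    using that DA by auto
  show "?C \<subseteq> carrier A" by auto
  show "\<zero> \<in> ?C" using D by (auto intro: bexI[of _ \<zero>])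
  fix l assume l: "l \<in> ?C"
  then have lA[simp]: "l \<in> carrier A" by simp
  show "star A l \<in> ?C"
  proof (rule CI[of _ 1])
    fix r :: real assume "0 < r"
    then obtain x where x: "x \<in> D" "x \<in> carrier A" "cnorm A (l \<ominus> x) < r" using CE[OF l] by blast
    then have "cnorm A (star A l \<ominus> star A x) \<le> 1 * r"
      using cnorm_star[of "l \<ominus> x"] by (simp add: star_diff)
    then show "\<exists>x\<in>D. cnorm A (star A l \<ominus> x) \<le> 1 * r" using star[OF x(1)] by blast
  qed simp
  show "c \<odot> l \<in> ?C" for c
  proof (rule CI[of _ "cmod c + 1 + cnorm A l"])
    fix r :: real assume r: "0 < r" "r < 1"
    then obtain x where x: "x \<in> D" "x \<in> carrier A" "cnorm A (l \<ominus> x) < r" using CE[OF l] by blast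
    obtain q where q: "q \<in> Q" "cmod (c - q) < r"
      using Q[of "ball c r"] r by (auto simp: dist_norm)
    have "c \<odot> l \<ominus> q \<odot> x = (c - q) \<odot> l \<oplus> q \<odot> (l \<ominus> x)"
      by (rule lin_eqI[where xs = "[l, x]"], (rule lin_reps)+) (use x in \<open>auto simp: All_less_Suc algebra_simps\<close>)
    then have "cnorm A (c \<odot> l \<ominus> q \<odot> x) \<le> cmod (c - q) * cnorm A l + cmod q * cnorm A (l \<ominus> x)"
      using cnorm_triangle[of "(c - q) \<odot> l" "q \<odot> (l \<ominus> x)"] x by simp
    also have "\<dots> \<le> r * cnorm A l + (cmod c + 1) * r"
      using q r x norm_triangle_sub[of q c] norm_minus_commute[of q c]
      by (intro add_mono mult_mono) (auto simp: cnorm_nonneg)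
    finally have "cnorm A (c \<odot> l \<ominus> q \<odot> x) \<le> (cmod c + 1 + cnorm A l) * r" by (simp add: algebra_simps)
    then show "\<exists>x\<in>D. cnorm A (c \<odot> l \<ominus> x) \<le> (cmod c + 1 + cnorm A l) * r" using scale[OF q(1) x(1)] by blast
  qed simp
  fix l' assume l': "l' \<in> ?C"
  then have l'A[simp]: "l' \<in> carrier A" by simp
  show "l \<oplus> l' \<in> ?C"
  proof (rule CI[of _ 2])
    fix r :: real assume "0 < r"
    then obtain x x' where x: "x \<in> D" "x \<in> carrier A" "cnorm A (l \<ominus> x) < r"
      and x': "x' \<in> D" "x' \<in> carrier A" "cnorm A (l' \<ominus> x') < r" using CE[OF l] CE[OF l'] by blast
    have "(l \<oplus> l') \<ominus> (x \<oplus> x') = (l \<ominus> x) \<oplus> (l' \<ominus> x')"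
      by (rule lin_eqI[where xs = "[l, x, l', x']"], (rule lin_reps)+) (use x x' in \<open>auto simp: All_less_Suc\<close>)
    then have "cnorm A ((l \<oplus> l') \<ominus> (x \<oplus> x')) \<le> 2 * r"
      using cnorm_triangle[of "l \<ominus> x" "l' \<ominus> x'"] x x' by simp
    then show "\<exists>x\<in>D. cnorm A ((l \<oplus> l') \<ominus> x) \<le> 2 * r" using add[OF x(1) x'(1)] by blast
  qed simp
  show "l \<otimes> l' \<in> ?C"
  proof (rule CI[of _ "cnorm A l + 1 + cnorm A l'"])
    fix r :: real assume r: "0 < r" "r < 1"
    then obtain x x' where x: "x \<in> D" "x \<in> carrier A" "cnorm A (l \<ominus> x) < r"
      and x': "x' \<in> D" "x' \<in> carrier A" "cnorm A (l' \<ominus> x') < r" using CE[OF l] CE[OF l'] by blast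
    note [simp] = x(2) x'(2)
    have "l \<otimes> l' \<ominus> x \<otimes> x' = x \<otimes> (l' \<ominus> x') \<oplus> (l \<ominus> x) \<otimes> l'"
      by (simp add: expand_simps, rule lin_eqI[where xs = "[l \<otimes> l', x \<otimes> x', x \<otimes> l']"], (rule lin_reps)+)
        (auto simp: All_less_Suc)
    then have "cnorm A (l \<otimes> l' \<ominus> x \<otimes> x') \<le> cnorm A x * cnorm A (l' \<ominus> x') + cnorm A (l \<ominus> x) * cnorm A l'"
      using cnorm_triangle[of "x \<otimes> (l' \<ominus> x')" "(l \<ominus> x) \<otimes> l'"] cnorm_mult[of x "l' \<ominus> x'"]
        cnorm_mult[of "l \<ominus> x" l'] by simp
    also have "\<dots> \<le> (cnorm A l + 1) * r + r * cnorm A l'"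
      using r x x' cnorm_le_diff[of x l] cnorm_minus_commute[of x l]
      by (intro add_mono mult_mono) (auto simp: cnorm_nonneg)
    finally have "cnorm A (l \<otimes> l' \<ominus> x \<otimes> x') \<le> (cnorm A l + 1 + cnorm A l') * r" by (simp add: algebra_simps)
    then show "\<exists>x\<in>D. cnorm A (l \<otimes> l' \<ominus> x) \<le> (cnorm A l + 1 + cnorm A l') * r" using mult[OF x(1) x'(1)] by blast
  qed simp
next
  show "calg_closed A ?C"
    unfolding calg_closed_iff
  proof (intro conjI ballI impI)
    fix l assume l: "l \<in> carrier A" and cl: "\<forall>r>0. \<exists>x\<in>?C. cnorm A (l \<ominus> x) < r"
    have "\<exists>x\<in>D. cnorm A (l \<ominus> x) < r" if r: "0 < r" for r
    proof -
      obtain y where y: "y \<in> ?C" "cnorm A (l \<ominus> y) < r / 2" using cl r by (meson half_gt_zero)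
      then obtain x where x: "x \<in> D" "cnorm A (y \<ominus> x) < r / 2" using r by (auto dest: spec[of _ "r / 2"])
      then have "cnorm A (l \<ominus> x) < r" using cnorm_diff_triangle[of l y x] l x y D by auto
      with x show ?thesis by blast
    qed
    with l show "l \<in> ?C" by blast
  qed auto
qed

text \<open>The generators are closed off under the operations and under scalars from a countable
  dense set. The closure of the resulting countable set is a C*-subalgebra containing
  \<open>G\<close>, hence everything.\<close>

lemma countable_dense:
  assumes G: "countable G" and gen: "generates A G"
  obtains D where "countable D" "dense_in D"
proof -
  obtain Q :: "complex set" where Q: "countable Q" "\<And>S. \<lbrakk>open S; S \<noteq> {}\<rbrakk> \<Longrightarrow> \<exists>c\<in>Q. c \<in> S"
    using countable_dense_setE by blast
  define step where "step X = X \<union> (\<lambda>(x, y). x \<oplus> y) ` (X \<times> X) \<union> (\<lambda>(x, y). x \<otimes> y) ` (X \<times> X)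
    \<union> star A ` X \<union> (\<lambda>(c, x). c \<odot> x) ` (Q \<times> X)" for X
  define E where "E n = (step ^^ n) (insert \<zero> G)" for n
  define D where "D = (\<Union>n. E n)"
  have E_Suc: "E (Suc n) = step (E n)" for n by (simp add: E_def)
  have "countable (E n)" for n
  proof (induction n)
    case 0
    then show ?case using G by (simp add: E_def)
  next
    case (Suc n)
    then show ?case unfolding E_Suc step_def using Q(1)
      by (intro countable_Un countable_image countable_SIGMA)
  qed
  then have "countable D" by (simp add: D_def)
  have "E n \<subseteq> E (Suc n)" for n by (auto simp: E_Suc step_def)
  then have mono: "E m \<subseteq> E n" if "m \<le> n" for m n using that by (rule lift_Suc_mono_le)
  have "E n \<subseteq> carrier A" for n
  proof (induction n)
    case 0
    then show ?case using gen by (auto simp: E_def generates_def)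
  next
    case (Suc n)
    then show ?case by (auto simp: E_Suc step_def)
  qed
  then have DA: "D \<subseteq> carrier A" by (auto simp: D_def)
  have pair: "\<exists>n. x \<in> E n \<and> y \<in> E n" if xy: "x \<in> D" "y \<in> D" for x y
  proof -
    obtain m n where "x \<in> E m" "y \<in> E n" using xy by (auto simp: D_def)
    then show ?thesis using mono[of m "max m n"] mono[of n "max m n"] by auto
  qed
  have stepD: "step (E n) \<subseteq> D" for n unfolding D_def E_Suc[symmetric] by blast
  have "cstar_subalgebra A {l \<in> carrier A. \<forall>r>0. \<exists>x\<in>D. cnorm A (l \<ominus> x) < r}"
  proof (rule closure_subalgebra[OF DA _ _ _ _ Q(2)])
    show "\<zero> \<in> D" by (auto simp: D_def E_def intro: exI[of _ 0])
    fix x y assume "x \<in> D" "y \<in> D"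
    then obtain n where n: "x \<in> E n" "y \<in> E n" using pair by blast
    then have "x \<oplus> y \<in> step (E n)" "x \<otimes> y \<in> step (E n)" by (auto simp: step_def)
    then show "x \<oplus> y \<in> D" "x \<otimes> y \<in> D" using stepD by blast+
  next
    fix x assume "x \<in> D"
    then obtain n where n: "x \<in> E n" by (auto simp: D_def)
    then have "star A x \<in> step (E n)" by (simp add: step_def)
    then show "star A x \<in> D" using stepD by blast
    fix c assume "c \<in> Q"
    with n have "c \<odot> x \<in> step (E n)" by (auto simp: step_def)
    then show "c \<odot> x \<in> D" using stepD by blast
  qed auto
  moreover have "G \<subseteq> {l \<in> carrier A. \<forall>r>0. \<exists>x\<in>D. cnorm A (l \<ominus> x) < r}"
  proof
    fix g assume g: "g \<in> G"
    then have "g \<in> E 0" by (simp add: E_def)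
    then have "g \<in> D" unfolding D_def by blast
    then show "g \<in> {l \<in> carrier A. \<forall>r>0. \<exists>x\<in>D. cnorm A (l \<ominus> x) < r}"
      using DA by (auto intro!: bexI[of _ g])
  qed
  ultimately have "dense_in D" using generatesD[OF gen] DA unfolding dense_in_def by blast
  with \<open>countable D\<close> show thesis by (rule that)
qed

text \<open>An element is encoded by the indices in \<open>D\<close> of chosen approximations to
  within \<open>1 / (n + 1)\<close>; equal codes force distance zero.\<close>

lemma injection_to_sequences:
  assumes D: "countable D" "dense_in D"
  obtains g :: "'a \<Rightarrow> nat \<Rightarrow> nat" where "inj_on g (carrier A)"
proof -
  define near where "near l n = (SOME x. x \<in> D \<and> cnorm A (l \<ominus> x) < 1 / real (Suc n))" for l n
  have near: "near l n \<in> D \<and> cnorm A (l \<ominus> near l n) < 1 / real (Suc n)" if "l \<in> carrier A" for l n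
  proof -
    have "0 < 1 / real (Suc n)" by simp
    then have "\<exists>x. x \<in> D \<and> cnorm A (l \<ominus> x) < 1 / real (Suc n)"
      using D(2) that unfolding dense_in_def by blast
    then show ?thesis unfolding near_def by (rule someI_ex)
  qed
  have "inj_on (\<lambda>l n. to_nat_on D (near l n)) (carrier A)"
  proof (rule inj_onI)
    fix l l' assume l: "l \<in> carrier A" "l' \<in> carrier A"
      and eq: "(\<lambda>n. to_nat_on D (near l n)) = (\<lambda>n. to_nat_on D (near l' n))"
    have "near l n = near l' n" for n
      using fun_cong[OF eq, of n] near l inj_on_to_nat_on[OF D(1)] by (meson inj_onD)
    then have small: "cnorm A (l \<ominus> l') < 2 * (1 / real (Suc n))" for n
      using near[OF l(1), of n] near[OF l(2), of n] cnorm_diff_triangle[of l "near l n" l']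
        cnorm_minus_commute[of "near l n" l'] l D(2) by (auto simp: dense_in_def subset_iff)
    have "cnorm A (l \<ominus> l') \<le> 0"
    proof (rule LIMSEQ_le_const)
      show "(\<lambda>n. 2 * (1 / real (Suc n))) \<longlonglongrightarrow> 0"
        using tendsto_mult[OF tendsto_const[of "2::real"] lim_1_over_n[THEN LIMSEQ_Suc]] by simp
    qed (use small less_imp_le in blast)
    then show "l = l'" using cnorm_nonneg[of "l \<ominus> l'"] l by (simp add: cnorm_eq_0 diff_eq_zero_iff)
  qed
  then show thesis by (rule that)
qed

end

section \<open>Transport of structure and the universal property for countably generated
  targets\<close>

definition transport :: "('a \<Rightarrow> 'b) \<Rightarrow> 'a star_algebra \<Rightarrow> 'b star_algebra" where
  "transport g A = (let i = inv_into (carrier A) g in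
    \<lparr>carrier = g ` carrier A, monoid.mult = (\<lambda>x y. g (i x \<otimes>\<^bsub>A\<^esub> i y)), one = g \<one>\<^bsub>A\<^esub>,
     ring.zero = g \<zero>\<^bsub>A\<^esub>, add = (\<lambda>x y. g (i x \<oplus>\<^bsub>A\<^esub> i y)), smult = (\<lambda>c x. g (c \<odot>\<^bsub>A\<^esub> i x)),
     star = (\<lambda>x. g (star A (i x))), cnorm = (\<lambda>x. cnorm A (i x))\<rparr>)"

lemma transport_simps [simp]:
  "carrier (transport g A) = g ` carrier A" "\<zero>\<^bsub>transport g A\<^esub> = g \<zero>\<^bsub>A\<^esub>"
  by (simp_all add: transport_def Let_def)

lemma transport_ops [simp]:
  assumes "inj_on g (carrier A)" and "x \<in> carrier A"
  shows "y \<in> carrier A \<Longrightarrow> g x \<otimes>\<^bsub>transport g A\<^esub> g y = g (x \<otimes>\<^bsub>A\<^esub> y)"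
    and "y \<in> carrier A \<Longrightarrow> g x \<oplus>\<^bsub>transport g A\<^esub> g y = g (x \<oplus>\<^bsub>A\<^esub> y)"
    and "c \<odot>\<^bsub>transport g A\<^esub> g x = g (c \<odot>\<^bsub>A\<^esub> x)"
    and "star (transport g A) (g x) = g (star A x)"
    and "cnorm (transport g A) (g x) = cnorm A x"
  using assms by (simp_all add: transport_def Let_def)

lemma (in cstar_algebra) cstar_algebra_transport:
  assumes g: "inj_on g (carrier A)"
  shows "cstar_algebra (transport g A)"
proof -
  let ?T = "transport g A"
  note [simp] = transport_ops[OF g]
  have T: "abelian_group ?T"
  proof (rule abelian_groupI)
    show "\<exists>y\<in>carrier ?T. y \<oplus>\<^bsub>?T\<^esub> x = \<zero>\<^bsub>?T\<^esub>" if "x \<in> carrier ?T" for x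
      using that M.l_neg by (auto intro!: bexI[of _ "\<ominus> _"])
  qed (auto simp: M.a_ac)
  interpret T: abelian_group ?T by (rule T)
  have mod: "module complex_ring ?T"
    by (rule moduleI[OF R.is_cring T]) (auto simp: complex_ring_def scalar_add_left scalar_add_right)
  have minus: "g x \<ominus>\<^bsub>?T\<^esub> g y = g (x \<ominus> y)" if "x \<in> carrier A" "y \<in> carrier A" for x y
    using that T.minus_equality[of "g (\<ominus> y)" "g y"] by (simp add: a_minus_def M.l_neg)
  have dist: "cdist ?T (g x) (g y) = cdist A x y" if "x \<in> carrier A" "y \<in> carrier A" for x y
    using that by (simp add: cdist_def minus)
  interpret A: Metric_space "carrier A" "cdist A" by (rule Metric_space_cdist)
  interpret M': Metric_space "carrier ?T" "cdist ?T"
  proof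
    fix x y
    show "0 \<le> cdist ?T x y"
      by (cases "x \<in> carrier ?T \<and> y \<in> carrier ?T") (auto simp: dist cnorm_nonneg, auto simp: cdist_def)
    show "cdist ?T x y = cdist ?T y x"
      by (cases "x \<in> carrier ?T \<and> y \<in> carrier ?T") (auto simp: dist A.commute, auto simp: cdist_def)
  next
    fix x y assume "x \<in> carrier ?T" "y \<in> carrier ?T"
    then show "cdist ?T x y = 0 \<longleftrightarrow> x = y" by (auto simp: dist cnorm_eq_0 diff_eq_zero_iff)
  next
    fix x y z assume "x \<in> carrier ?T" "y \<in> carrier ?T" "z \<in> carrier ?T"
    then show "cdist ?T x z \<le> cdist ?T x y + cdist ?T y z" by (auto simp: dist A.triangle simp del: cdist_eq)
  qed
  have "M'.mcomplete"
    unfolding M'.mcomplete_def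
  proof (intro allI impI)
    fix \<sigma> assume \<sigma>: "M'.MCauchy \<sigma>"
    then have "\<sigma> n \<in> g ` carrier A" for n unfolding M'.MCauchy_def by auto
    then have "\<exists>x\<in>carrier A. \<sigma> n = g x" for n by blast
    then obtain \<tau> where \<tau>: "\<And>n. \<tau> n \<in> carrier A" "\<And>n. \<sigma> n = g (\<tau> n)" by metis
    have "A.MCauchy \<tau>"
      using \<sigma> unfolding M'.MCauchy_def A.MCauchy_def by (auto simp: \<tau> dist simp del: cdist_eq)
    then obtain l where "limitin A.mtopology \<tau> l sequentially"
      using complete by (auto simp: A.mcomplete_def)
    then have "limitin M'.mtopology \<sigma> (g l) sequentially"
      unfolding A.limitin_metric M'.limitin_metric by (auto simp: \<tau> dist simp del: cdist_eq)
    then show "\<exists>x. limitin M'.mtopology \<sigma> x sequentially" by blast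
  qed
  then show ?thesis
    by (intro cstar_algebra.intro[OF mod] cstar_algebra_axioms.intro)
      (auto simp: mult_assoc mult_add_left mult_add_right star_add star_smult star_mult cnorm_nonneg
        cnorm_eq_0 cnorm_triangle cnorm_mult cnorm_star_mult inj_on_eq_iff[OF g])
qed

lemma (in cstar_algebra) transport_homs:
  assumes g: "inj_on g (carrier A)"
  shows "cstar_hom A (transport g A) g" "cstar_hom (transport g A) A (inv_into (carrier A) g)"
  using g by (auto simp: cstar_hom_def)

lemma cstar_hom_comp: "\<lbrakk>cstar_hom A B g; cstar_hom B C h\<rbrakk> \<Longrightarrow> cstar_hom A C (h \<circ> g)"
  by (simp add: cstar_hom_def)

lemma (in cstar_homomorphism) hom_finsum:
  assumes "finite S" "f \<in> S \<rightarrow> carrier A"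
  shows "h (\<Oplus>\<^bsub>A\<^esub>x\<in>S. f x) = (\<Oplus>\<^bsub>B\<^esub>x\<in>S. h (f x))"
  using assms
proof (induction S rule: finite_induct)
  case (insert x S)
  then have "f \<in> S \<rightarrow> carrier A" "f x \<in> carrier A" "(\<lambda>x. h (f x)) \<in> S \<rightarrow> carrier B" by (auto simp: Pi_iff)
  with insert show ?case by (simp add: A.M.finsum_insert B.M.finsum_insert A.M.finsum_closed)
qed simp

lemma (in cstar_homomorphism) hypergraph_family_hom:
  assumes H: "finite_hypergraph H" and fam: "hypergraph_family H A p s"
  shows "hypergraph_family H B (h \<circ> p) (h \<circ> s)"
proof -
  have p: "p v \<in> carrier A" if "v \<in> verts H" for v
    using fam that by (auto simp: hypergraph_family_def projection_def)
  have s: "s e \<in> carrier A" if "e \<in> edges H" for e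
    using fam that by (auto simp: hypergraph_family_def partial_isometry_def)
  have fin: "finite (rng H e)" "finite (src H e)" "rng H e \<subseteq> verts H" "src H e \<subseteq> verts H" if "e \<in> edges H" for e
    using H that by (auto simp: finite_hypergraph_def intro: finite_subset)
  have sums: "(\<Oplus>\<^bsub>B\<^esub>v\<in>S. h (p v)) = h (\<Oplus>\<^bsub>A\<^esub>v\<in>S. p v)" if "S \<subseteq> verts H" for S
    using that p H hom_finsum[of S p] by (auto simp: finite_hypergraph_def finite_subset Pi_iff subset_iff)
  have esums: "(\<Oplus>\<^bsub>B\<^esub>e\<in>S. h (s e) \<otimes>\<^bsub>B\<^esub> star B (h (s e))) = h (\<Oplus>\<^bsub>A\<^esub>e\<in>S. s e \<otimes>\<^bsub>A\<^esub> star A (s e))"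
    if S: "S \<subseteq> edges H" for S
  proof -
    have "h (\<Oplus>\<^bsub>A\<^esub>e\<in>S. s e \<otimes>\<^bsub>A\<^esub> star A (s e)) = (\<Oplus>\<^bsub>B\<^esub>e\<in>S. h (s e \<otimes>\<^bsub>A\<^esub> star A (s e)))"
      using S s H by (intro hom_finsum) (auto simp: finite_hypergraph_def intro: finite_subset)
    also have "\<dots> = (\<Oplus>\<^bsub>B\<^esub>e\<in>S. h (s e) \<otimes>\<^bsub>B\<^esub> star B (h (s e)))"
      using S s by (intro B.M.finsum_cong') (auto simp: subset_iff)
    finally show ?thesis ..
  qed
  have le: "cstar_le B (h a) (h b)" if "cstar_le A a b" for a b
    using that unfolding cstar_le_def by (metis A.mult_closed A.star_closed hom_diff hom_simps(1,4,5))
  show ?thesis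
    unfolding hypergraph_family_def comp_def
  proof (intro conjI ballI impI)
    fix v assume v: "v \<in> verts H"
    then have pv: "projection A (p v)" using fam by (simp add: hypergraph_family_def)
    then show "projection B (h (p v))"
      unfolding projection_def by (metis hom_simps(1,4,5))
    fix u assume "u \<in> verts H" "v \<noteq> u"
    with v have "p v \<otimes>\<^bsub>A\<^esub> p u = \<zero>\<^bsub>A\<^esub>" using fam by (simp add: hypergraph_family_def)
    with p v \<open>u \<in> verts H\<close> show "h (p v) \<otimes>\<^bsub>B\<^esub> h (p u) = \<zero>\<^bsub>B\<^esub>" by (metis hom_simps(4) hom_zero)
  next
    fix e assume e: "e \<in> edges H"
    then have "partial_isometry A (s e)" using fam by (simp add: hypergraph_family_def)
    then show "partial_isometry B (h (s e))"
      unfolding partial_isometry_def by (metis A.mult_closed A.star_closed hom_simps(1,4,5))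
    fix f assume f: "f \<in> edges H"
    have "star A (s e) \<otimes>\<^bsub>A\<^esub> s f = (if e = f then (\<Oplus>\<^bsub>A\<^esub>v\<in>rng H e. p v) else \<zero>\<^bsub>A\<^esub>)"
      using fam e f by (simp add: hypergraph_family_def)
    then show "star B (h (s e)) \<otimes>\<^bsub>B\<^esub> h (s f) = (if e = f then (\<Oplus>\<^bsub>B\<^esub>v\<in>rng H e. h (p v)) else \<zero>\<^bsub>B\<^esub>)"
      using s e f sums[OF fin(3)[OF e]] by (metis A.star_closed hom_simps(4,5) hom_zero)
  next
    fix e assume e: "e \<in> edges H"
    then have "cstar_le A (s e \<otimes>\<^bsub>A\<^esub> star A (s e)) (\<Oplus>\<^bsub>A\<^esub>v\<in>src H e. p v)"
      using fam by (simp add: hypergraph_family_def)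
    from le[OF this] show "cstar_le B (h (s e) \<otimes>\<^bsub>B\<^esub> star B (h (s e))) (\<Oplus>\<^bsub>B\<^esub>v\<in>src H e. h (p v))"
      using s e sums[OF fin(4)[OF e]] by simp
  next
    fix v assume v: "v \<in> verts H" "\<not> sink H v"
    then have "cstar_le A (p v) (\<Oplus>\<^bsub>A\<^esub>e\<in>{e \<in> edges H. v \<in> src H e}. s e \<otimes>\<^bsub>A\<^esub> star A (s e))"
      using fam by (simp add: hypergraph_family_def)
    from le[OF this] show "cstar_le B (h (p v)) (\<Oplus>\<^bsub>B\<^esub>e\<in>{e \<in> edges H. v \<in> src H e}. h (s e) \<otimes>\<^bsub>B\<^esub> star B (h (s e)))"
      using esums[of "{e \<in> edges H. v \<in> src H e}"] by simp
  qed
qed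

text \<open>\<open>B\<close> is copied onto a subset of \<open>nat \<Rightarrow> nat\<close>, where
  the universal property applies, and the homomorphism found there is composed with the inverse of
  the copying map.\<close>

lemma hypergraph_algebra_universal:
  fixes H :: "('v, 'e) hypergraph" and B :: "'b star_algebra"
  assumes H: "finite_hypergraph H" and alg: "is_hypergraph_algebra H A p s"
    and B: "cstar_algebra B" and G: "countable G" "generates B G" and fam: "hypergraph_family H B q t"
  obtains \<pi> where "cstar_hom A B \<pi>" "\<And>v. v \<in> verts H \<Longrightarrow> \<pi> (p v) = q v" "\<And>e. e \<in> edges H \<Longrightarrow> \<pi> (s e) = t e"
proof -
  interpret B: cstar_algebra B by (rule B)
  obtain D where "countable D" "B.dense_in D" using B.countable_dense[OF G] by blast
  then obtain g :: "'b \<Rightarrow> nat \<Rightarrow> nat" where g: "inj_on g (carrier B)" using B.injection_to_sequences by blast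
  let ?T = "transport g B" and ?i = "inv_into (carrier B) g"
  have T: "cstar_algebra ?T" by (rule B.cstar_algebra_transport[OF g])
  interpret g: cstar_homomorphism B ?T g
    by (intro cstar_homomorphism.intro cstar_homomorphism_axioms.intro B T B.transport_homs[OF g])
  have "hypergraph_family H ?T (g \<circ> q) (g \<circ> t)" by (rule g.hypergraph_family_hom[OF H fam])
  then obtain h where h: "cstar_hom A ?T h" "\<forall>v\<in>verts H. h (p v) = g (q v)" "\<forall>e\<in>edges H. h (s e) = g (t e)"
    using alg T unfolding is_hypergraph_algebra_def comp_def by blast
  have q: "q v \<in> carrier B" if "v \<in> verts H" for v
    using fam that by (auto simp: hypergraph_family_def projection_def)
  have t: "t e \<in> carrier B" if "e \<in> edges H" for e
    using fam that by (auto simp: hypergraph_family_def partial_isometry_def)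
  show thesis
  proof (rule that[of "?i \<circ> h"])
    show "cstar_hom A B (?i \<circ> h)" by (rule cstar_hom_comp[OF h(1) B.transport_homs(2)[OF g]])
    show "(?i \<circ> h) (p v) = q v" if "v \<in> verts H" for v
      using h(2) q[OF that] g that by simp
    show "(?i \<circ> h) (s e) = t e" if "e \<in> edges H" for e
      using h(3) t[OF that] g that by simp
  qed
qed

section \<open>Move R\<close>

locale hypergraph_representation = cstar_algebra A
  for A :: "'a star_algebra" (structure) and H :: "('v, 'e) hypergraph" and p :: "'v \<Rightarrow> 'a" and s :: "'e \<Rightarrow> 'a" +
  assumes finite_H: "finite_hypergraph H" and family: "hypergraph_family H A p s"
begin

definition psum :: "'v set \<Rightarrow> 'a" where
  "psum S = (\<Oplus>v\<in>S. p v)"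

lemma p_projection: "v \<in> verts H \<Longrightarrow> projection A (p v)"
  using family by (simp add: hypergraph_family_def)

lemma p_simps [simp]:
  assumes "v \<in> verts H"
  shows "p v \<in> carrier A" "star A (p v) = p v" "p v \<otimes> p v = p v"
  using projectionD[OF p_projection[OF assms]] by auto

lemma p_orthogonal: "\<lbrakk>v \<in> verts H; u \<in> verts H; v \<noteq> u\<rbrakk> \<Longrightarrow> p v \<otimes> p u = \<zero>"
  using family by (simp add: hypergraph_family_def)

lemma s_closed [simp]: "e \<in> edges H \<Longrightarrow> s e \<in> carrier A"
  using family by (simp add: hypergraph_family_def partial_isometry_def)

lemma s_star_s: "e \<in> edges H \<Longrightarrow> s e \<otimes> (star A (s e) \<otimes> s e) = s e"
proof -
  assume e: "e \<in> edges H"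
  then have "s e \<otimes> star A (s e) \<otimes> s e = s e"
    using family by (simp add: hypergraph_family_def partial_isometry_def)
  with e show ?thesis by (simp add: mult_assoc)
qed

lemma star_s_s: "e \<in> edges H \<Longrightarrow> star A (s e) \<otimes> s e = psum (rng H e)"
  using family by (simp add: hypergraph_family_def psum_def)

lemma star_s_s_distinct: "\<lbrakk>e \<in> edges H; e' \<in> edges H; e \<noteq> e'\<rbrakk> \<Longrightarrow> star A (s e) \<otimes> s e' = \<zero>"
  using family by (simp add: hypergraph_family_def)

lemma edge_sets:
  assumes "e \<in> edges H"
  shows "rng H e \<subseteq> verts H" "src H e \<subseteq> verts H"
  using finite_H assms by (auto simp: finite_hypergraph_def)

lemma finite_subset_verts: "S \<subseteq> verts H \<Longrightarrow> finite S"
  using finite_H by (auto simp: finite_hypergraph_def intro: finite_subset)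

lemma psum_closed [simp]: "S \<subseteq> verts H \<Longrightarrow> psum S \<in> carrier A"
  unfolding psum_def by (intro M.finsum_closed) auto

lemma psum_empty [simp]: "psum {} = \<zero>"
  by (simp add: psum_def)

lemma psum_insert: "\<lbrakk>insert v S \<subseteq> verts H; v \<notin> S\<rbrakk> \<Longrightarrow> psum (insert v S) = p v \<oplus> psum S"
  unfolding psum_def by (subst M.finsum_insert) (auto simp: finite_subset_verts)

lemma psum_singleton: "v \<in> verts H \<Longrightarrow> psum {v} = p v"
  using psum_insert[of v "{}"] by simp

lemma psum_induct [consumes 1, case_names empty insert]:
  assumes "S \<subseteq> verts H" "P {}"
    and "\<And>v S. \<lbrakk>v \<in> verts H; S \<subseteq> verts H; v \<notin> S; P S\<rbrakk> \<Longrightarrow> P (insert v S)"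
  shows "P S"
  using finite_subset_verts[OF assms(1)] assms(1)
  by (induction S rule: finite_induct) (auto intro: assms(2,3))

lemma p_mult_psum:
  assumes "S \<subseteq> verts H" "v \<in> verts H"
  shows "p v \<otimes> psum S = (if v \<in> S then p v else \<zero>)"
  using assms(1)
proof (induction S rule: psum_induct)
  case (insert u S)
  then show ?case using assms(2) p_orthogonal[OF assms(2) insert(1)]
    by (cases "u = v") (auto simp: psum_insert mult_add_right)
qed (use assms in auto)

lemma psum_mult:
  assumes "S \<subseteq> verts H" "T \<subseteq> verts H"
  shows "psum S \<otimes> psum T = psum (S \<inter> T)"
  using assms(1)
proof (induction S rule: psum_induct)
  case (insert v S)
  then have "S \<inter> T \<subseteq> verts H" by auto
  with insert assms show ?case
    by (cases "v \<in> T") (auto simp: psum_insert mult_add_left p_mult_psum)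
qed (use assms in auto)

lemma psum_projection:
  assumes "S \<subseteq> verts H" shows "projection A (psum S)"
proof -
  have "star A (psum S) = psum S"
    using assms by (induction S rule: psum_induct) (auto simp: psum_insert star_add)
  with assms show ?thesis by (simp add: projection_def psum_mult)
qed

lemma s_mult_psum:
  assumes "e \<in> edges H" "S \<subseteq> verts H"
  shows "s e \<otimes> psum S = s e \<otimes> psum (rng H e \<inter> S)"
proof -
  have "s e \<otimes> psum S = s e \<otimes> (psum (rng H e) \<otimes> psum S)"
    using s_star_s[OF assms(1)] assms edge_sets[OF assms(1)] by (simp add: star_s_s flip: mult_assoc)
  then show ?thesis using assms edge_sets[OF assms(1)] by (simp add: psum_mult)
qed

lemma s_mult_psum_rng [simp]: "e \<in> edges H \<Longrightarrow> s e \<otimes> psum (rng H e) = s e"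
  using s_star_s[of e] by (simp add: star_s_s)

lemma s_mult_psum_supset: "\<lbrakk>e \<in> edges H; S \<subseteq> verts H; rng H e \<subseteq> S\<rbrakk> \<Longrightarrow> s e \<otimes> psum S = s e"
  by (subst s_mult_psum) (simp_all add: Int_absorb2)

lemma s_mult_psum_disjoint: "\<lbrakk>e \<in> edges H; S \<subseteq> verts H; rng H e \<inter> S = {}\<rbrakk> \<Longrightarrow> s e \<otimes> psum S = \<zero>"
  by (subst s_mult_psum) simp_all

lemma range_projection:
  assumes e: "e \<in> edges H" shows "projection A (s e \<otimes> star A (s e))"
proof -
  have "(s e \<otimes> star A (s e)) \<otimes> (s e \<otimes> star A (s e)) = (s e \<otimes> (star A (s e) \<otimes> s e)) \<otimes> star A (s e)"
    using e by (simp only: mult_assoc mult_closed star_closed s_closed)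
  then show ?thesis using e s_star_s[OF e] by (simp add: projection_def star_mult)
qed

text \<open>(HR2a) turned from an order relation into an equation by
  \<open>projection_le_absorb\<close>; all later rules for vertex sums to the left of
  \<open>s e\<close> rest on it.\<close>

lemma psum_src_mult_s [simp]:
  assumes e: "e \<in> edges H" shows "psum (src H e) \<otimes> s e = s e"
proof -
  have "psum (src H e) \<otimes> (s e \<otimes> star A (s e)) = s e \<otimes> star A (s e)"
    using family e by (intro projection_le_absorb range_projection psum_projection edge_sets)
      (auto simp: hypergraph_family_def psum_def)
  then have "psum (src H e) \<otimes> (s e \<otimes> star A (s e)) \<otimes> s e = s e \<otimes> star A (s e) \<otimes> s e" by simp
  then show ?thesis using e edge_sets[OF e] s_star_s[OF e] by (simp add: mult_assoc)
qed

lemma psum_mult_s: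
  assumes "e \<in> edges H" "S \<subseteq> verts H"
  shows "psum S \<otimes> s e = psum (S \<inter> src H e) \<otimes> s e"
proof -
  have "psum S \<otimes> s e = psum S \<otimes> (psum (src H e) \<otimes> s e)" using assms by simp
  also have "\<dots> = (psum S \<otimes> psum (src H e)) \<otimes> s e"
    using assms edge_sets[OF assms(1)] by (intro mult_assoc[symmetric]) auto
  also have "\<dots> = psum (S \<inter> src H e) \<otimes> s e"
    using assms edge_sets[OF assms(1)] by (simp add: psum_mult)
  finally show ?thesis .
qed

lemma psum_supset_mult_s: "\<lbrakk>e \<in> edges H; S \<subseteq> verts H; src H e \<subseteq> S\<rbrakk> \<Longrightarrow> psum S \<otimes> s e = s e"
  by (subst psum_mult_s) (simp_all add: Int_absorb1)

lemma psum_disjoint_mult_s: "\<lbrakk>e \<in> edges H; S \<subseteq> verts H; S \<inter> src H e = {}\<rbrakk> \<Longrightarrow> psum S \<otimes> s e = \<zero>"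
  by (subst psum_mult_s) simp_all

lemma unit:
  assumes gen: "generates A (p ` verts H \<union> s ` edges H)" and a: "a \<in> carrier A"
  shows "psum (verts H) \<otimes> a = a" "a \<otimes> psum (verts H) = a"
proof -
  define u where "u = psum (verts H)"
  have u[simp]: "u \<in> carrier A" "star A u = u" "u \<otimes> u = u"
    using projectionD[OF psum_projection[of "verts H"]] by (auto simp: u_def)
  \<comment> \<open>The equations \<open>u x = x\<close> and \<open>x u = x\<close> are written as
    preimages of \<open>{\<zero>}\<close>, which makes closedness an instance of
    \<open>calg_closed_preimage\<close>.\<close>
  let ?S = "{x \<in> carrier A. u \<otimes> x \<ominus> x \<in> {\<zero>}} \<inter> {x \<in> carrier A. x \<otimes> u \<ominus> x \<in> {\<zero>}}"
  have S: "x \<in> ?S \<longleftrightarrow> x \<in> carrier A \<and> u \<otimes> x = x \<and> x \<otimes> u = x" for x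
    by (auto simp: diff_eq_zero_iff)
  have "cstar_subalgebra A ?S"
    unfolding cstar_subalgebra_def linear_subspace_def
  proof (intro conjI ballI allI)
    show "\<zero> \<in> ?S" by auto
    show "calg_closed A ?S"
    proof (intro calg_closed_Int calg_closed_preimage[where K = "cnorm A u + 1"] calg_closed_singleton)
      fix x y assume [simp]: "x \<in> carrier A" "y \<in> carrier A"
      show "u \<otimes> (x \<ominus> y) \<ominus> (x \<ominus> y) = (u \<otimes> x \<ominus> x) \<ominus> (u \<otimes> y \<ominus> y)"
        by (simp add: expand_simps, rule lin_eqI[where xs = "[x, y, u \<otimes> x, u \<otimes> y]"], (rule lin_reps)+)
          (auto simp: All_less_Suc)
      show "(x \<ominus> y) \<otimes> u \<ominus> (x \<ominus> y) = (x \<otimes> u \<ominus> x) \<ominus> (y \<otimes> u \<ominus> y)"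
        by (simp add: expand_simps, rule lin_eqI[where xs = "[x, y, x \<otimes> u, y \<otimes> u]"], (rule lin_reps)+)
          (auto simp: All_less_Suc)
      show "cnorm A (u \<otimes> x \<ominus> x) \<le> (cnorm A u + 1) * cnorm A x"
        using cnorm_triangle_diff[of "u \<otimes> x" x] cnorm_mult[of u x] by (simp add: algebra_simps)
      show "cnorm A (x \<otimes> u \<ominus> x) \<le> (cnorm A u + 1) * cnorm A x"
        using cnorm_triangle_diff[of "x \<otimes> u" x] cnorm_mult[of x u] by (simp add: algebra_simps)
    qed auto
    fix x assume x: "x \<in> ?S"
    then have x'[simp]: "x \<in> carrier A" "u \<otimes> x = x" "x \<otimes> u = x" unfolding S by auto
    have "u \<otimes> star A x = star A (x \<otimes> u)" "star A x \<otimes> u = star A (u \<otimes> x)"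
      by (simp_all add: star_mult del: x'(2,3))
    then show "star A x \<in> ?S" unfolding S by simp
    show "c \<odot> x \<in> ?S" for c unfolding S by simp
    fix y assume y: "y \<in> ?S"
    then have y'[simp]: "y \<in> carrier A" "u \<otimes> y = y" "y \<otimes> u = y" unfolding S by auto
    show "x \<oplus> y \<in> ?S" unfolding S by (simp add: mult_add_left mult_add_right)
    show "x \<otimes> y \<in> ?S" unfolding S using mult_assoc[of u x y] by (simp add: mult_assoc)
  qed auto
  moreover have "p ` verts H \<union> s ` edges H \<subseteq> ?S"
  proof
    fix x assume "x \<in> p ` verts H \<union> s ` edges H"
    then show "x \<in> ?S"
    proof
      assume "x \<in> p ` verts H"
      then obtain v where v: "v \<in> verts H" "x = p v" by blast
      then show ?thesis
        unfolding S u_def using psum_mult[of "{v}" "verts H"] psum_mult[of "verts H" "{v}"]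
        by (simp add: psum_singleton)
    next
      assume "x \<in> s ` edges H"
      then show ?thesis
        unfolding S u_def using edge_sets by (auto simp: s_mult_psum_supset psum_supset_mult_s)
    qed
  qed
  ultimately have "a \<in> ?S" using generatesD[OF gen] a by blast
  then have "u \<otimes> a = a" "a \<otimes> u = a" unfolding S by auto
  then show "psum (verts H) \<otimes> a = a" "a \<otimes> psum (verts H) = a" unfolding u_def by auto
qed

end

section \<open>The family of the modified hypergraph and the corner it generates\<close>

locale move_R_representation = hypergraph_representation A H p s
  for A :: "'a star_algebra" (structure) and H :: "('v, 'e) hypergraph" and p :: "'v \<Rightarrow> 'a" and s :: "'e \<Rightarrow> 'a" +
  fixes w :: 'v and f :: 'e
  assumes w: "w \<in> verts H" and out_w: "{e \<in> edges H. w \<in> src H e} = {f}"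
    and src_f [simp]: "src H f = {w}" and w_notin_rng_f [simp]: "w \<notin> rng H f"
    and rng_w: "\<And>e. \<lbrakk>e \<in> edges H; w \<in> rng H e\<rbrakk> \<Longrightarrow> rng H e = {w}"
begin

abbreviation moved :: "('v, 'e move_edge) hypergraph" where
  "moved \<equiv> move_R H w f"

text \<open>On \<open>edges H - {f}\<close> this is a bijection onto the edges of
  \<open>moved\<close>, so the relations for the new hypergraph can be checked on old edges.\<close>

definition relabel :: "'e \<Rightarrow> 'e move_edge" where
  "relabel e = (if rng H e = {w} then New e else Kept e)"

definition moved_s :: "'e move_edge \<Rightarrow> 'a" where
  "moved_s e = (case e of Kept e \<Rightarrow> s e | New e \<Rightarrow> s e \<otimes> s f)"

lemma f [simp]: "f \<in> edges H"
  using out_w by auto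

lemma w_notin_src: "\<lbrakk>e \<in> edges H; e \<noteq> f\<rbrakk> \<Longrightarrow> w \<notin> src H e"
  using out_w by auto

lemma rng_f: "rng H f \<noteq> {w}"
  by (metis singletonI w_notin_rng_f)

lemma verts_moved [simp]: "verts moved = verts H - {w}"
  by (simp add: move_R_def)

lemma edges_moved: "edges moved = relabel ` (edges H - {f})"
  using rng_f by (auto simp: move_R_def relabel_def)

lemma inj_relabel: "inj_on relabel S"
  by (auto simp: inj_on_def relabel_def split: if_splits)

lemma src_relabel [simp]: "src moved (relabel e) = src H e"
  by (simp add: move_R_def relabel_def)

lemma rng_relabel [simp]: "rng moved (relabel e) = (if rng H e = {w} then rng H f else rng H e)"
  by (simp add: move_R_def relabel_def)

lemma moved_s_relabel: "moved_s (relabel e) = (if rng H e = {w} then s e \<otimes> s f else s e)"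
  by (simp add: moved_s_def relabel_def)

lemma finite_moved: "finite_hypergraph moved"
  unfolding finite_hypergraph_def edges_moved
proof (intro conjI ballI)
  fix e' assume "e' \<in> relabel ` (edges H - {f})"
  then obtain e where e: "e \<in> edges H" "e \<noteq> f" "e' = relabel e" by blast
  have "rng H e \<noteq> {}" "src H e \<noteq> {}" "rng H f \<noteq> {}"
    using finite_H f e(1) unfolding finite_hypergraph_def by blast+
  moreover have "rng H e \<subseteq> verts H - {w}" if "rng H e \<noteq> {w}"
    using that rng_w[OF e(1)] edge_sets[OF e(1)] by blast
  moreover have "rng H f \<subseteq> verts H - {w}" using edge_sets[OF f] w_notin_rng_f by blast
  moreover have "src H e \<subseteq> verts H - {w}" using w_notin_src[OF e(1,2)] edge_sets[OF e(1)] by blast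
  ultimately show "rng moved e' \<subseteq> verts moved" "rng moved e' \<noteq> {}" "src moved e' \<subseteq> verts moved" "src moved e' \<noteq> {}"
    unfolding e(3) src_relabel rng_relabel verts_moved by presburger+
qed (use finite_H in \<open>auto simp: finite_hypergraph_def\<close>)

text \<open>(HR2b) at \<open>w\<close>, which emits only \<open>f\<close>, gives \<open>p w\<close>
  absorbed by \<open>s_f s_f^*\<close>; (HR2a) with source \<open>{w}\<close> gives the converse
  absorption.\<close>

lemma s_f_star: "s f \<otimes> star A (s f) = p w"
proof -
  have pws: "p w \<otimes> s f = s f" using psum_src_mult_s[OF f] w by (simp add: psum_singleton)
  have "\<not> sink H w" by (auto simp: sink_def intro!: bexI[of _ f])
  then have "cstar_le A (p w) (\<Oplus>e\<in>{e \<in> edges H. w \<in> src H e}. s e \<otimes> star A (s e))"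
    using family w by (simp add: hypergraph_family_def)
  then have "cstar_le A (p w) (s f \<otimes> star A (s f))"
    unfolding out_w by (subst (asm) M.finsum_insert) auto
  from projection_le_absorb(2)[OF p_projection[OF w] range_projection[OF f] this]
  have "p w \<otimes> (s f \<otimes> star A (s f)) = p w" .
  then show ?thesis using pws w by (simp flip: mult_assoc)
qed

text \<open>If \<open>rng H e = {w}\<close>, the inner \<open>s_e^* s_e\<close> is
  \<open>p w\<close>, the source projection of \<open>f\<close>, and what remains is
  \<open>s_f^* s_f\<close>.\<close>

lemma star_moved_s:
  assumes "e \<in> edges H" "e' \<in> edges H"
  shows "star A (moved_s (relabel e)) \<otimes> moved_s (relabel e')
    = (if e = e' then psum (rng moved (relabel e)) else \<zero>)"
proof (cases "e = e'")
  case True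
  have "star A (s f) \<otimes> (star A (s e) \<otimes> (s e \<otimes> s f)) = psum (rng H f)" if "rng H e = {w}"
  proof -
    have "star A (s e) \<otimes> (s e \<otimes> s f) = psum (src H f) \<otimes> s f"
      using that assms by (simp add: star_s_s flip: mult_assoc)
    then show ?thesis using star_s_s[OF f] psum_src_mult_s[OF f] by (simp del: src_f)
  qed
  then show ?thesis using assms True by (simp add: moved_s_relabel star_s_s star_mult mult_assoc)
next
  case False
  have "star A (s e) \<otimes> s e' = \<zero>" using star_s_s_distinct assms False by simp
  moreover from this have "star A (s e) \<otimes> (s e' \<otimes> z) = \<zero>" if "z \<in> carrier A" for z
    using that assms by (simp flip: mult_assoc)
  ultimately show ?thesis using assms False by (simp add: moved_s_relabel star_mult mult_assoc)
qed

text \<open>If \<open>rng H e = {w}\<close>, the inner \<open>s_f s_f^*\<close> is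
  \<open>p w\<close>, which \<open>s e\<close> absorbs. Range projections and sources are thus
  unchanged, so (HR2a) and (HR2b) carry over to the new family.\<close>

lemma moved_s_star:
  assumes e: "e \<in> edges H"
  shows "moved_s (relabel e) \<otimes> star A (moved_s (relabel e)) = s e \<otimes> star A (s e)"
proof -
  have "(s e \<otimes> s f) \<otimes> star A (s e \<otimes> s f) = s e \<otimes> star A (s e)" if "rng H e = {w}"
  proof -
    have "(s e \<otimes> s f) \<otimes> star A (s e \<otimes> s f) = s e \<otimes> ((s f \<otimes> star A (s f)) \<otimes> star A (s e))"
      using e by (simp add: star_mult mult_assoc)
    also have "\<dots> = (s e \<otimes> psum (rng H e)) \<otimes> star A (s e)"
      using e w that unfolding s_f_star by (simp add: psum_singleton mult_assoc)
    finally show ?thesis using e by simp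
  qed
  then show ?thesis by (simp add: moved_s_relabel)
qed

lemma moved_s_closed [simp]: "e \<in> edges H \<Longrightarrow> moved_s (relabel e) \<in> carrier A"
  by (simp add: moved_s_relabel)

lemma moved_family: "hypergraph_family moved A p moved_s"
  unfolding hypergraph_family_def
proof (intro conjI ballI impI)
  fix v assume v: "v \<in> verts moved"
  then show "projection A (p v)" by (simp add: p_projection)
  fix u assume "u \<in> verts moved" "v \<noteq> u"
  with v show "p v \<otimes> p u = \<zero>" by (simp add: p_orthogonal)
next
  fix e' assume "e' \<in> edges moved"
  then obtain e where e: "e \<in> edges H" "e \<noteq> f" "e' = relabel e" by (auto simp: edges_moved)
  have "s e \<otimes> (star A (s e) \<otimes> moved_s (relabel e)) = moved_s (relabel e)"
    using e s_star_s[OF e(1)] by (simp add: moved_s_relabel flip: mult_assoc)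
  then show "partial_isometry A (moved_s e')"
    using e by (simp add: partial_isometry_def moved_s_star mult_assoc)
  show "cstar_le A (moved_s e' \<otimes> star A (moved_s e')) (\<Oplus>v\<in>src moved e'. p v)"
    using family e by (simp add: moved_s_star hypergraph_family_def)
  fix e'' assume "e'' \<in> edges moved"
  then obtain e2 where e2: "e2 \<in> edges H" "e'' = relabel e2" by (auto simp: edges_moved)
  show "star A (moved_s e') \<otimes> moved_s e'' = (if e' = e'' then \<Oplus>v\<in>rng moved e'. p v else \<zero>)"
    using star_moved_s[OF e(1) e2(1)] inj_relabel[of UNIV] e(3) e2(2)
    by (auto simp: psum_def dest: injD)
next
  fix v assume v: "v \<in> verts moved" "\<not> sink moved v"
  let ?E = "{e \<in> edges H. v \<in> src H e}"
  have E: "{e \<in> edges moved. v \<in> src moved e} = relabel ` ?E"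
    using v(1) unfolding edges_moved by (auto simp: image_iff)
  have "\<not> sink H v" using v(2) by (auto simp: sink_def edges_moved)
  then have "cstar_le A (p v) (\<Oplus>e\<in>?E. s e \<otimes> star A (s e))"
    using family v(1) by (simp add: hypergraph_family_def)
  also have "(\<Oplus>e\<in>?E. s e \<otimes> star A (s e)) = (\<Oplus>e\<in>?E. moved_s (relabel e) \<otimes> star A (moved_s (relabel e)))"
    by (intro M.finsum_cong') (auto simp: moved_s_star)
  also have "\<dots> = (\<Oplus>e\<in>relabel ` ?E. moved_s e \<otimes> star A (moved_s e))"
    by (rule M.finsum_reindex[symmetric]) (auto simp: inj_relabel)
  finally show "cstar_le A (p v) (\<Oplus>e\<in>{e \<in> edges moved. v \<in> src moved e}. moved_s e \<otimes> star A (moved_s e))"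
    unfolding E .
qed

lemma corner_subset:
  assumes gen: "generates A (p ` verts H \<union> s ` edges H)"
    and C: "cstar_subalgebra A C" and pC: "\<And>v. \<lbrakk>v \<in> verts H; v \<noteq> w\<rbrakk> \<Longrightarrow> p v \<in> C"
    and sC: "\<And>e. \<lbrakk>e \<in> edges H; e \<noteq> f\<rbrakk> \<Longrightarrow> moved_s (relabel e) \<in> C"
    and a: "a \<in> carrier A"
  shows "psum (verts H - {w}) \<otimes> (a \<otimes> psum (verts H - {w})) \<in> C"
proof -
  define P where "P = psum (verts H - {w})"
  have P[simp]: "P \<in> carrier A" "star A P = P" "P \<otimes> P = P"
    using projectionD[OF psum_projection[of "verts H - {w}"]] by (auto simp: P_def)
  have CA: "x \<in> carrier A" if "x \<in> C" for x
    using C that by (auto simp: cstar_subalgebra_def linear_subspace_def)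
  have C0: "\<zero> \<in> C" and C_add: "\<And>x y. \<lbrakk>x \<in> C; y \<in> C\<rbrakk> \<Longrightarrow> x \<oplus> y \<in> C"
    and C_scale: "\<And>c x. x \<in> C \<Longrightarrow> c \<odot> x \<in> C"
    and C_mult: "\<And>x y. \<lbrakk>x \<in> C; y \<in> C\<rbrakk> \<Longrightarrow> x \<otimes> y \<in> C"
    and C_star: "\<And>x. x \<in> C \<Longrightarrow> star A x \<in> C" and C_closed: "calg_closed A C"
    using C by (auto simp: cstar_subalgebra_def linear_subspace_def)
  have psumC: "psum S \<in> C" if "S \<subseteq> verts H - {w}" for S
  proof -
    have "S \<subseteq> verts H" using that by auto
    then show ?thesis using that
      by (induction S rule: psum_induct) (auto simp: psum_insert C0 intro: C_add pC)
  qed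
  have rng_f_C: "psum (rng H f) \<in> C" using psumC edge_sets(1)[OF f] w_notin_rng_f by blast
  \<comment> \<open>\<open>P\<close> is doubled so that both summands have the form
    \<open>l l^* x\<close> with \<open>l\<close> in \<open>{P, s f}\<close>.\<close>
  have split: "x = P \<otimes> (P \<otimes> x) \<oplus> s f \<otimes> (star A (s f) \<otimes> x)" if "x \<in> carrier A" for x
  proof -
    have "psum (verts H) = p w \<oplus> P"
      unfolding P_def using psum_insert[of w "verts H - {w}"] w by (simp add: insert_absorb)
    then have "x = (p w \<oplus> P) \<otimes> x" using unit(1)[OF gen that] by simp
    also have "\<dots> = P \<otimes> (P \<otimes> x) \<oplus> s f \<otimes> (star A (s f) \<otimes> x)"
      using that w by (simp add: mult_add_left M.a_comm flip: mult_assoc s_f_star)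
    finally show ?thesis .
  qed
  have P_s[simp]: "P \<otimes> s e = s e" "star A (s e) \<otimes> P = star A (s e)" if e: "e \<in> edges H" "e \<noteq> f" for e
  proof -
    have "src H e \<subseteq> verts H - {w}" using w_notin_src[OF e] edge_sets[OF e(1)] by auto
    then show 1: "P \<otimes> s e = s e" unfolding P_def using e by (intro psum_supset_mult_s) auto
    show "star A (s e) \<otimes> P = star A (s e)" using arg_cong[OF 1, of "star A"] e by (simp add: star_mult)
  qed
  have P_sf[simp]: "P \<otimes> s f = \<zero>" unfolding P_def by (intro psum_disjoint_mult_s) auto
  have "star A (P \<otimes> s f) = star A (s f) \<otimes> P" by (simp add: star_mult del: P_sf)
  then have sf_P[simp]: "star A (s f) \<otimes> P = \<zero>" by simp
  have s_P[simp]: "s e \<otimes> P = (if rng H e = {w} then \<zero> else s e)" if e: "e \<in> edges H" for e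
  proof (cases "rng H e = {w}")
    case True
    then have "s e \<otimes> P = \<zero>" unfolding P_def using e by (intro s_mult_psum_disjoint) auto
    with True show ?thesis by simp
  next
    case False
    then have "rng H e \<subseteq> verts H - {w}" using rng_w[OF e] edge_sets[OF e] by blast
    then have "s e \<otimes> P = s e" unfolding P_def using e by (intro s_mult_psum_supset) auto
    with False show ?thesis by simp
  qed
  have pw_sf: "p w \<otimes> s f = s f" using psum_src_mult_s[OF f] w by (simp add: psum_singleton)
  have sf_s[simp]: "star A (s f) \<otimes> s e = \<zero>" if "e \<in> edges H" "e \<noteq> f" for e
    using star_s_s_distinct that by simp
  have s_sf: "s e \<otimes> s f = \<zero>" if e: "e \<in> edges H" and "rng H e \<noteq> {w}" for e
  proof -
    have "s e \<otimes> psum {w} = \<zero>" using that rng_w[OF e] w by (intro s_mult_psum_disjoint) auto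
    then have "s e \<otimes> p w \<otimes> s f = \<zero>" using w by (simp add: psum_singleton)
    then show ?thesis using e w by (simp add: mult_assoc pw_sf)
  qed
  \<comment> \<open>\<open>S l r\<close> constrains one entry of \<open>x\<close> in the 2 by 2
    matrix picture belonging to \<open>P\<close> and \<open>s f\<close>; by \<open>split\<close>,
    products are computed by matrix multiplication.\<close>
  define S where "S l r = {x \<in> carrier A. star A l \<otimes> (x \<otimes> r) \<in> C}" for l r
  have S_closed: "calg_closed A (S l r)" if [simp]: "l \<in> carrier A" "r \<in> carrier A" for l r
    unfolding S_def
  proof (rule calg_closed_preimage[where K = "cnorm A l * cnorm A r", OF _ _ _ C_closed])
    fix x assume [simp]: "x \<in> carrier A"
    have "cnorm A (star A l \<otimes> (x \<otimes> r)) \<le> cnorm A l * cnorm A (x \<otimes> r)"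
      using cnorm_mult[of "star A l" "x \<otimes> r"] by simp
    also have "\<dots> \<le> cnorm A l * (cnorm A x * cnorm A r)"
      by (intro mult_left_mono cnorm_mult) (auto simp: cnorm_nonneg)
    finally show "cnorm A (star A l \<otimes> (x \<otimes> r)) \<le> cnorm A l * cnorm A r * cnorm A x" by (simp add: mult_ac)
  qed (auto simp: expand_simps)
  let ?L = "{P, s f}"
  let ?S = "S P P \<inter> S P (s f) \<inter> (S (s f) P \<inter> S (s f) (s f))"
  have S: "x \<in> ?S \<longleftrightarrow> x \<in> carrier A \<and> (\<forall>l\<in>?L. \<forall>r\<in>?L. star A l \<otimes> (x \<otimes> r) \<in> C)" for x
    by (auto simp: S_def)
  have L: "l \<in> carrier A" if "l \<in> ?L" for l using that by auto
  have "cstar_subalgebra A ?S"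
    unfolding cstar_subalgebra_def linear_subspace_def
  proof (intro conjI ballI allI)
    show "?S \<subseteq> carrier A" by (auto simp: S_def)
    show "\<zero> \<in> ?S" unfolding S using L C0 by auto
    show "calg_closed A ?S" by (intro calg_closed_Int S_closed) auto
    fix x assume "x \<in> ?S"
    then have x[simp]: "x \<in> carrier A" and xC: "\<And>l r. \<lbrakk>l \<in> ?L; r \<in> ?L\<rbrakk> \<Longrightarrow> star A l \<otimes> (x \<otimes> r) \<in> C"
      unfolding S by auto
    have "star A l \<otimes> (star A x \<otimes> r) \<in> C" if "l \<in> ?L" "r \<in> ?L" for l r
      using C_star[OF xC[OF that(2,1)]] L[OF that(1)] L[OF that(2)] by (simp add: star_mult mult_assoc)
    then show "star A x \<in> ?S" unfolding S by auto
    have "star A l \<otimes> ((c \<odot> x) \<otimes> r) \<in> C" if "l \<in> ?L" "r \<in> ?L" for l r c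
      using C_scale[OF xC[OF that], of c] L[OF that(1)] L[OF that(2)] by simp
    then show "c \<odot> x \<in> ?S" for c unfolding S by auto
    fix y assume "y \<in> ?S"
    then have y[simp]: "y \<in> carrier A" and yC: "\<And>l r. \<lbrakk>l \<in> ?L; r \<in> ?L\<rbrakk> \<Longrightarrow> star A l \<otimes> (y \<otimes> r) \<in> C"
      unfolding S by auto
    have "star A l \<otimes> ((x \<oplus> y) \<otimes> r) \<in> C" if "l \<in> ?L" "r \<in> ?L" for l r
      using C_add[OF xC[OF that] yC[OF that]] L[OF that(1)] L[OF that(2)]
      by (simp add: mult_add_left mult_add_right)
    then show "x \<oplus> y \<in> ?S" unfolding S by auto
    have "star A l \<otimes> ((x \<otimes> y) \<otimes> r) \<in> C" if lr: "l \<in> ?L" "r \<in> ?L" for l r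
    proof -
      note [simp] = L[OF lr(1)] L[OF lr(2)]
      have "star A l \<otimes> ((x \<otimes> y) \<otimes> r) = star A l \<otimes> (x \<otimes> (y \<otimes> r))" by (simp add: mult_assoc)
      also have "\<dots> = star A l \<otimes> (x \<otimes> (P \<otimes> (P \<otimes> (y \<otimes> r)) \<oplus> s f \<otimes> (star A (s f) \<otimes> (y \<otimes> r))))"
        using split[of "y \<otimes> r"] by simp
      also have "\<dots> = (star A l \<otimes> (x \<otimes> P)) \<otimes> (star A P \<otimes> (y \<otimes> r))
          \<oplus> (star A l \<otimes> (x \<otimes> s f)) \<otimes> (star A (s f) \<otimes> (y \<otimes> r))"
        by (simp add: mult_add_right mult_assoc)
      also have "\<dots> \<in> C" using lr by (intro C_add C_mult xC yC) auto
      finally show ?thesis .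
    qed
    then show "x \<otimes> y \<in> ?S" unfolding S by auto
  qed
  moreover have "p ` verts H \<union> s ` edges H \<subseteq> ?S"
  proof
    fix x assume "x \<in> p ` verts H \<union> s ` edges H"
    then consider v where "v \<in> verts H" "v \<noteq> w" "x = p v" | "x = p w"
      | e where "e \<in> edges H" "e \<noteq> f" "x = s e" | "x = s f" by blast
    then show "x \<in> ?S"
    proof cases
      case (1 v)
      have "P \<otimes> p v = p v" "p v \<otimes> P = p v"
        unfolding P_def using 1 psum_mult[of "verts H - {w}" "{v}"] psum_mult[of "{v}" "verts H - {w}"]
        by (simp_all add: psum_singleton)
      moreover have "p v \<otimes> s f = \<zero>"
        using 1 psum_disjoint_mult_s[of f "{v}"] by (simp add: psum_singleton)
      ultimately show ?thesis unfolding S using 1 pC by (simp add: C0) (metis P_sf sf_P C0 p_simps(1) mult_assoc f s_closed star_closed P(1) mult_zero_left)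
    next
      case 2
      \<comment> \<open>The only entry left is \<open>s_f^* p w s_f = psum (rng H f)\<close>, which
        lies in \<open>C\<close> because \<open>w\<close> is not in the range of
        \<open>f\<close>.\<close>
      have "p w \<otimes> P = \<zero>" unfolding P_def using w by (simp add: p_mult_psum)
      then show ?thesis unfolding S using 2 w star_s_s[OF f] rng_f_C
        by (auto simp: pw_sf C0)
    next
      case (3 e)
      \<comment> \<open>One of these two entries is \<open>moved_s (relabel e)\<close> and the other
        is zero; which is which depends on whether \<open>e\<close> ends at
        \<open>w\<close>.\<close>
      have "s e \<otimes> P \<in> C" "s e \<otimes> s f \<in> C"
        using sC[OF 3(1,2)] 3 s_sf C0 by (auto simp: moved_s_relabel split: if_splits)
      moreover have "star A (s f) \<otimes> (s e \<otimes> z) = \<zero>" "P \<otimes> (s e \<otimes> z) = s e \<otimes> z" if "z \<in> carrier A" for z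
        using 3 that by (simp_all flip: mult_assoc)
      ultimately show ?thesis unfolding S using 3 C0 by (cases "rng H e = {w}") simp_all
    next
      case 4
      have "s f \<otimes> P = s f" using rng_f by simp
      moreover have "star A (s f) \<otimes> (s f \<otimes> s f) = \<zero>" "P \<otimes> (s f \<otimes> s f) = \<zero>"
        using s_sf[OF f rng_f] by simp_all
      ultimately show ?thesis unfolding S using 4 star_s_s[OF f] rng_f_C C0
        by auto
    qed
  qed
  ultimately have "a \<in> ?S" using generatesD[OF gen] a by blast
  then have "star A P \<otimes> (a \<otimes> P) \<in> C" unfolding S by blast
  then show ?thesis by (simp add: P_def[symmetric])
qed

text \<open>The edge \<open>e\<close> differs from \<open>f\<close>, so its source avoids
  \<open>w\<close> and the source sum lies in \<open>I\<close>. Multiplying it by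
  \<open>s_e^*\<close> and \<open>s_e\<close> yields \<open>p w\<close>, and with it the unit lies
  in \<open>I\<close>.\<close>

lemma ideal_full:
  assumes gen: "generates A (p ` verts H \<union> s ` edges H)"
    and I: "closed_ideal A I" and pI: "\<And>v. \<lbrakk>v \<in> verts H; v \<noteq> w\<rbrakk> \<Longrightarrow> p v \<in> I"
    and e: "e \<in> edges H" "w \<in> rng H e"
  shows "I = carrier A"
proof -
  have IA: "I \<subseteq> carrier A" and I0: "\<zero> \<in> I" and I_add: "\<And>x y. \<lbrakk>x \<in> I; y \<in> I\<rbrakk> \<Longrightarrow> x \<oplus> y \<in> I"
    and I_l: "\<And>a x. \<lbrakk>a \<in> carrier A; x \<in> I\<rbrakk> \<Longrightarrow> a \<otimes> x \<in> I"
    and I_r: "\<And>a x. \<lbrakk>a \<in> carrier A; x \<in> I\<rbrakk> \<Longrightarrow> x \<otimes> a \<in> I"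
    using I by (auto simp: closed_ideal_def linear_subspace_def)
  have psumI: "psum S \<in> I" if S: "S \<subseteq> verts H" "\<And>v. v \<in> S \<Longrightarrow> p v \<in> I" for S
    using S by (induction S rule: psum_induct) (auto simp: psum_insert I0 intro: I_add)
  have "e \<noteq> f" using e by auto
  then have "psum (src H e) \<in> I"
    using edge_sets[OF e(1)] w_notin_src[OF e(1)] by (intro psumI pI) auto
  then have "star A (s e) \<otimes> (psum (src H e) \<otimes> s e) \<in> I" using e by (intro I_l I_r) auto
  then have "p w \<in> I" using e rng_w[OF e] w by (simp add: star_s_s psum_singleton)
  then have "psum (verts H) \<in> I" using pI by (intro psumI) auto
  then have "a \<in> I" if "a \<in> carrier A" for a using I_r[OF that, of "psum (verts H)"] unit(1)[OF gen that] by simp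
  with IA show ?thesis by blast
qed

end

theorem proposition6p8:
  fixes H :: "('v, 'e) hypergraph" and w x :: 'v and f :: 'e
    and A :: "'a star_algebra" and p :: "'v \<Rightarrow> 'a" and s :: "'e \<Rightarrow> 'a"
    and B :: "'b star_algebra" and q :: "'v \<Rightarrow> 'b" and t :: "'e move_edge \<Rightarrow> 'b"
  assumes "finite_hypergraph H"
    and "w \<in> verts H"
    and "{e \<in> edges H. w \<in> src H e} = {f}"
    and "{v \<in> verts H. emits_to H v w} = {x}" and "x \<noteq> w"
    and "locally_ultra H w"
    and "\<forall>e\<in>edges H. w \<in> rng H e \<longrightarrow> rng H e = {w}"
    and "is_hypergraph_algebra H A p s"
    and "is_hypergraph_algebra (move_R H w f) B q t"
  shows "\<exists>\<pi>. cstar_hom B A \<pi> \<and> full_corner A (\<pi> ` carrier B)"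
proof -
  have A: "cstar_algebra A" and famA: "hypergraph_family H A p s"
    and genA: "generates A (p ` verts H \<union> s ` edges H)"
    using assms(8) by (auto simp: is_hypergraph_algebra_def)
  have B: "cstar_algebra B" and famB: "hypergraph_family (move_R H w f) B q t"
    and genB: "generates B (q ` verts (move_R H w f) \<union> t ` edges (move_R H w f))"
    using assms(9) by (auto simp: is_hypergraph_algebra_def)
  have f: "f \<in> edges H" "w \<in> src H f" using assms(3) by auto
  \<comment> \<open>Otherwise \<open>w\<close> would emit to itself, whereas the only vertex
    emitting to \<open>w\<close> is \<open>x \<noteq> w\<close>.\<close>
  have "w \<notin> rng H f"
  proof
    assume "w \<in> rng H f"
    with f assms(2) have "w \<in> {v \<in> verts H. emits_to H v w}" by (auto simp: emits_to_def)
    with assms(4,5) show False by auto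
  qed
  moreover have "src H f = {w}" using assms(6) f by (auto simp: locally_ultra_def)
  ultimately interpret move_R_representation A H p s w f
    using assms(1-3,7) A famA
    by (intro move_R_representation.intro hypergraph_representation.intro
        hypergraph_representation_axioms.intro move_R_representation_axioms.intro) auto
  interpret B: hypergraph_representation B moved q t
    by (intro hypergraph_representation.intro hypergraph_representation_axioms.intro B finite_moved famB)
  have "countable (p ` verts H \<union> s ` edges H)"
    using assms(1) by (auto simp: finite_hypergraph_def intro: countable_finite)
  from hypergraph_algebra_universal[OF finite_moved assms(9) A this genA moved_family]
  obtain \<pi> where \<pi>: "cstar_hom B A \<pi>" "\<And>v. v \<in> verts moved \<Longrightarrow> \<pi> (q v) = p v"
    "\<And>e. e \<in> edges moved \<Longrightarrow> \<pi> (t e) = moved_s e" by blast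
  interpret \<pi>: cstar_homomorphism B A \<pi>
    by (intro cstar_homomorphism.intro cstar_homomorphism_axioms.intro A B \<pi>(1))
  let ?C = "\<pi> ` carrier B" and ?P = "psum (verts H - {w})"
  have pC: "p v \<in> ?C" if "v \<in> verts H" "v \<noteq> w" for v
    using \<pi>(2)[of v] that B.p_simps(1)[of v] by (metis Diff_iff imageI singletonD verts_moved)
  have sC: "moved_s (relabel e) \<in> ?C" if "e \<in> edges H" "e \<noteq> f" for e
  proof -
    have "relabel e \<in> edges moved" using that by (auto simp: edges_moved)
    then show ?thesis using \<pi>(3) B.s_closed by (metis imageI)
  qed
  have P: "projection A ?P" by (rule psum_projection) auto
  \<comment> \<open>The unit of \<open>B\<close> is sent to \<open>?P\<close>, which places the
    image inside the corner; \<open>corner_subset\<close> gives the reverse inclusion.\<close>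
  have \<pi>_unit: "\<pi> (B.psum (verts moved)) = ?P"
  proof -
    have "\<pi> (B.psum (verts moved)) = (\<Oplus>\<^bsub>A\<^esub>v\<in>verts moved. \<pi> (q v))"
      unfolding B.psum_def using finite_subset_verts by (intro \<pi>.hom_finsum) auto
    also have "\<dots> = (\<Oplus>\<^bsub>A\<^esub>v\<in>verts moved. p v)"
      using \<pi>(2) by (intro M.finsum_cong') auto
    finally show ?thesis by (simp add: psum_def)
  qed
  have "?C = {?P \<otimes>\<^bsub>A\<^esub> a \<otimes>\<^bsub>A\<^esub> ?P | a. a \<in> carrier A}"
  proof (intro equalityI subsetI)
    fix y assume "y \<in> ?C"
    then obtain b where b: "b \<in> carrier B" "y = \<pi> b" by blast
    have "b = (B.psum (verts moved) \<otimes>\<^bsub>B\<^esub> b) \<otimes>\<^bsub>B\<^esub> B.psum (verts moved)"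
      using B.unit[OF genB b(1)] by simp
    from arg_cong[OF this, of \<pi>] have "y = ?P \<otimes>\<^bsub>A\<^esub> y \<otimes>\<^bsub>A\<^esub> ?P"
      using b \<pi>_unit B.psum_closed[of "verts moved"] by (simp del: verts_moved)
    with b show "y \<in> {?P \<otimes>\<^bsub>A\<^esub> a \<otimes>\<^bsub>A\<^esub> ?P | a. a \<in> carrier A}" by auto
  next
    fix y assume "y \<in> {?P \<otimes>\<^bsub>A\<^esub> a \<otimes>\<^bsub>A\<^esub> ?P | a. a \<in> carrier A}"
    then obtain a where "a \<in> carrier A" "y = ?P \<otimes>\<^bsub>A\<^esub> a \<otimes>\<^bsub>A\<^esub> ?P" by blast
    then show "y \<in> ?C"
      using corner_subset[OF genA \<pi>.image_subalgebra pC sC] by (simp add: mult_assoc)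
  qed
  then have "corner A ?C" unfolding corner_def using P by blast
  moreover have "I = carrier A" if I: "closed_ideal A I" "?C \<subseteq> I" for I
  proof -
    \<comment> \<open>The vertex \<open>x\<close> supplies the edge into \<open>w\<close> on which
      fullness rests.\<close>
    have "x \<in> {v \<in> verts H. emits_to H v w}" using assms(4) by blast
    then obtain e where "e \<in> edges H" "w \<in> rng H e" by (auto simp: emits_to_def)
    then show ?thesis using ideal_full[OF genA I(1)] pC I(2) by blast
  qed
  ultimately show ?thesis using \<pi>(1) unfolding full_corner_def by blast
qed

end
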